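(* Let $P$ be a poset and $\mathbb F$ a field. For $x\in P$ write $\downarrow\! x:=\{y\in P\mid y\le x\}$. Then the following hold. (1) The category $\operatorname{rep}(P,\mathbb F)$ is abelian and all its objects are of finite length if and only if for each $x\in P$ the set $\downarrow\! x$ is finite. (2) The category $\operatorname{rep}(P,\mathbb F)$ is abelian and all its objects are noetherian if and only if for each $x\in P$ all ascending chains of ideals of $\downarrow\! x$ stabilise.
   Context: An ideal of a poset $Q$ is a subset $I\subseteq Q$ that is downward closed: $x\le y$ in $Q$ and $y\in I$ imply $x\in I$ (no further condition, such as directedness or non-emptiness, is imposed). Ideals are ordered by inclusion. A poset $P$ is viewed as a category with a unique morphism $x\to y$ if and only if $x\le y$. Its $\mathbb F$-linearisation $\mathbb FP$ has the same objects, and $\operatorname{Hom}_{\mathbb FP}(x,y)$ is the $\mathbb F$-vector space with basis $\operatorname{Hom}_P(x,y)$ (so it is $\mathbb F$ if $x\le y$ and $0$ otherwise), with bilinear composition. $\operatorname{Rep}(P,\mathbb F)$ is the category of additive functors $(\mathbb FP)^{\mathrm{op}}\to\mathrm{Ab}$, equivalently of contravariant functors from $P$ to $\mathbb F$-vector spaces. $\operatorname{rep}(P,\mathbb F)$ is its full subcategory of finitely presented functors, i.e. cokernels of morphisms between finite direct sums of representable functors $h_x=\operatorname{Hom}_{\mathbb FP}(-,x)$, $x\in P$. The notions "finite length" and "noetherian" refer to subobjects in the category $\operatorname{rep}(P,\mathbb F)$. *)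

theory Defs
  imports "HOL-Algebra.Module"
begin

section \<open>Abelian categories\<close>

text \<open>
  \<open>Comp C X Y Z g f\<close> is the composite of \<open>f : X \<rightarrow> Y\<close> and \<open>g : Y \<rightarrow> Z\<close>.  The objects are passed
  explicitly because the sets \<open>Hom C X Y\<close> need not be disjoint.
\<close>

record ('o, 'm) category =
  Obj :: "'o set"
  Hom :: "'o \<Rightarrow> 'o \<Rightarrow> 'm set"
  Comp :: "'o \<Rightarrow> 'o \<Rightarrow> 'o \<Rightarrow> 'm \<Rightarrow> 'm \<Rightarrow> 'm"
  Id :: "'o \<Rightarrow> 'm"
  Add :: "'o \<Rightarrow> 'o \<Rightarrow> 'm \<Rightarrow> 'm \<Rightarrow> 'm"
  Zero :: "'o \<Rightarrow> 'o \<Rightarrow> 'm"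

definition full_subcategory :: "('o, 'm) category \<Rightarrow> ('o \<Rightarrow> bool) \<Rightarrow> ('o, 'm) category" where
  "full_subcategory C Q = C\<lparr>Obj := {X \<in> Obj C. Q X}\<rparr>"

text \<open>The group of morphisms is written multiplicatively only to make \<open>comm_group\<close> and \<open>finprod\<close> available.\<close>

definition hom_group :: "('o, 'm) category \<Rightarrow> 'o \<Rightarrow> 'o \<Rightarrow> 'm monoid" where
  "hom_group C X Y = \<lparr>carrier = Hom C X Y, monoid.mult = Add C X Y, one = Zero C X Y\<rparr>"

locale preadditive_category =
  fixes C :: "('o, 'm) category"
  assumes id_closed: "X \<in> Obj C \<Longrightarrow> Id C X \<in> Hom C X X"
    and comp_closed: "\<lbrakk>X \<in> Obj C; Y \<in> Obj C; Z \<in> Obj C; f \<in> Hom C X Y; g \<in> Hom C Y Z\<rbrakk>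
      \<Longrightarrow> Comp C X Y Z g f \<in> Hom C X Z"
    and comp_id: "\<lbrakk>X \<in> Obj C; Y \<in> Obj C; f \<in> Hom C X Y\<rbrakk> \<Longrightarrow> Comp C X X Y f (Id C X) = f"
    and id_comp: "\<lbrakk>X \<in> Obj C; Y \<in> Obj C; f \<in> Hom C X Y\<rbrakk> \<Longrightarrow> Comp C X Y Y (Id C Y) f = f"
    and comp_assoc: "\<lbrakk>W \<in> Obj C; X \<in> Obj C; Y \<in> Obj C; Z \<in> Obj C;
        f \<in> Hom C W X; g \<in> Hom C X Y; h \<in> Hom C Y Z\<rbrakk>
      \<Longrightarrow> Comp C W X Z (Comp C X Y Z h g) f = Comp C W Y Z h (Comp C W X Y g f)"
    and hom_comm_group: "\<lbrakk>X \<in> Obj C; Y \<in> Obj C\<rbrakk> \<Longrightarrow> comm_group (hom_group C X Y)"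
    and comp_add_left: "\<lbrakk>X \<in> Obj C; Y \<in> Obj C; Z \<in> Obj C;
        f \<in> Hom C X Y; g \<in> Hom C Y Z; g' \<in> Hom C Y Z\<rbrakk>
      \<Longrightarrow> Comp C X Y Z (Add C Y Z g g') f = Add C X Z (Comp C X Y Z g f) (Comp C X Y Z g' f)"
    and comp_add_right: "\<lbrakk>X \<in> Obj C; Y \<in> Obj C; Z \<in> Obj C;
        f \<in> Hom C X Y; f' \<in> Hom C X Y; g \<in> Hom C Y Z\<rbrakk>
      \<Longrightarrow> Comp C X Y Z g (Add C X Y f f') = Add C X Z (Comp C X Y Z g f) (Comp C X Y Z g f')"

definition is_mono :: "('o, 'm) category \<Rightarrow> 'o \<Rightarrow> 'o \<Rightarrow> 'm \<Rightarrow> bool" where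
  "is_mono C X Y f \<longleftrightarrow> X \<in> Obj C \<and> Y \<in> Obj C \<and> f \<in> Hom C X Y \<and>
     (\<forall>Z\<in>Obj C. \<forall>g\<in>Hom C Z X. \<forall>h\<in>Hom C Z X. Comp C Z X Y f g = Comp C Z X Y f h \<longrightarrow> g = h)"

definition is_epi :: "('o, 'm) category \<Rightarrow> 'o \<Rightarrow> 'o \<Rightarrow> 'm \<Rightarrow> bool" where
  "is_epi C X Y f \<longleftrightarrow> X \<in> Obj C \<and> Y \<in> Obj C \<and> f \<in> Hom C X Y \<and>
     (\<forall>Z\<in>Obj C. \<forall>g\<in>Hom C Y Z. \<forall>h\<in>Hom C Y Z. Comp C X Y Z g f = Comp C X Y Z h f \<longrightarrow> g = h)"

definition is_iso :: "('o, 'm) category \<Rightarrow> 'o \<Rightarrow> 'o \<Rightarrow> 'm \<Rightarrow> bool" where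
  "is_iso C X Y f \<longleftrightarrow> X \<in> Obj C \<and> Y \<in> Obj C \<and> f \<in> Hom C X Y \<and>
     (\<exists>g\<in>Hom C Y X. Comp C X Y X g f = Id C X \<and> Comp C Y X Y f g = Id C Y)"

definition zero_object :: "('o, 'm) category \<Rightarrow> 'o \<Rightarrow> bool" where
  "zero_object C X \<longleftrightarrow> X \<in> Obj C \<and>
     (\<forall>Y\<in>Obj C. (\<exists>!f. f \<in> Hom C X Y) \<and> (\<exists>!f. f \<in> Hom C Y X))"

text \<open>\<open>k : K \<rightarrow> X\<close> is a kernel of \<open>f : X \<rightarrow> Y\<close>, respectively \<open>c : Y \<rightarrow> Q\<close> is a cokernel of \<open>f : X \<rightarrow> Y\<close>.\<close>

definition is_kernel :: "('o, 'm) category \<Rightarrow> 'o \<Rightarrow> 'o \<Rightarrow> 'm \<Rightarrow> 'o \<Rightarrow> 'm \<Rightarrow> bool" where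
  "is_kernel C X Y f K k \<longleftrightarrow> X \<in> Obj C \<and> Y \<in> Obj C \<and> f \<in> Hom C X Y \<and>
     K \<in> Obj C \<and> k \<in> Hom C K X \<and> Comp C K X Y f k = Zero C K Y \<and>
     (\<forall>Z\<in>Obj C. \<forall>g\<in>Hom C Z X. Comp C Z X Y f g = Zero C Z Y \<longrightarrow>
        (\<exists>!u. u \<in> Hom C Z K \<and> Comp C Z K X k u = g))"

definition is_cokernel :: "('o, 'm) category \<Rightarrow> 'o \<Rightarrow> 'o \<Rightarrow> 'm \<Rightarrow> 'o \<Rightarrow> 'm \<Rightarrow> bool" where
  "is_cokernel C X Y f Q c \<longleftrightarrow> X \<in> Obj C \<and> Y \<in> Obj C \<and> f \<in> Hom C X Y \<and>
     Q \<in> Obj C \<and> c \<in> Hom C Y Q \<and> Comp C X Y Q c f = Zero C X Q \<and>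
     (\<forall>Z\<in>Obj C. \<forall>g\<in>Hom C Y Z. Comp C X Y Z g f = Zero C X Z \<longrightarrow>
        (\<exists>!u. u \<in> Hom C Q Z \<and> Comp C Y Q Z u c = g))"

text \<open>
  \<open>S\<close> is a direct sum (biproduct) of \<open>X 0, \<dots>, X (n - 1)\<close> with injections \<open>i k\<close> and projections \<open>p k\<close>.
  For \<open>n = 0\<close> this says that the identity of \<open>S\<close> is zero.
\<close>

definition is_direct_sum ::
  "('o, 'm) category \<Rightarrow> nat \<Rightarrow> (nat \<Rightarrow> 'o) \<Rightarrow> 'o \<Rightarrow> (nat \<Rightarrow> 'm) \<Rightarrow> (nat \<Rightarrow> 'm) \<Rightarrow> bool" where
  "is_direct_sum C n X S i p \<longleftrightarrow> S \<in> Obj C \<and>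
     (\<forall>k<n. X k \<in> Obj C \<and> i k \<in> Hom C (X k) S \<and> p k \<in> Hom C S (X k)) \<and>
     (\<forall>k<n. \<forall>l<n. Comp C (X k) S (X l) (p l) (i k) =
        (if k = l then Id C (X k) else Zero C (X k) (X l))) \<and>
     finprod (hom_group C S S) (\<lambda>k. Comp C S (X k) S (i k) (p k)) {..<n} = Id C S"

locale abelian_category = preadditive_category +
  assumes finite_direct_sums: "(\<forall>k<n. Xs k \<in> Obj C) \<Longrightarrow> \<exists>S i p. is_direct_sum C n Xs S i p"
    and kernels: "\<lbrakk>X \<in> Obj C; Y \<in> Obj C; f \<in> Hom C X Y\<rbrakk> \<Longrightarrow> \<exists>K k. is_kernel C X Y f K k"
    and cokernels: "\<lbrakk>X \<in> Obj C; Y \<in> Obj C; f \<in> Hom C X Y\<rbrakk> \<Longrightarrow> \<exists>Q c. is_cokernel C X Y f Q c"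
    and mono_is_kernel: "is_mono C K Y k \<Longrightarrow> \<exists>Z g. is_kernel C Y Z g K k"
    and epi_is_cokernel: "is_epi C Y Q c \<Longrightarrow> \<exists>Z g. is_cokernel C Z Y g Q c"


section \<open>Noetherian objects and objects of finite length\<close>

text \<open>
  Subobjects of \<open>X\<close> are represented by monomorphisms into \<open>X\<close>; two of them give the same subobject
  iff each factors through the other.
\<close>

definition subobject_le :: "('o, 'm) category \<Rightarrow> 'o \<Rightarrow> 'o \<Rightarrow> 'm \<Rightarrow> 'o \<Rightarrow> 'm \<Rightarrow> bool" where
  "subobject_le C X A a B b \<longleftrightarrow> is_mono C A X a \<and> is_mono C B X b \<and>
     (\<exists>u\<in>Hom C A B. Comp C A B X b u = a)"

definition noetherian_object :: "('o, 'm) category \<Rightarrow> 'o \<Rightarrow> bool" where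
  "noetherian_object C X \<longleftrightarrow> X \<in> Obj C \<and>
     (\<forall>A a. (\<forall>n. is_mono C (A n) X (a n)) \<and>
            (\<forall>n. subobject_le C X (A n) (a n) (A (Suc n)) (a (Suc n))) \<longrightarrow>
        (\<exists>N. \<forall>n\<ge>N. subobject_le C X (A N) (a N) (A n) (a n) \<and>
                    subobject_le C X (A n) (a n) (A N) (a N)))"

definition simple_object :: "('o, 'm) category \<Rightarrow> 'o \<Rightarrow> bool" where
  "simple_object C X \<longleftrightarrow> X \<in> Obj C \<and> \<not> zero_object C X \<and>
     (\<forall>A a. is_mono C A X a \<longrightarrow> zero_object C A \<or> is_iso C A X a)"

text \<open>Finite length means existence of a composition series \<open>0 = A 0 \<subseteq> A 1 \<subseteq> \<dots> \<subseteq> A n = X\<close>.\<close>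

definition finite_length_object :: "('o, 'm) category \<Rightarrow> 'o \<Rightarrow> bool" where
  "finite_length_object C X \<longleftrightarrow> X \<in> Obj C \<and>
     (\<exists>n A a. (\<forall>k\<le>n. is_mono C (A k) X (a k)) \<and> zero_object C (A 0) \<and> is_iso C (A n) X (a n) \<and>
        (\<forall>k<n. \<exists>u\<in>Hom C (A k) (A (Suc k)).
           Comp C (A k) (A (Suc k)) X (a (Suc k)) u = a k \<and>
           (\<exists>Q c. is_cokernel C (A k) (A (Suc k)) u Q c \<and> simple_object C Q)))"


section \<open>Representations of posets\<close>

text \<open>
  A poset is a set \<open>P\<close> with \<open>partial_order_on P r\<close>, where \<open>(x, y) \<in> r\<close> means \<open>x \<le> y\<close>.
  A representation \<open>M\<close> assigns to \<open>x\<close> the \<open>F\<close>-vector space \<open>Val M x\<close>, with carrier in the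
  type \<open>'v\<close>, and to \<open>y \<le> x\<close> a linear map \<open>Res M y x\<close> from \<open>Val M x\<close> to \<open>Val M y\<close>.
\<close>

record ('p, 'f, 'v) representation =
  Val :: "'p \<Rightarrow> ('f, 'v) module"
  Res :: "'p \<Rightarrow> 'p \<Rightarrow> 'v \<Rightarrow> 'v"

definition linear_map :: "'f ring \<Rightarrow> ('f, 'v) module \<Rightarrow> ('f, 'w) module \<Rightarrow> ('v \<Rightarrow> 'w) \<Rightarrow> bool" where
  "linear_map F V W f \<longleftrightarrow> f \<in> carrier V \<rightarrow> carrier W \<and>
     (\<forall>u\<in>carrier V. \<forall>v\<in>carrier V. f (u \<oplus>\<^bsub>V\<^esub> v) = f u \<oplus>\<^bsub>W\<^esub> f v) \<and>
     (\<forall>c\<in>carrier F. \<forall>v\<in>carrier V. f (c \<odot>\<^bsub>V\<^esub> v) = c \<odot>\<^bsub>W\<^esub> f v)"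

definition is_representation ::
  "'p set \<Rightarrow> 'p rel \<Rightarrow> 'f ring \<Rightarrow> ('p, 'f, 'v) representation \<Rightarrow> bool" where
  "is_representation P r F M \<longleftrightarrow>
     (\<forall>x\<in>P. module F (Val M x)) \<and>
     (\<forall>x\<in>P. \<forall>y\<in>P. (y, x) \<in> r \<longrightarrow> linear_map F (Val M x) (Val M y) (Res M y x)) \<and>
     (\<forall>x\<in>P. \<forall>v\<in>carrier (Val M x). Res M x x v = v) \<and>
     (\<forall>x\<in>P. \<forall>y\<in>P. \<forall>z\<in>P. (y, x) \<in> r \<longrightarrow> (z, y) \<in> r \<longrightarrow>
        (\<forall>v\<in>carrier (Val M x). Res M z y (Res M y x v) = Res M z x v))"

text \<open>
  Natural transformations are made extensional, so that they are determined by their values.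
  Source and target may have different types of elements; this is used only to compare the
  functors \<open>hom_functor\<close> below with objects of the category \<open>Rep\<close>.
\<close>

definition nat_trans ::
  "'p set \<Rightarrow> 'p rel \<Rightarrow> 'f ring \<Rightarrow> ('p, 'f, 'v) representation \<Rightarrow> ('p, 'f, 'w) representation
     \<Rightarrow> ('p \<Rightarrow> 'v \<Rightarrow> 'w) set" where
  "nat_trans P r F M N =
     {\<eta> \<in> (\<Pi>\<^sub>E x\<in>P. carrier (Val M x) \<rightarrow>\<^sub>E carrier (Val N x)).
        (\<forall>x\<in>P. linear_map F (Val M x) (Val N x) (\<eta> x)) \<and>
        (\<forall>x\<in>P. \<forall>y\<in>P. (y, x) \<in> r \<longrightarrow>
           (\<forall>v\<in>carrier (Val M x). \<eta> y (Res M y x v) = Res N y x (\<eta> x v)))}"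

type_synonym ('p, 'f, 'v) rep_category =
  "(('p, 'f, 'v) representation, 'p \<Rightarrow> 'v \<Rightarrow> 'v) category"

definition Rep :: "'p set \<Rightarrow> 'p rel \<Rightarrow> 'f ring \<Rightarrow> ('p, 'f, 'v) rep_category" where
  "Rep P r F = \<lparr>
     Obj = {M. is_representation P r F M},
     Hom = nat_trans P r F,
     Comp = (\<lambda>L M N \<psi> \<phi>. \<lambda>x\<in>P. \<lambda>v\<in>carrier (Val L x). \<psi> x (\<phi> x v)),
     Id = (\<lambda>M. \<lambda>x\<in>P. \<lambda>v\<in>carrier (Val M x). v),
     Add = (\<lambda>M N \<phi> \<psi>. \<lambda>x\<in>P. \<lambda>v\<in>carrier (Val M x). \<phi> x v \<oplus>\<^bsub>Val N x\<^esub> \<psi> x v),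
     Zero = (\<lambda>M N. \<lambda>x\<in>P. \<lambda>v\<in>carrier (Val M x). \<zero>\<^bsub>Val N x\<^esub>)\<rparr>"

text \<open>
  The functor \<open>h\<^sub>x\<close>: its value at \<open>y\<close> is the vector space on the set of morphisms from \<open>y\<close> to \<open>x\<close>,
  which is \<open>F\<close> for \<open>y \<le> x\<close> and \<open>0\<close> otherwise.  Precomposition with the morphism from \<open>z\<close> to \<open>y\<close>
  sends the basis vector at \<open>y\<close> to the one at \<open>z\<close>, hence is the identity on coordinates.
\<close>

definition hom_functor :: "'p rel \<Rightarrow> 'f ring \<Rightarrow> 'p \<Rightarrow> ('p, 'f, 'f) representation" where
  "hom_functor r F x = \<lparr>
     Val = (\<lambda>y. \<lparr>carrier = (if (y, x) \<in> r then carrier F else {\<zero>\<^bsub>F\<^esub>}),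
        monoid.mult = (\<otimes>\<^bsub>F\<^esub>), one = \<one>\<^bsub>F\<^esub>, zero = \<zero>\<^bsub>F\<^esub>, add = (\<oplus>\<^bsub>F\<^esub>), smult = (\<otimes>\<^bsub>F\<^esub>)\<rparr>),
     Res = (\<lambda>z y a. a)\<rparr>"

definition representable_by ::
  "'p set \<Rightarrow> 'p rel \<Rightarrow> 'f ring \<Rightarrow> 'p \<Rightarrow> ('p, 'f, 'v) representation \<Rightarrow> bool" where
  "representable_by P r F x H \<longleftrightarrow> is_representation P r F H \<and>
     (\<exists>\<eta>\<in>nat_trans P r F (hom_functor r F x) H.
        \<forall>y\<in>P. bij_betw (\<eta> y) (carrier (Val (hom_functor r F x) y)) (carrier (Val H y)))"

definition finite_sum_of_representables ::
  "'p set \<Rightarrow> 'p rel \<Rightarrow> 'f ring \<Rightarrow> ('p, 'f, 'v) representation \<Rightarrow> bool" where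
  "finite_sum_of_representables P r F S \<longleftrightarrow>
     (\<exists>n H i p. (\<forall>k<n. \<exists>x\<in>P. representable_by P r F x (H k)) \<and> is_direct_sum (Rep P r F) n H S i p)"

definition finitely_presented ::
  "'p set \<Rightarrow> 'p rel \<Rightarrow> 'f ring \<Rightarrow> ('p, 'f, 'v) representation \<Rightarrow> bool" where
  "finitely_presented P r F M \<longleftrightarrow>
     (\<exists>A B f c. finite_sum_of_representables P r F A \<and> finite_sum_of_representables P r F B \<and>
        is_cokernel (Rep P r F) A B f M c)"

definition rep :: "'p set \<Rightarrow> 'p rel \<Rightarrow> 'f ring \<Rightarrow> ('p, 'f, 'v) rep_category" where
  "rep P r F = full_subcategory (Rep P r F) (finitely_presented P r F)"


section \<open>Ideals of posets\<close>

definition down :: "'p set \<Rightarrow> 'p rel \<Rightarrow> 'p \<Rightarrow> 'p set" where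
  "down P r x = {y \<in> P. (y, x) \<in> r}"

definition poset_ideal :: "'p set \<Rightarrow> 'p rel \<Rightarrow> 'p set \<Rightarrow> bool" where
  "poset_ideal Q r I \<longleftrightarrow> I \<subseteq> Q \<and> (\<forall>x\<in>Q. \<forall>y\<in>I. (x, y) \<in> r \<longrightarrow> x \<in> I)"

definition ascending_chains_of_ideals_stabilise :: "'p set \<Rightarrow> 'p rel \<Rightarrow> bool" where
  "ascending_chains_of_ideals_stabilise Q r \<longleftrightarrow>
     (\<forall>I :: nat \<Rightarrow> 'p set. (\<forall>n. poset_ideal Q r (I n)) \<and> (\<forall>n. I n \<subseteq> I (Suc n)) \<longrightarrow>
        (\<exists>N. \<forall>n\<ge>N. I n = I N))"

end

theory Submission
  imports Defs
begin

text \<open>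
  By the Yoneda lemma, elements of \<open>M\<close> at \<open>x\<close> are the same as maps from the representable functor \<open>h\<^sub>x\<close> to \<open>M\<close>.  All
  nonzero fibres of \<open>h\<^sub>x\<close> are copies of \<open>F\<close> with identity restrictions, so a subfunctor of \<open>h\<^sub>x\<close> is the same thing as
  an ideal of the down-set of \<open>x\<close>: the set of points where it does not vanish.  Everything below is a comparison
  of generators and subobjects of finitely presented functors with generators and chains of such ideals.

  Suppose that ascending chains of ideals of each down-set stabilise.  Then every subrepresentation of a finitely
  generated representation is finitely generated (\<open>subrep_fin_gen\<close>): peeling off one generator \<open>v\<close> at \<open>x\<close>, the points
  over which the subrepresentation contains an element with nonzero \<open>v\<close>-coefficient form an ideal of the down-set
  of \<open>x\<close>, and finitely many elements over the maximal points of that ideal suffice.  Hence finitely presented means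
  finitely generated (\<open>fp_iff_fg\<close>).  This class is closed under subobjects, quotients and finite sums, so it
  is abelian with all constructions made fibrewise (\<open>fg_abelian\<close>), and its objects are noetherian because
  the union of a chain of subobjects is finitely generated (\<open>fg_noetherian\<close>).

  Conversely, a chain of ideals that does not stabilise gives a sequence \<open>z\<close> in the down-set of \<open>x\<close> in which no member
  lies below an earlier one.  The quotient of \<open>h\<^sub>x\<close> by the restrictions of its universal element to \<open>z 0, \<dots>, z (n - 1)\<close> is
  finitely presented by construction, so the quotient map has a kernel in an abelian \<open>rep P r F\<close>.  Since the
  representables are finitely presented and detect elements, the fibres of this kernel are the kernels of the
  maps of fibres, and for growing \<open>n\<close> the kernels form a strictly ascending chain of subobjects (\<open>noetherian_imp_no_bad_sequence\<close>).

  For finite length, the point is that a simple object \<open>S\<close> is supported at a single point (\<open>simple_support\<close>): for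
  \<open>v \<noteq> 0\<close> in \<open>S\<close> at \<open>y\<close>, the quotient of \<open>S\<close> by \<open>v\<close> is again finitely presented, and the kernel of the quotient map is nonzero,
  hence all of \<open>S\<close>.  So \<open>S\<close> is generated at \<open>y\<close> and vanishes off the down-set of \<open>y\<close>, for every \<open>y\<close> in its support.  A
  composition series of \<open>h\<^sub>x\<close> with \<open>n\<close> steps therefore leaves room for at most \<open>n\<close> points below \<open>x\<close>.  If, on the other hand, all
  down-sets are finite, then adjoining generators one by one, those at lower points first, enlarges a
  subrepresentation either not at all or minimally, which gives composition series (\<open>finite_down_has_series\<close>).

  The universe \<open>'v\<close> matters because direct sums and representables must be found in it.  Fibres of finitely
  generated representations are quotients of \<open>F\<^sup>n\<close>, so they can be copied into \<open>'v\<close> (\<open>transport_fin_gen\<close>).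
\<close>

abbreviation fibre :: "('p, 'f, 'v) representation \<Rightarrow> 'p \<Rightarrow> 'v set" where
  "fibre M x \<equiv> carrier (Val M x)"

section \<open>Representations and natural transformations\<close>

lemma (in module) diff_as_smult:
  assumes "u \<in> carrier M" "v \<in> carrier M"
  shows "u \<ominus>\<^bsub>M\<^esub> v = u \<oplus>\<^bsub>M\<^esub> (\<ominus>\<^bsub>R\<^esub> \<one>\<^bsub>R\<^esub>) \<odot>\<^bsub>M\<^esub> v"
  using assms by (simp add: smult_l_minus M.minus_eq)

lemma (in module) diff_eq_zero_iff:
  assumes "u \<in> carrier M" "v \<in> carrier M"
  shows "u \<ominus>\<^bsub>M\<^esub> v = \<zero>\<^bsub>M\<^esub> \<longleftrightarrow> u = v"
  using assms by (simp add: M.minus_eq M.add.inv_solve_right')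

lemma linear_mapD:
  assumes "linear_map F V W f"
  shows "v \<in> carrier V \<Longrightarrow> f v \<in> carrier W"
    and "u \<in> carrier V \<Longrightarrow> v \<in> carrier V \<Longrightarrow> f (u \<oplus>\<^bsub>V\<^esub> v) = f u \<oplus>\<^bsub>W\<^esub> f v"
    and "c \<in> carrier F \<Longrightarrow> v \<in> carrier V \<Longrightarrow> f (c \<odot>\<^bsub>V\<^esub> v) = c \<odot>\<^bsub>W\<^esub> f v"
  using assms by (auto simp: linear_map_def)

lemma linear_map_zero:
  assumes "linear_map F V W f" "module F V" "module F W"
  shows "f \<zero>\<^bsub>V\<^esub> = \<zero>\<^bsub>W\<^esub>"
proof -
  interpret V: module F V by fact
  interpret W: module F W by fact
  have "f \<zero>\<^bsub>V\<^esub> = f (\<zero>\<^bsub>F\<^esub> \<odot>\<^bsub>V\<^esub> \<zero>\<^bsub>V\<^esub>)" by simp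
  also have "\<dots> = \<zero>\<^bsub>F\<^esub> \<odot>\<^bsub>W\<^esub> f \<zero>\<^bsub>V\<^esub>" by (rule linear_mapD(3)[OF assms(1)]) auto
  finally show ?thesis using linear_mapD(1)[OF assms(1)] by simp
qed

lemma linear_map_diff:
  assumes "linear_map F V W f" "module F V" "module F W" "u \<in> carrier V" "v \<in> carrier V"
  shows "f (u \<ominus>\<^bsub>V\<^esub> v) = f u \<ominus>\<^bsub>W\<^esub> f v"
proof -
  interpret V: module F V by fact
  interpret W: module F W by fact
  show ?thesis
    using assms by (simp add: V.diff_as_smult W.diff_as_smult linear_mapD[OF assms(1)])
qed

locale poset_over_field = F: field F
  for P :: "'p set" and r :: "'p rel" and F :: "'f ring" +
  assumes partial_order: "partial_order_on P r"
begin

lemma le_refl: "x \<in> P \<Longrightarrow> (x, x) \<in> r"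
  and le_trans: "(z, y) \<in> r \<Longrightarrow> (y, x) \<in> r \<Longrightarrow> (z, x) \<in> r"
  and le_antisym: "(x, y) \<in> r \<Longrightarrow> (y, x) \<in> r \<Longrightarrow> x = y"
  and le_in: "(y, x) \<in> r \<Longrightarrow> y \<in> P" "(y, x) \<in> r \<Longrightarrow> x \<in> P"
  using partial_order_onD[OF partial_order] by (auto simp: refl_on_def trans_def antisym_def)

abbreviation is_rep :: "('p, 'f, 'v) representation \<Rightarrow> bool" where
  "is_rep M \<equiv> is_representation P r F M"

abbreviation homs :: "('p, 'f, 'v) representation \<Rightarrow> ('p, 'f, 'w) representation \<Rightarrow> ('p \<Rightarrow> 'v \<Rightarrow> 'w) set" where
  "homs M N \<equiv> nat_trans P r F M N"

lemma rep_module: "is_rep M \<Longrightarrow> x \<in> P \<Longrightarrow> module F (Val M x)"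
  by (simp add: is_representation_def)

lemma rep_linear: "is_rep M \<Longrightarrow> (y, x) \<in> r \<Longrightarrow> linear_map F (Val M x) (Val M y) (Res M y x)"
  using le_in[of y x] by (simp add: is_representation_def)

lemma rep_zero_closed: "is_rep M \<Longrightarrow> x \<in> P \<Longrightarrow> \<zero>\<^bsub>Val M x\<^esub> \<in> fibre M x"
  using rep_module[of M x] by (simp add: module_def abelian_group_def abelian_monoid.zero_closed)

lemma rep_add_closed:
  "is_rep M \<Longrightarrow> x \<in> P \<Longrightarrow> u \<in> fibre M x \<Longrightarrow> v \<in> fibre M x \<Longrightarrow> u \<oplus>\<^bsub>Val M x\<^esub> v \<in> fibre M x"
  using rep_module[of M x] by (simp add: module_def abelian_group_def abelian_monoid.a_closed)

lemma rep_smult_closed: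
  "is_rep M \<Longrightarrow> x \<in> P \<Longrightarrow> c \<in> carrier F \<Longrightarrow> v \<in> fibre M x \<Longrightarrow> c \<odot>\<^bsub>Val M x\<^esub> v \<in> fibre M x"
  by (rule module.smult_closed[OF rep_module])

lemmas rep_closed = rep_zero_closed rep_add_closed rep_smult_closed

lemma res_closed: "is_rep M \<Longrightarrow> (y, x) \<in> r \<Longrightarrow> v \<in> fibre M x \<Longrightarrow> Res M y x v \<in> fibre M y"
  by (rule linear_mapD(1)[OF rep_linear])

lemma res_id: "is_rep M \<Longrightarrow> x \<in> P \<Longrightarrow> v \<in> fibre M x \<Longrightarrow> Res M x x v = v"
  by (simp add: is_representation_def)

lemma res_res:
  "is_rep M \<Longrightarrow> (y, x) \<in> r \<Longrightarrow> (z, y) \<in> r \<Longrightarrow> v \<in> fibre M x \<Longrightarrow> Res M z y (Res M y x v) = Res M z x v"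
  using le_in[of y x] le_in[of z y] by (simp add: is_representation_def)

lemma res_add:
  "is_rep M \<Longrightarrow> (y, x) \<in> r \<Longrightarrow> u \<in> fibre M x \<Longrightarrow> v \<in> fibre M x \<Longrightarrow>
    Res M y x (u \<oplus>\<^bsub>Val M x\<^esub> v) = Res M y x u \<oplus>\<^bsub>Val M y\<^esub> Res M y x v"
  by (rule linear_mapD(2)[OF rep_linear])

lemma res_smult:
  "is_rep M \<Longrightarrow> (y, x) \<in> r \<Longrightarrow> c \<in> carrier F \<Longrightarrow> v \<in> fibre M x \<Longrightarrow>
    Res M y x (c \<odot>\<^bsub>Val M x\<^esub> v) = c \<odot>\<^bsub>Val M y\<^esub> Res M y x v"
  by (rule linear_mapD(3)[OF rep_linear])

lemma res_zero: "is_rep M \<Longrightarrow> (y, x) \<in> r \<Longrightarrow> Res M y x \<zero>\<^bsub>Val M x\<^esub> = \<zero>\<^bsub>Val M y\<^esub>"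
  by (rule linear_map_zero[OF rep_linear rep_module rep_module]) (auto dest: le_in)

text \<open>
  Morphisms of representations are extensional families; \<open>natural\<close> is the part of the definition that
  carries mathematical content, and \<open>ext\<close> makes a family extensional.
\<close>

definition natural :: "('p, 'f, 'v) representation \<Rightarrow> ('p, 'f, 'w) representation \<Rightarrow> ('p \<Rightarrow> 'v \<Rightarrow> 'w) \<Rightarrow> bool" where
  "natural M N g \<longleftrightarrow> (\<forall>x\<in>P. linear_map F (Val M x) (Val N x) (g x)) \<and>
     (\<forall>x y. (y, x) \<in> r \<longrightarrow> (\<forall>v\<in>fibre M x. g y (Res M y x v) = Res N y x (g x v)))"

definition ext :: "('p, 'f, 'v) representation \<Rightarrow> ('p \<Rightarrow> 'v \<Rightarrow> 'w) \<Rightarrow> 'p \<Rightarrow> 'v \<Rightarrow> 'w" where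
  "ext M g = (\<lambda>x\<in>P. \<lambda>v\<in>fibre M x. g x v)"

lemma ext_apply [simp]: "x \<in> P \<Longrightarrow> v \<in> fibre M x \<Longrightarrow> ext M g x v = g x v"
  by (simp add: ext_def)

lemma ext_cong: "(\<And>x v. x \<in> P \<Longrightarrow> v \<in> fibre M x \<Longrightarrow> g x v = h x v) \<Longrightarrow> ext M g = ext M h"
  by (auto simp: ext_def fun_eq_iff restrict_def)

lemma homs_iff: "\<phi> \<in> homs M N \<longleftrightarrow> natural M N \<phi> \<and> ext M \<phi> = \<phi>"
proof
  assume h: "\<phi> \<in> homs M N"
  then have e: "\<phi> \<in> (\<Pi>\<^sub>E x\<in>P. fibre M x \<rightarrow>\<^sub>E fibre N x)" by (simp add: nat_trans_def)
  have "ext M \<phi> x v = \<phi> x v" for x v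
  proof (cases "x \<in> P")
    case True
    then have "\<phi> x \<in> fibre M x \<rightarrow>\<^sub>E fibre N x" using e by (rule PiE_mem[rotated])
    then show ?thesis using True by (cases "v \<in> fibre M x") (auto simp: ext_def PiE_def extensional_def)
  next
    case False
    then have "\<phi> x = undefined" using e PiE_arb by fastforce
    then show ?thesis using False by (simp add: ext_def)
  qed
  moreover have "natural M N \<phi>" using h le_in by (auto simp: nat_trans_def natural_def)
  ultimately show "natural M N \<phi> \<and> ext M \<phi> = \<phi>" by (auto simp: fun_eq_iff)
next
  assume h: "natural M N \<phi> \<and> ext M \<phi> = \<phi>"
  then have 1: "natural M N \<phi>" by simp
  have "ext M \<phi> \<in> (\<Pi>\<^sub>E x\<in>P. fibre M x \<rightarrow>\<^sub>E fibre N x)"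
    using 1 by (auto simp: ext_def natural_def linear_map_def)
  then show "\<phi> \<in> homs M N" using h by (auto simp: nat_trans_def natural_def)
qed

lemma linear_map_cong:
  assumes "linear_map F V W f" "module F V" "\<And>v. v \<in> carrier V \<Longrightarrow> g v = f v"
  shows "linear_map F V W g"
proof -
  interpret V: module F V by fact
  show ?thesis using assms by (simp add: linear_map_def Pi_iff)
qed

lemma natural_cong:
  assumes "natural M N g" "is_rep M" "\<And>x v. x \<in> P \<Longrightarrow> v \<in> fibre M x \<Longrightarrow> h x v = g x v"
  shows "natural M N h"
  unfolding natural_def
proof (intro conjI ballI allI impI)
  fix x assume "x \<in> P"
  then show "linear_map F (Val M x) (Val N x) (h x)"
    using linear_map_cong[of "Val M x" "Val N x" "g x" "h x"] assms rep_module by (auto simp: natural_def)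
next
  fix x y v assume "(y, x) \<in> r" "v \<in> fibre M x"
  then show "h y (Res M y x v) = Res N y x (h x v)"
    using assms by (simp add: natural_def res_closed le_in)
qed

lemma ext_in_homs: "natural M N g \<Longrightarrow> is_rep M \<Longrightarrow> ext M g \<in> homs M N"
  unfolding homs_iff by (auto intro: natural_cong ext_cong)

lemma homs_natural: "\<phi> \<in> homs M N \<Longrightarrow> natural M N \<phi>" by (simp add: homs_iff)

lemma homs_eqI:
  assumes "\<phi> \<in> homs M N" "\<psi> \<in> homs M N'" "\<And>x v. x \<in> P \<Longrightarrow> v \<in> fibre M x \<Longrightarrow> \<phi> x v = \<psi> x v"
  shows "\<phi> = \<psi>"
  using assms ext_cong[of M \<phi> \<psi>] by (simp add: homs_iff)

lemma naturalI:
  assumes "\<And>x v. x \<in> P \<Longrightarrow> v \<in> fibre M x \<Longrightarrow> g x v \<in> fibre N x"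
    and "\<And>x u v. x \<in> P \<Longrightarrow> u \<in> fibre M x \<Longrightarrow> v \<in> fibre M x \<Longrightarrow>
           g x (u \<oplus>\<^bsub>Val M x\<^esub> v) = g x u \<oplus>\<^bsub>Val N x\<^esub> g x v"
    and "\<And>x c v. x \<in> P \<Longrightarrow> c \<in> carrier F \<Longrightarrow> v \<in> fibre M x \<Longrightarrow>
           g x (c \<odot>\<^bsub>Val M x\<^esub> v) = c \<odot>\<^bsub>Val N x\<^esub> g x v"
    and "\<And>x y v. (y, x) \<in> r \<Longrightarrow> v \<in> fibre M x \<Longrightarrow> g y (Res M y x v) = Res N y x (g x v)"
  shows "natural M N g"
  using assms by (auto simp: natural_def linear_map_def)

lemma naturalD:
  assumes "natural M N g"
  shows "x \<in> P \<Longrightarrow> v \<in> fibre M x \<Longrightarrow> g x v \<in> fibre N x"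
    and "x \<in> P \<Longrightarrow> u \<in> fibre M x \<Longrightarrow> v \<in> fibre M x \<Longrightarrow>
           g x (u \<oplus>\<^bsub>Val M x\<^esub> v) = g x u \<oplus>\<^bsub>Val N x\<^esub> g x v"
    and "x \<in> P \<Longrightarrow> c \<in> carrier F \<Longrightarrow> v \<in> fibre M x \<Longrightarrow>
           g x (c \<odot>\<^bsub>Val M x\<^esub> v) = c \<odot>\<^bsub>Val N x\<^esub> g x v"
    and "(y, x) \<in> r \<Longrightarrow> v \<in> fibre M x \<Longrightarrow> g y (Res M y x v) = Res N y x (g x v)"
  using assms by (auto simp: natural_def linear_map_def)

lemmas homD = naturalD[OF homs_natural]

lemma hom_linear: "\<phi> \<in> homs M N \<Longrightarrow> x \<in> P \<Longrightarrow> linear_map F (Val M x) (Val N x) (\<phi> x)"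
  using homs_natural by (auto simp: natural_def)

lemma hom_zero: "\<phi> \<in> homs M N \<Longrightarrow> is_rep M \<Longrightarrow> is_rep N \<Longrightarrow> x \<in> P \<Longrightarrow> \<phi> x \<zero>\<^bsub>Val M x\<^esub> = \<zero>\<^bsub>Val N x\<^esub>"
  by (rule linear_map_zero[OF hom_linear rep_module rep_module])

lemma hom_diff:
  "\<phi> \<in> homs M N \<Longrightarrow> is_rep M \<Longrightarrow> is_rep N \<Longrightarrow> x \<in> P \<Longrightarrow> u \<in> fibre M x \<Longrightarrow> v \<in> fibre M x \<Longrightarrow>
    \<phi> x (u \<ominus>\<^bsub>Val M x\<^esub> v) = \<phi> x u \<ominus>\<^bsub>Val N x\<^esub> \<phi> x v"
  by (rule linear_map_diff[OF hom_linear rep_module rep_module])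

lemma natural_comp:
  assumes "natural L M g" "natural M N h"
  shows "natural L N (\<lambda>x v. h x (g x v))"
  by (rule naturalI) (simp_all add: naturalD[OF assms(1)] naturalD[OF assms(2)] le_in)

lemma natural_id: "natural M M (\<lambda>x v. v)"
  by (rule naturalI) auto

lemma natural_zero:
  assumes "is_rep N"
  shows "natural M N (\<lambda>x v. \<zero>\<^bsub>Val N x\<^esub>)"
proof (rule naturalI)
  fix x assume x: "x \<in> P"
  interpret N: module F "Val N x" using assms x by (rule rep_module)
  show "\<zero>\<^bsub>Val N x\<^esub> = \<zero>\<^bsub>Val N x\<^esub> \<oplus>\<^bsub>Val N x\<^esub> \<zero>\<^bsub>Val N x\<^esub>" by simp
  show "\<zero>\<^bsub>Val N x\<^esub> = c \<odot>\<^bsub>Val N x\<^esub> \<zero>\<^bsub>Val N x\<^esub>" if "c \<in> carrier F" for c using that by simp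
  show "\<zero>\<^bsub>Val N x\<^esub> \<in> fibre N x" by simp
qed (simp add: res_zero assms)

lemma natural_add:
  assumes "is_rep M" "is_rep N" "natural M N g" "natural M N h"
  shows "natural M N (\<lambda>x v. g x v \<oplus>\<^bsub>Val N x\<^esub> h x v)"
proof (rule naturalI)
  fix x assume x: "x \<in> P"
  interpret N: module F "Val N x" using assms(2) x by (rule rep_module)
  note D = naturalD[OF assms(3)] naturalD[OF assms(4)]
  show "g x v \<oplus>\<^bsub>Val N x\<^esub> h x v \<in> fibre N x" if "v \<in> fibre M x" for v
    using that x by (simp add: D)
  show "g x (u \<oplus>\<^bsub>Val M x\<^esub> v) \<oplus>\<^bsub>Val N x\<^esub> h x (u \<oplus>\<^bsub>Val M x\<^esub> v) =
      g x u \<oplus>\<^bsub>Val N x\<^esub> h x u \<oplus>\<^bsub>Val N x\<^esub> (g x v \<oplus>\<^bsub>Val N x\<^esub> h x v)"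
    if "u \<in> fibre M x" "v \<in> fibre M x" for u v
    using that x by (simp add: D N.a_ac)
  show "g x (c \<odot>\<^bsub>Val M x\<^esub> v) \<oplus>\<^bsub>Val N x\<^esub> h x (c \<odot>\<^bsub>Val M x\<^esub> v) =
      c \<odot>\<^bsub>Val N x\<^esub> (g x v \<oplus>\<^bsub>Val N x\<^esub> h x v)" if "c \<in> carrier F" "v \<in> fibre M x" for c v
    using that x by (simp add: D N.smult_r_distr)
next
  fix x y v assume "(y, x) \<in> r" "v \<in> fibre M x"
  then show "g y (Res M y x v) \<oplus>\<^bsub>Val N y\<^esub> h y (Res M y x v) = Res N y x (g x v \<oplus>\<^bsub>Val N x\<^esub> h x v)"
    using assms by (simp add: naturalD[OF assms(3)] naturalD[OF assms(4)] res_add le_in)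
qed

lemma natural_smult:
  assumes "is_rep M" "is_rep N" "natural M N g" "c \<in> carrier F"
  shows "natural M N (\<lambda>x v. c \<odot>\<^bsub>Val N x\<^esub> g x v)"
proof (rule naturalI)
  fix x assume x: "x \<in> P"
  interpret N: module F "Val N x" using assms(2) x by (rule rep_module)
  note D = naturalD[OF assms(3)]
  show "c \<odot>\<^bsub>Val N x\<^esub> g x v \<in> fibre N x" if "v \<in> fibre M x" for v
    using that x assms by (simp add: D)
  show "c \<odot>\<^bsub>Val N x\<^esub> g x (u \<oplus>\<^bsub>Val M x\<^esub> v) = c \<odot>\<^bsub>Val N x\<^esub> g x u \<oplus>\<^bsub>Val N x\<^esub> c \<odot>\<^bsub>Val N x\<^esub> g x v"
    if "u \<in> fibre M x" "v \<in> fibre M x" for u v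
    using that x assms by (simp add: D N.smult_r_distr)
  show "c \<odot>\<^bsub>Val N x\<^esub> g x (d \<odot>\<^bsub>Val M x\<^esub> v) = d \<odot>\<^bsub>Val N x\<^esub> (c \<odot>\<^bsub>Val N x\<^esub> g x v)"
    if "d \<in> carrier F" "v \<in> fibre M x" for d v
    using that x assms by (simp add: D F.m_comm flip: N.smult_assoc1)
next
  fix x y v assume "(y, x) \<in> r" "v \<in> fibre M x"
  then show "c \<odot>\<^bsub>Val N y\<^esub> g y (Res M y x v) = Res N y x (c \<odot>\<^bsub>Val N x\<^esub> g x v)"
    using assms by (simp add: naturalD[OF assms(3)] res_smult le_in)
qed

text \<open>
  The universal property of a quotient, proved without reference to a category so that \<open>M\<close>, \<open>N\<close> and \<open>L\<close> may live in
  different universes.  The factorisation applies \<open>g\<close> to arbitrary preimages under \<open>c\<close>; two preimages differ by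
  an element of the kernel of \<open>c\<close>, which \<open>g\<close> kills.
\<close>

lemma factor_through_surjection:
  assumes M: "is_rep M" and N: "is_rep N" and L: "is_rep L"
    and c: "c \<in> homs M N" and g: "g \<in> homs M L"
    and surj: "\<And>x. x \<in> P \<Longrightarrow> fibre N x \<subseteq> c x ` fibre M x"
    and ker: "\<And>x v. x \<in> P \<Longrightarrow> v \<in> fibre M x \<Longrightarrow> c x v = \<zero>\<^bsub>Val N x\<^esub> \<Longrightarrow> g x v = \<zero>\<^bsub>Val L x\<^esub>"
  obtains u where "u \<in> homs N L" "\<And>x v. x \<in> P \<Longrightarrow> v \<in> fibre M x \<Longrightarrow> u x (c x v) = g x v"
proof -
  define s where "s x = inv_into (fibre M x) (c x)" for x
  define u where "u = ext N (\<lambda>x w. g x (s x w))"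
  have s: "s x w \<in> fibre M x" "c x (s x w) = w" if "x \<in> P" "w \<in> fibre N x" for x w
    using surj[OF that(1)] that by (auto simp: s_def inv_into_into f_inv_into_f)
  have eq: "g x v = g x v'" if x: "x \<in> P" and v: "v \<in> fibre M x" "v' \<in> fibre M x" "c x v = c x v'" for x v v'
  proof -
    interpret M: module F "Val M x" using M x by (rule rep_module)
    interpret N: module F "Val N x" using N x by (rule rep_module)
    interpret L: module F "Val L x" using L x by (rule rep_module)
    have "c x (v \<ominus>\<^bsub>Val M x\<^esub> v') = \<zero>\<^bsub>Val N x\<^esub>"
      using hom_diff[OF c M N x v(1,2)] v homD(1)[OF c x] by (simp add: N.diff_eq_zero_iff)
    then have "g x (v \<ominus>\<^bsub>Val M x\<^esub> v') = \<zero>\<^bsub>Val L x\<^esub>" using ker[OF x] v by simp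
    then show ?thesis
      using hom_diff[OF g M L x v(1,2)] v homD(1)[OF g x] by (simp add: L.diff_eq_zero_iff)
  qed
  have u: "u x (c x v) = g x v" if "x \<in> P" "v \<in> fibre M x" for x v
    using that s[of x "c x v"] homD(1)[OF c] by (auto simp: u_def intro!: eq)
  have repres: "\<exists>v\<in>fibre M x. w = c x v" if "x \<in> P" "w \<in> fibre N x" for x w
    using surj[OF that(1)] that(2) by auto
  have "natural N L (\<lambda>x w. u x w)"
  proof (rule naturalI)
    fix x assume x: "x \<in> P"
    show "u x w \<in> fibre L x" if w: "w \<in> fibre N x" for w
    proof -
      obtain v where "v \<in> fibre M x" "w = c x v" using repres[OF x w] by blast
      then show ?thesis using u x homD(1)[OF g] by simp
    qed
    show "u x (w \<oplus>\<^bsub>Val N x\<^esub> w') = u x w \<oplus>\<^bsub>Val L x\<^esub> u x w'"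
      if w: "w \<in> fibre N x" "w' \<in> fibre N x" for w w'
    proof -
      obtain v v' where v: "v \<in> fibre M x" "w = c x v" "v' \<in> fibre M x" "w' = c x v'"
        using repres[OF x w(1)] repres[OF x w(2)] by blast
      then show ?thesis
        using u[OF x, of "v \<oplus>\<^bsub>Val M x\<^esub> v'"] x v by (simp add: u homD(2)[OF g] homD(2)[OF c] rep_add_closed[OF M])
    qed
    show "u x (a \<odot>\<^bsub>Val N x\<^esub> w) = a \<odot>\<^bsub>Val L x\<^esub> u x w"
      if w: "a \<in> carrier F" "w \<in> fibre N x" for a w
    proof -
      obtain v where v: "v \<in> fibre M x" "w = c x v" using repres[OF x w(2)] by blast
      then show ?thesis
        using u[OF x, of "a \<odot>\<^bsub>Val M x\<^esub> v"] x w v by (simp add: u homD(3)[OF g] homD(3)[OF c] rep_smult_closed[OF M])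
    qed
  next
    fix x y w assume yx: "(y, x) \<in> r" and w: "w \<in> fibre N x"
    obtain v where v: "v \<in> fibre M x" "w = c x v" using repres[OF le_in(2)[OF yx] w] by blast
    have "u y (Res N y x w) = u y (c y (Res M y x v))" using v yx homD(4)[OF c] by simp
    also have "\<dots> = Res L y x (g x v)" using u le_in[OF yx] res_closed[OF M yx] v homD(4)[OF g yx] by simp
    finally show "u y (Res N y x w) = Res L y x (u x w)" using u le_in[OF yx] v by simp
  qed
  moreover have "ext N u = u" unfolding u_def by (rule ext_cong) simp
  ultimately have "u \<in> homs N L" by (simp add: homs_iff)
  then show ?thesis using u that by blast
qed

text \<open>
  Here \<open>u\<close> inverts \<open>k\<close> on its image, and injectivity of \<open>k\<close> makes it a morphism.
\<close>

lemma factor_through_injection: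
  assumes Z: "is_rep Z" and K: "is_rep K"
    and k: "k \<in> homs K X" and g: "g \<in> homs Z X"
    and inj: "\<And>x. x \<in> P \<Longrightarrow> inj_on (k x) (fibre K x)"
    and im: "\<And>x v. x \<in> P \<Longrightarrow> v \<in> fibre Z x \<Longrightarrow> g x v \<in> k x ` fibre K x"
  obtains u where "u \<in> homs Z K" "\<And>x v. x \<in> P \<Longrightarrow> v \<in> fibre Z x \<Longrightarrow> k x (u x v) = g x v"
proof -
  define u where "u = ext Z (\<lambda>x v. inv_into (fibre K x) (k x) (g x v))"
  have uK: "u x v \<in> fibre K x" and ku: "k x (u x v) = g x v" if "x \<in> P" "v \<in> fibre Z x" for x v
    using im[OF that] that by (auto simp: u_def inv_into_into f_inv_into_f)
  have eqI: "a = b" if "x \<in> P" "a \<in> fibre K x" "b \<in> fibre K x" "k x a = k x b" for x a b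
    using inj[OF that(1)] that by (auto dest: inj_onD)
  have "natural Z K u"
  proof (rule naturalI)
    fix x v assume "x \<in> P" "v \<in> fibre Z x"
    then show "u x v \<in> fibre K x" by (rule uK)
  next
    fix x v w assume h: "x \<in> P" "v \<in> fibre Z x" "w \<in> fibre Z x"
    show "u x (v \<oplus>\<^bsub>Val Z x\<^esub> w) = u x v \<oplus>\<^bsub>Val K x\<^esub> u x w"
      by (rule eqI[OF h(1)]) (use h in \<open>simp_all add: uK ku homD(2)[OF k] homD(2)[OF g] rep_closed Z K\<close>)
  next
    fix x c v assume h: "x \<in> P" "c \<in> carrier F" "v \<in> fibre Z x"
    show "u x (c \<odot>\<^bsub>Val Z x\<^esub> v) = c \<odot>\<^bsub>Val K x\<^esub> u x v"
      by (rule eqI[OF h(1)]) (use h in \<open>simp_all add: uK ku homD(3)[OF k] homD(3)[OF g] rep_closed Z K\<close>)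
  next
    fix x y v assume h: "(y, x) \<in> r" "v \<in> fibre Z x"
    show "u y (Res Z y x v) = Res K y x (u x v)"
      by (rule eqI[OF le_in(1)[OF h(1)]])
        (use h in \<open>simp_all add: uK ku homD(4)[OF k] homD(4)[OF g] res_closed Z K le_in\<close>)
  qed
  moreover have "ext Z u = u" unfolding u_def by (rule ext_cong) simp
  ultimately have "u \<in> homs Z K" by (simp add: homs_iff)
  then show ?thesis using ku that by blast
qed

section \<open>Subrepresentations and generators\<close>

definition subrep :: "('p, 'f, 'v) representation \<Rightarrow> ('p \<Rightarrow> 'v set) \<Rightarrow> bool" where
  "subrep M S \<longleftrightarrow>
     (\<forall>x\<in>P. S x \<subseteq> fibre M x \<and> \<zero>\<^bsub>Val M x\<^esub> \<in> S x \<and>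
        (\<forall>u\<in>S x. \<forall>v\<in>S x. u \<oplus>\<^bsub>Val M x\<^esub> v \<in> S x) \<and>
        (\<forall>c\<in>carrier F. \<forall>v\<in>S x. c \<odot>\<^bsub>Val M x\<^esub> v \<in> S x)) \<and>
     (\<forall>x y. (y, x) \<in> r \<longrightarrow> (\<forall>v\<in>S x. Res M y x v \<in> S y))"

lemma subrepD:
  assumes "subrep M S"
  shows "x \<in> P \<Longrightarrow> v \<in> S x \<Longrightarrow> v \<in> fibre M x"
    and "x \<in> P \<Longrightarrow> \<zero>\<^bsub>Val M x\<^esub> \<in> S x"
    and "x \<in> P \<Longrightarrow> u \<in> S x \<Longrightarrow> v \<in> S x \<Longrightarrow> u \<oplus>\<^bsub>Val M x\<^esub> v \<in> S x"
    and "x \<in> P \<Longrightarrow> c \<in> carrier F \<Longrightarrow> v \<in> S x \<Longrightarrow> c \<odot>\<^bsub>Val M x\<^esub> v \<in> S x"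
    and "(y, x) \<in> r \<Longrightarrow> v \<in> S x \<Longrightarrow> Res M y x v \<in> S y"
  using assms by (auto simp: subrep_def)

lemma subrepI:
  assumes "\<And>x v. x \<in> P \<Longrightarrow> v \<in> S x \<Longrightarrow> v \<in> fibre M x"
    and "\<And>x. x \<in> P \<Longrightarrow> \<zero>\<^bsub>Val M x\<^esub> \<in> S x"
    and "\<And>x u v. x \<in> P \<Longrightarrow> u \<in> S x \<Longrightarrow> v \<in> S x \<Longrightarrow> u \<oplus>\<^bsub>Val M x\<^esub> v \<in> S x"
    and "\<And>x c v. x \<in> P \<Longrightarrow> c \<in> carrier F \<Longrightarrow> v \<in> S x \<Longrightarrow> c \<odot>\<^bsub>Val M x\<^esub> v \<in> S x"
    and "\<And>x y v. (y, x) \<in> r \<Longrightarrow> v \<in> S x \<Longrightarrow> Res M y x v \<in> S y"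
  shows "subrep M S"
  using assms by (auto simp: subrep_def)

lemma subrep_diff:
  assumes "is_rep M" "subrep M S" "x \<in> P" "u \<in> S x" "v \<in> S x"
  shows "u \<ominus>\<^bsub>Val M x\<^esub> v \<in> S x"
proof -
  interpret M: module F "Val M x" using assms by (intro rep_module)
  show ?thesis using assms by (simp add: M.diff_as_smult subrepD[OF assms(2)])
qed

lemma subrep_cancel:
  assumes "is_rep M" "subrep M S" "x \<in> P" "u \<in> fibre M x" "v \<in> S x" "u \<ominus>\<^bsub>Val M x\<^esub> v \<in> S x"
  shows "u \<in> S x"
proof -
  interpret M: module F "Val M x" using assms by (intro rep_module)
  have v: "v \<in> fibre M x" by (rule subrepD(1)[OF assms(2,3,5)])
  have "u = (u \<ominus>\<^bsub>Val M x\<^esub> v) \<oplus>\<^bsub>Val M x\<^esub> v"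
    using assms(4) v by (simp add: M.minus_eq M.a_assoc M.l_neg)
  moreover have "(u \<ominus>\<^bsub>Val M x\<^esub> v) \<oplus>\<^bsub>Val M x\<^esub> v \<in> S x"
    by (rule subrepD(3)[OF assms(2,3,6,5)])
  ultimately show ?thesis by simp
qed

lemma subrep_whole: "is_rep M \<Longrightarrow> subrep M (fibre M)"
  by (rule subrepI) (auto simp: rep_closed res_closed)

lemma subrep_zero:
  assumes "is_rep M"
  shows "subrep M (\<lambda>x. {\<zero>\<^bsub>Val M x\<^esub>})"
proof (rule subrepI)
  fix x assume x: "x \<in> P"
  interpret M: module F "Val M x" using assms x by (rule rep_module)
  show "u \<oplus>\<^bsub>Val M x\<^esub> v \<in> {\<zero>\<^bsub>Val M x\<^esub>}" if "u \<in> {\<zero>\<^bsub>Val M x\<^esub>}" "v \<in> {\<zero>\<^bsub>Val M x\<^esub>}" for u v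
    using that by simp
  show "c \<odot>\<^bsub>Val M x\<^esub> v \<in> {\<zero>\<^bsub>Val M x\<^esub>}" if "c \<in> carrier F" "v \<in> {\<zero>\<^bsub>Val M x\<^esub>}" for c v
    using that by simp
qed (use assms in \<open>auto simp: rep_closed res_zero\<close>)

lemma subrep_Int: "subrep M S \<Longrightarrow> subrep M T \<Longrightarrow> subrep M (\<lambda>x. S x \<inter> T x)"
  by (rule subrepI) (auto dest: subrepD)

lemma subrep_Union_chain:
  fixes S :: "nat \<Rightarrow> 'p \<Rightarrow> 'v set"
  assumes S: "\<And>n. subrep M (S n)" and mono: "\<And>n x. x \<in> P \<Longrightarrow> S n x \<subseteq> S (Suc n) x"
  shows "subrep M (\<lambda>x. \<Union>n. S n x)"
proof (rule subrepI)
  have up: "S m x \<subseteq> S n x" if "m \<le> n" "x \<in> P" for m n x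
    by (rule lift_Suc_mono_le[of "\<lambda>n. S n x"]) (use mono that in auto)
  fix x u v assume x: "x \<in> P" and u: "u \<in> (\<Union>n. S n x)" and v: "v \<in> (\<Union>n. S n x)"
  obtain m n where "u \<in> S m x" "v \<in> S n x" using u v by auto
  then have "u \<in> S (max m n) x" "v \<in> S (max m n) x"
    using up[OF _ x, of m "max m n"] up[OF _ x, of n "max m n"] by auto
  then show "u \<oplus>\<^bsub>Val M x\<^esub> v \<in> (\<Union>n. S n x)" using subrepD(3)[OF S x] by blast
qed (auto dest: subrepD[OF S])

lemma subrep_image:
  assumes "is_rep M" "is_rep N" "\<phi> \<in> homs M N" "subrep M S"
  shows "subrep N (\<lambda>x. \<phi> x ` S x)"
proof (rule subrepI)
  note S = subrepD[OF assms(4)] and h = homD[OF assms(3)]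
  fix x assume x: "x \<in> P"
  show "\<zero>\<^bsub>Val N x\<^esub> \<in> \<phi> x ` S x" using hom_zero[OF assms(3,1,2) x] S(2)[OF x] by (metis imageI)
  show "u \<oplus>\<^bsub>Val N x\<^esub> v \<in> \<phi> x ` S x" if "u \<in> \<phi> x ` S x" "v \<in> \<phi> x ` S x" for u v
    using that h(2)[OF x] S(1,3)[OF x] by (auto simp: image_iff) (metis)
  show "c \<odot>\<^bsub>Val N x\<^esub> v \<in> \<phi> x ` S x" if "c \<in> carrier F" "v \<in> \<phi> x ` S x" for c v
    using that h(3)[OF x] S(1,4)[OF x] by (auto simp: image_iff) (metis)
  show "v \<in> fibre N x" if "v \<in> \<phi> x ` S x" for v using that h(1)[OF x] S(1)[OF x] by auto
next
  note S = subrepD[OF assms(4)] and h = homD[OF assms(3)]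
  fix x y v assume yx: "(y, x) \<in> r" and v: "v \<in> \<phi> x ` S x"
  then obtain w where w: "w \<in> S x" "v = \<phi> x w" by auto
  then have "Res N y x v = \<phi> y (Res M y x w)" using h(4)[OF yx] S(1)[OF le_in(2)[OF yx]] by simp
  then show "Res N y x v \<in> \<phi> y ` S y" using S(5)[OF yx w(1)] by simp
qed

lemma subrep_vimage:
  assumes "is_rep M" "is_rep N" "\<phi> \<in> homs M N" "subrep N T"
  shows "subrep M (\<lambda>x. {v \<in> fibre M x. \<phi> x v \<in> T x})"
  by (rule subrepI)
    (use assms in \<open>auto simp: rep_closed res_closed homD[OF assms(3)] hom_zero[OF assms(3)] subrepD[OF assms(4)] le_in\<close>)

lemma kernel_subrep:
  assumes "is_rep M" "is_rep N" "\<phi> \<in> homs M N"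
  shows "subrep M (\<lambda>x. {v \<in> fibre M x. \<phi> x v = \<zero>\<^bsub>Val N x\<^esub>})"
  using subrep_vimage[OF assms subrep_zero[OF assms(2)]] by simp

text \<open>
  \<open>gen M G\<close> is the subrepresentation generated by a set \<open>G\<close> of homogeneous elements, that is of pairs \<open>(x, v)\<close>
  with \<open>v\<close> in the fibre at \<open>x\<close>.  Its fibre at \<open>y\<close> is the linear span of the restrictions to \<open>y\<close> of
  the members of \<open>G\<close> that live above \<open>y\<close>.
\<close>

inductive_set gen :: "('p, 'f, 'v) representation \<Rightarrow> ('p \<times> 'v) set \<Rightarrow> 'p \<Rightarrow> 'v set"
  for M G y where
  gen_res: "(x, v) \<in> G \<Longrightarrow> (y, x) \<in> r \<Longrightarrow> Res M y x v \<in> gen M G y"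
| gen_zero: "\<zero>\<^bsub>Val M y\<^esub> \<in> gen M G y"
| gen_add: "u \<in> gen M G y \<Longrightarrow> v \<in> gen M G y \<Longrightarrow> u \<oplus>\<^bsub>Val M y\<^esub> v \<in> gen M G y"
| gen_smult: "c \<in> carrier F \<Longrightarrow> v \<in> gen M G y \<Longrightarrow> c \<odot>\<^bsub>Val M y\<^esub> v \<in> gen M G y"

text \<open>
  The standard way to bound a generated subrepresentation, used with kernels, images and preimages as \<open>S\<close>.
\<close>

lemma gen_least:
  assumes S: "subrep M S" and G: "G \<subseteq> Sigma P S" and y: "y \<in> P"
  shows "gen M G y \<subseteq> S y"
proof
  fix w assume "w \<in> gen M G y"
  then show "w \<in> S y"
    by induction (use y G in \<open>auto intro: subrepD[OF S]\<close>)
qed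

lemma gen_subrep:
  assumes M: "is_rep M" and G: "G \<subseteq> Sigma P (fibre M)"
  shows "subrep M (gen M G)"
proof (rule subrepI)
  fix x v assume "x \<in> P" "v \<in> gen M G x"
  then show "v \<in> fibre M x" using gen_least[OF subrep_whole[OF M] G] by blast
next
  fix x y v assume yx: "(y, x) \<in> r" and v: "v \<in> gen M G x"
  have x: "x \<in> P" using le_in yx by blast
  have in_fibre: "w \<in> fibre M x" if "w \<in> gen M G x" for w
    using gen_least[OF subrep_whole[OF M] G x] that by blast
  show "Res M y x v \<in> gen M G y" using v
  proof induction
    case (gen_res z v)
    then have "v \<in> fibre M z" using G by auto
    then show ?case using gen_res yx M res_res[of M x z y v] le_trans[OF yx gen_res(2)] gen.gen_res
      by metis
  qed (use yx in \<open>auto simp: res_zero res_add res_smult M in_fibre intro: gen.intros\<close>)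
qed (auto intro: gen.intros)

lemma gen_in_fibre:
  "is_rep M \<Longrightarrow> G \<subseteq> Sigma P (fibre M) \<Longrightarrow> x \<in> P \<Longrightarrow> v \<in> gen M G x \<Longrightarrow> v \<in> fibre M x"
  by (rule subrepD(1)[OF gen_subrep])

lemma gen_mono: "G \<subseteq> H \<Longrightarrow> gen M G y \<subseteq> gen M H y"
proof
  fix w assume "w \<in> gen M G y" and "G \<subseteq> H"
  then show "w \<in> gen M H y" by induction (auto intro: gen.intros)
qed

lemma gen_base: "is_rep M \<Longrightarrow> G \<subseteq> Sigma P (fibre M) \<Longrightarrow> (x, v) \<in> G \<Longrightarrow> v \<in> gen M G x"
  using gen_res[of x v G x M] res_id[of M x v] le_refl by fastforce

lemma gen_trans:
  assumes M: "is_rep M" and G: "G \<subseteq> Sigma P (fibre M)" and H: "H \<subseteq> Sigma P (gen M G)" and y: "y \<in> P"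
  shows "gen M H y \<subseteq> gen M G y"
  using gen_least[OF gen_subrep[OF M G] H y] .

text \<open>
  The fibre at \<open>y\<close> sees generators above \<open>y\<close> only.  This is how the order of \<open>P\<close> enters all vanishing arguments.
\<close>

lemma gen_empty:
  assumes "is_rep M" "y \<in> P" "\<And>x v. (x, v) \<in> G \<Longrightarrow> (y, x) \<notin> r"
  shows "gen M G y = {\<zero>\<^bsub>Val M y\<^esub>}"
proof -
  interpret M: module F "Val M y" using assms by (intro rep_module)
  have "w = \<zero>\<^bsub>Val M y\<^esub>" if "w \<in> gen M G y" for w
    using that by induction (use assms(3) in auto)
  then show ?thesis by (auto intro: gen_zero)
qed

text \<open>
  Splitting off one generator.  Since \<open>gen M G y\<close> is a linear span, an element either avoids the new generator or
  involves a multiple of its restriction.  The case distinction on \<open>(y, x) \<in> r\<close> lets the coefficient be arbitrary,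
  including zero.
\<close>

lemma gen_insert:
  assumes M: "is_rep M" and G: "insert (x, v) G \<subseteq> Sigma P (fibre M)" and y: "y \<in> P"
    and w: "w \<in> gen M (insert (x, v) G) y"
  shows "w \<in> gen M G y \<or>
    (y, x) \<in> r \<and> (\<exists>c\<in>carrier F. \<exists>m\<in>gen M G y. w = c \<odot>\<^bsub>Val M y\<^esub> Res M y x v \<oplus>\<^bsub>Val M y\<^esub> m)"
proof (cases "(y, x) \<in> r")
  case False
  from w have "w \<in> gen M G y"
    by induction (use False in \<open>auto intro: gen.intros\<close>)
  then show ?thesis ..
next
  case yx: True
  interpret M: module F "Val M y" using M y by (rule rep_module)
  have rv [simp]: "Res M y x v \<in> fibre M y" using G yx by (auto simp: M res_closed)
  have inG: "m \<in> fibre M y" if "m \<in> gen M G y" for m using gen_in_fibre[OF M _ y that] G by auto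
  from w have "\<exists>c\<in>carrier F. \<exists>m\<in>gen M G y. w = c \<odot>\<^bsub>Val M y\<^esub> Res M y x v \<oplus>\<^bsub>Val M y\<^esub> m"
  proof induction
    case (gen_res x' v')
    show ?case
    proof (cases "(x', v') = (x, v)")
      case True
      then show ?thesis
        by (intro bexI[of _ "\<one>\<^bsub>F\<^esub>"] bexI[of _ "\<zero>\<^bsub>Val M y\<^esub>"]) (auto intro: gen_zero)
    next
      case False
      then have "Res M y x' v' \<in> gen M G y" using gen_res by (auto intro: gen.gen_res)
      then show ?thesis
        by (intro bexI[of _ "\<zero>\<^bsub>F\<^esub>"] bexI[of _ "Res M y x' v'"]) (auto simp: inG)
    qed
  next
    case gen_zero
    then show ?case
      by (intro bexI[of _ "\<zero>\<^bsub>F\<^esub>"] bexI[of _ "\<zero>\<^bsub>Val M y\<^esub>"]) (auto intro: gen.gen_zero)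
  next
    case (gen_add u1 u2)
    then obtain c1 m1 c2 m2 where h: "c1 \<in> carrier F" "m1 \<in> gen M G y"
      "u1 = c1 \<odot>\<^bsub>Val M y\<^esub> Res M y x v \<oplus>\<^bsub>Val M y\<^esub> m1"
      "c2 \<in> carrier F" "m2 \<in> gen M G y" "u2 = c2 \<odot>\<^bsub>Val M y\<^esub> Res M y x v \<oplus>\<^bsub>Val M y\<^esub> m2" by blast
    show ?case
      by (intro bexI[of _ "c1 \<oplus>\<^bsub>F\<^esub> c2"] bexI[of _ "m1 \<oplus>\<^bsub>Val M y\<^esub> m2"])
        (use h in \<open>auto simp: inG M.smult_l_distr M.a_ac intro: gen.gen_add\<close>)
  next
    case (gen_smult d u)
    then obtain c m where h: "c \<in> carrier F" "m \<in> gen M G y"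
      "u = c \<odot>\<^bsub>Val M y\<^esub> Res M y x v \<oplus>\<^bsub>Val M y\<^esub> m" by blast
    show ?case
      by (intro bexI[of _ "d \<otimes>\<^bsub>F\<^esub> c"] bexI[of _ "d \<odot>\<^bsub>Val M y\<^esub> m"])
        (use h gen_smult in \<open>auto simp: inG M.smult_assoc1 M.smult_r_distr intro: gen.gen_smult\<close>)
  qed
  then show ?thesis using yx by blast
qed

lemma gen_image:
  assumes M: "is_rep M" and N: "is_rep N" and \<phi>: "\<phi> \<in> homs M N" and G: "G \<subseteq> Sigma P (fibre M)" and y: "y \<in> P"
  shows "gen N ((\<lambda>(x, v). (x, \<phi> x v)) ` G) y = \<phi> y ` gen M G y"
proof
  let ?G = "(\<lambda>(x, v). (x, \<phi> x v)) ` G"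
  have "?G \<subseteq> Sigma P (\<lambda>x. \<phi> x ` gen M G x)" using gen_base[OF M G] G by auto
  then show "gen N ?G y \<subseteq> \<phi> y ` gen M G y"
    using gen_least[OF subrep_image[OF M N \<phi> gen_subrep[OF M G]] _ y] by blast
  have "?G \<subseteq> Sigma P (fibre N)" using G homD(1)[OF \<phi>] by auto
  note sub = subrep_vimage[OF M N \<phi> gen_subrep[OF N this]]
  have "G \<subseteq> Sigma P (\<lambda>x. {v \<in> fibre M x. \<phi> x v \<in> gen N ?G x})"
    using G gen_base[OF N \<open>?G \<subseteq> Sigma P (fibre N)\<close>] by force
  then show "\<phi> y ` gen M G y \<subseteq> gen N ?G y" using gen_least[OF sub _ y] by blast
qed

definition fin_gen :: "('p, 'f, 'v) representation \<Rightarrow> ('p \<Rightarrow> 'v set) \<Rightarrow> bool" where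
  "fin_gen M S \<longleftrightarrow> (\<exists>G. finite G \<and> G \<subseteq> Sigma P S \<and> (\<forall>y\<in>P. S y \<subseteq> gen M G y))"

lemma fin_gen_image:
  assumes M: "is_rep M" and N: "is_rep N" and \<phi>: "\<phi> \<in> homs M N" and S: "subrep M S" and fg: "fin_gen M S"
  shows "fin_gen N (\<lambda>x. \<phi> x ` S x)"
proof -
  obtain G where G: "finite G" "G \<subseteq> Sigma P S" "\<forall>y\<in>P. S y \<subseteq> gen M G y" using fg by (auto simp: fin_gen_def)
  have "G \<subseteq> Sigma P (fibre M)" using G(2) subrepD(1)[OF S] by auto
  note im = gen_image[OF M N \<phi> this]
  show ?thesis unfolding fin_gen_def
    by (rule exI[of _ "(\<lambda>(x, v). (x, \<phi> x v)) ` G"]) (use G in \<open>auto simp: im\<close>)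
qed

lemma fin_gen_cong: "(\<And>x. x \<in> P \<Longrightarrow> S x = T x) \<Longrightarrow> fin_gen M S = fin_gen M T"
proof -
  assume eq: "\<And>x. x \<in> P \<Longrightarrow> S x = T x"
  then have "Sigma P S = Sigma P T" by (intro Sigma_cong) auto
  then show ?thesis using eq by (simp add: fin_gen_def)
qed

lemma fin_gen_surjection:
  assumes M: "is_rep M" and N: "is_rep N" and q: "q \<in> homs M N"
    and surj: "\<And>x. x \<in> P \<Longrightarrow> fibre N x \<subseteq> q x ` fibre M x" and fg: "fin_gen M (fibre M)"
  shows "fin_gen N (fibre N)"
proof -
  have eq: "fibre N x = q x ` fibre M x" if "x \<in> P" for x
    using surj[OF that] homD(1)[OF q that] by auto
  show ?thesis
    by (rule fin_gen_cong[THEN iffD2, OF _ fin_gen_image[OF M N q subrep_whole[OF M] fg]]) (rule eq)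
qed

section \<open>Quotients and change of universe\<close>

text \<open>
  A family of maps \<open>\<rho> x\<close> out of the fibres of \<open>M\<close> whose fibres are the cosets of a subrepresentation turns the
  images into a representation.  An injective \<open>\<rho>\<close> moves \<open>M\<close> to another universe; a choice of coset
  representatives gives the quotient of \<open>M\<close> within the same universe.
\<close>

definition image_rep :: "('p, 'f, 'v) representation \<Rightarrow> ('p \<Rightarrow> 'v \<Rightarrow> 'w) \<Rightarrow> ('p, 'f, 'w) representation" where
  "image_rep M \<rho> = (let s = (\<lambda>x. inv_into (fibre M x) (\<rho> x)) in
     \<lparr>Val = (\<lambda>x. \<lparr>carrier = \<rho> x ` fibre M x, monoid.mult = undefined, one = undefined,
        zero = \<rho> x \<zero>\<^bsub>Val M x\<^esub>, add = (\<lambda>a b. \<rho> x (s x a \<oplus>\<^bsub>Val M x\<^esub> s x b)),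
        smult = (\<lambda>c a. \<rho> x (c \<odot>\<^bsub>Val M x\<^esub> s x a))\<rparr>),
      Res = (\<lambda>y x a. \<rho> y (Res M y x (s x a)))\<rparr>)"

lemma image_rep:
  assumes M: "is_rep M" and S: "subrep M S"
    and \<rho>: "\<And>x u v. x \<in> P \<Longrightarrow> u \<in> fibre M x \<Longrightarrow> v \<in> fibre M x \<Longrightarrow> \<rho> x u = \<rho> x v \<longleftrightarrow> u \<ominus>\<^bsub>Val M x\<^esub> v \<in> S x"
  shows "is_rep (image_rep M \<rho>)" and "natural M (image_rep M \<rho>) \<rho>"
    and "fibre (image_rep M \<rho>) x = \<rho> x ` fibre M x" and "\<zero>\<^bsub>Val (image_rep M \<rho>) x\<^esub> = \<rho> x \<zero>\<^bsub>Val M x\<^esub>"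
proof -
  let ?N = "image_rep M \<rho>"
  define s where "s x = inv_into (fibre M x) (\<rho> x)" for x
  show carr: "fibre ?N x = \<rho> x ` fibre M x" for x by (simp add: image_rep_def Let_def)
  show zero: "\<zero>\<^bsub>Val ?N x\<^esub> = \<rho> x \<zero>\<^bsub>Val M x\<^esub>" for x by (simp add: image_rep_def Let_def)
  have s: "s x (\<rho> x u) \<in> fibre M x" "\<rho> x (s x (\<rho> x u)) = \<rho> x u" if "x \<in> P" "u \<in> fibre M x" for x u
    using that by (auto simp: s_def inv_into_into f_inv_into_f)
  have cong_add: "\<rho> x (u \<oplus>\<^bsub>Val M x\<^esub> v) = \<rho> x (u' \<oplus>\<^bsub>Val M x\<^esub> v')"
    if "x \<in> P" "u \<in> fibre M x" "v \<in> fibre M x" "u' \<in> fibre M x" "v' \<in> fibre M x"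
      "\<rho> x u = \<rho> x u'" "\<rho> x v = \<rho> x v'" for x u v u' v'
  proof -
    interpret M: module F "Val M x" using M that(1) by (rule rep_module)
    have "(u \<ominus>\<^bsub>Val M x\<^esub> u') \<oplus>\<^bsub>Val M x\<^esub> (v \<ominus>\<^bsub>Val M x\<^esub> v') \<in> S x"
      using that \<rho> subrepD(3)[OF S] by simp
    moreover have "(u \<ominus>\<^bsub>Val M x\<^esub> u') \<oplus>\<^bsub>Val M x\<^esub> (v \<ominus>\<^bsub>Val M x\<^esub> v') =
        (u \<oplus>\<^bsub>Val M x\<^esub> v) \<ominus>\<^bsub>Val M x\<^esub> (u' \<oplus>\<^bsub>Val M x\<^esub> v')"
      using that by (simp add: M.minus_eq M.minus_add M.a_ac)
    ultimately show ?thesis using that \<rho> by simp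
  qed
  have cong_smult: "\<rho> x (c \<odot>\<^bsub>Val M x\<^esub> u) = \<rho> x (c \<odot>\<^bsub>Val M x\<^esub> u')"
    if "x \<in> P" "c \<in> carrier F" "u \<in> fibre M x" "u' \<in> fibre M x" "\<rho> x u = \<rho> x u'" for x c u u'
  proof -
    interpret M: module F "Val M x" using M that(1) by (rule rep_module)
    have "c \<odot>\<^bsub>Val M x\<^esub> (u \<ominus>\<^bsub>Val M x\<^esub> u') \<in> S x" using that \<rho> subrepD(4)[OF S] by simp
    moreover have "c \<odot>\<^bsub>Val M x\<^esub> (u \<ominus>\<^bsub>Val M x\<^esub> u') = c \<odot>\<^bsub>Val M x\<^esub> u \<ominus>\<^bsub>Val M x\<^esub> c \<odot>\<^bsub>Val M x\<^esub> u'"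
      using that by (simp add: M.minus_eq M.smult_r_distr M.smult_r_minus)
    ultimately show ?thesis using that \<rho> by simp
  qed
  have cong_res: "\<rho> y (Res M y x u) = \<rho> y (Res M y x u')"
    if "(y, x) \<in> r" "u \<in> fibre M x" "u' \<in> fibre M x" "\<rho> x u = \<rho> x u'" for x y u u'
  proof -
    have P: "x \<in> P" "y \<in> P" using that le_in by auto
    have "Res M y x (u \<ominus>\<^bsub>Val M x\<^esub> u') \<in> S y" using that \<rho> P subrepD(5)[OF S] by simp
    moreover have "Res M y x (u \<ominus>\<^bsub>Val M x\<^esub> u') = Res M y x u \<ominus>\<^bsub>Val M y\<^esub> Res M y x u'"
      by (rule linear_map_diff[OF rep_linear[OF M that(1)] rep_module[OF M P(1)] rep_module[OF M P(2)] that(2,3)])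
    ultimately show ?thesis using that \<rho> P res_closed[OF M] by simp
  qed
  have add: "\<rho> x u \<oplus>\<^bsub>Val ?N x\<^esub> \<rho> x v = \<rho> x (u \<oplus>\<^bsub>Val M x\<^esub> v)"
    if "x \<in> P" "u \<in> fibre M x" "v \<in> fibre M x" for x u v
    by (simp add: image_rep_def Let_def flip: s_def) (rule cong_add, (use that in \<open>simp_all add: s le_in\<close>))
  have smult: "c \<odot>\<^bsub>Val ?N x\<^esub> \<rho> x u = \<rho> x (c \<odot>\<^bsub>Val M x\<^esub> u)"
    if "x \<in> P" "c \<in> carrier F" "u \<in> fibre M x" for x c u
    by (simp add: image_rep_def Let_def flip: s_def) (rule cong_smult, (use that in \<open>simp_all add: s le_in\<close>))
  have res: "Res ?N y x (\<rho> x u) = \<rho> y (Res M y x u)"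
    if "(y, x) \<in> r" "u \<in> fibre M x" for x y u
    by (simp add: image_rep_def Let_def flip: s_def) (rule cong_res, (use that in \<open>simp_all add: s le_in\<close>))
  show "natural M ?N \<rho>"
    by (rule naturalI) (simp_all add: carr add smult res)
  show "is_rep ?N" unfolding is_representation_def
  proof (intro conjI ballI impI)
    fix x assume x: "x \<in> P"
    interpret M: module F "Val M x" using M x by (rule rep_module)
    show "module F (Val ?N x)"
    proof (rule moduleI)
      show "cring F" ..
      show "abelian_group (Val ?N x)"
      proof (rule abelian_groupI)
        fix a assume "a \<in> fibre ?N x"
        then obtain u where u: "u \<in> fibre M x" "a = \<rho> x u" by (auto simp: carr)
        show "\<exists>b\<in>fibre ?N x. b \<oplus>\<^bsub>Val ?N x\<^esub> a = \<zero>\<^bsub>Val ?N x\<^esub>"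
          by (rule bexI[of _ "\<rho> x (\<ominus>\<^bsub>Val M x\<^esub> u)"]) (use u x in \<open>auto simp: carr add zero M.l_neg\<close>)
      qed (use x in \<open>auto simp: carr add zero M.a_ac\<close>)
    qed (use x in \<open>auto simp: carr add smult M.smult_l_distr M.smult_r_distr M.smult_assoc1\<close>)
    show "Res ?N x x v = v" if "v \<in> fibre ?N x" for v
      using that x by (auto simp: carr res le_refl res_id M)
  next
    fix x y assume "(y, x) \<in> r" "x \<in> P" "y \<in> P"
    then show "linear_map F (Val ?N x) (Val ?N y) (Res ?N y x)"
      by (auto simp: linear_map_def carr res add smult res_closed res_add res_smult rep_closed M)
  next
    fix x y z v assume h: "(y, x) \<in> r" "(z, y) \<in> r" "v \<in> fibre ?N x" "x \<in> P" "y \<in> P" "z \<in> P"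
    show "Res ?N z y (Res ?N y x v) = Res ?N z x v"
      using h le_trans[OF h(2,1)] by (auto simp: carr res res_closed res_res M)
  qed
qed

text \<open>
  Choosing coset representatives keeps the quotient in the universe of \<open>M\<close>.
\<close>

lemma quotient_rep:
  fixes M :: "('p, 'f, 'v) representation"
  assumes M: "is_rep M" and S: "subrep M S"
  obtains N :: "('p, 'f, 'v) representation" and q where "is_rep N" "q \<in> homs M N"
    "\<And>x. x \<in> P \<Longrightarrow> fibre N x = q x ` fibre M x"
    "\<And>x v. x \<in> P \<Longrightarrow> v \<in> fibre M x \<Longrightarrow> q x v = \<zero>\<^bsub>Val N x\<^esub> \<longleftrightarrow> v \<in> S x"
proof -
  \<comment> \<open>The chosen representative depends on \<open>v\<close> only through the coset of \<open>v\<close>, because the predicate does.\<close>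
  define \<rho> where "\<rho> x v = (SOME w. w \<in> fibre M x \<and> w \<ominus>\<^bsub>Val M x\<^esub> v \<in> S x)" for x v
  have \<rho>: "\<rho> x u = \<rho> x v \<longleftrightarrow> u \<ominus>\<^bsub>Val M x\<^esub> v \<in> S x"
    if x: "x \<in> P" and uv: "u \<in> fibre M x" "v \<in> fibre M x" for x u v
  proof -
    interpret M: module F "Val M x" using M x by (rule rep_module)
    have self: "u \<in> fibre M x \<and> u \<ominus>\<^bsub>Val M x\<^esub> u \<in> S x" if "u \<in> fibre M x" for u
      using that subrepD(2)[OF S x] by (simp add: M.minus_eq M.r_neg)
    have sub: "u \<ominus>\<^bsub>Val M x\<^esub> w \<in> S x"
      if "w \<in> fibre M x" "u \<in> fibre M x" "v \<in> fibre M x" "u \<ominus>\<^bsub>Val M x\<^esub> v \<in> S x" "w \<ominus>\<^bsub>Val M x\<^esub> v \<in> S x" for u v w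
    proof -
      have "(u \<ominus>\<^bsub>Val M x\<^esub> v) \<ominus>\<^bsub>Val M x\<^esub> (w \<ominus>\<^bsub>Val M x\<^esub> v) \<in> S x"
        using subrep_diff[OF M S x] that by simp
      moreover have "(u \<ominus>\<^bsub>Val M x\<^esub> v) \<ominus>\<^bsub>Val M x\<^esub> (w \<ominus>\<^bsub>Val M x\<^esub> v) = u \<ominus>\<^bsub>Val M x\<^esub> w"
      proof -
        have "\<ominus>\<^bsub>Val M x\<^esub> v \<oplus>\<^bsub>Val M x\<^esub> (v \<oplus>\<^bsub>Val M x\<^esub> \<ominus>\<^bsub>Val M x\<^esub> w) = \<ominus>\<^bsub>Val M x\<^esub> w"
          using that by (simp add: M.r_neg1)
        then show ?thesis using that by (simp add: M.minus_eq M.minus_add M.a_ac)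
      qed
      ultimately show ?thesis by simp
    qed
    have zero: "\<zero>\<^bsub>Val M x\<^esub> \<in> S x" using subrepD(2)[OF S x] .
    have neg: "v \<ominus>\<^bsub>Val M x\<^esub> u \<in> S x"
      if "u \<in> fibre M x" "v \<in> fibre M x" "u \<ominus>\<^bsub>Val M x\<^esub> v \<in> S x" for u v
      using sub[of u v v] self[of v] that by simp
    have chosen: "\<rho> x u \<in> fibre M x \<and> \<rho> x u \<ominus>\<^bsub>Val M x\<^esub> u \<in> S x" if "u \<in> fibre M x" for u
      unfolding \<rho>_def by (rule someI[of _ u]) (rule self[OF that])
    show ?thesis
    proof
      assume "\<rho> x u = \<rho> x v"
      then have "\<rho> x u \<ominus>\<^bsub>Val M x\<^esub> v \<in> S x" "\<rho> x u \<ominus>\<^bsub>Val M x\<^esub> u \<in> S x" "\<rho> x u \<in> fibre M x"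
        using chosen[OF uv(1)] chosen[OF uv(2)] by auto
      then show "u \<ominus>\<^bsub>Val M x\<^esub> v \<in> S x"
        using uv sub[of v u "\<rho> x u"] neg by blast
    next
      assume *: "u \<ominus>\<^bsub>Val M x\<^esub> v \<in> S x"
      have "w \<ominus>\<^bsub>Val M x\<^esub> u \<in> S x \<longleftrightarrow> w \<ominus>\<^bsub>Val M x\<^esub> v \<in> S x" if "w \<in> fibre M x" for w
        using sub[of v w u] sub[of u w v] neg that uv * by blast
      then show "\<rho> x u = \<rho> x v" unfolding \<rho>_def by metis
    qed
  qed
  note im = image_rep[OF M S \<rho>]
  have "ext M \<rho> x ` fibre M x = \<rho> x ` fibre M x" if "x \<in> P" for x using that by simp
  moreover have "ext M \<rho> x v = \<zero>\<^bsub>Val (image_rep M \<rho>) x\<^esub> \<longleftrightarrow> v \<in> S x" if "x \<in> P" "v \<in> fibre M x" for x v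
  proof -
    interpret M: module F "Val M x" using M that(1) by (rule rep_module)
    show ?thesis using that \<rho>[of x v "\<zero>\<^bsub>Val M x\<^esub>"] by (simp add: im(4) M.diff_as_smult)
  qed
  ultimately show ?thesis
    using that[of "image_rep M \<rho>" "ext M \<rho>"] im(1,3) ext_in_homs[OF im(2) M] by simp
qed

lemma transport_rep:
  fixes M :: "('p, 'f, 'w) representation" and \<rho> :: "'p \<Rightarrow> 'w \<Rightarrow> 'v"
  assumes M: "is_rep M" and inj: "\<And>x. x \<in> P \<Longrightarrow> inj_on (\<rho> x) (fibre M x)"
  obtains N :: "('p, 'f, 'v) representation" and q where "is_rep N" "q \<in> homs M N"
    "\<And>x. x \<in> P \<Longrightarrow> bij_betw (q x) (fibre M x) (fibre N x)"
proof -
  have \<rho>: "\<rho> x u = \<rho> x v \<longleftrightarrow> u \<ominus>\<^bsub>Val M x\<^esub> v \<in> {\<zero>\<^bsub>Val M x\<^esub>}"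
    if "x \<in> P" "u \<in> fibre M x" "v \<in> fibre M x" for x u v
    using that inj module.diff_eq_zero_iff[OF rep_module[OF M]] by (auto dest: inj_onD)
  note im = image_rep[OF M subrep_zero[OF M] \<rho>]
  have "bij_betw (ext M \<rho> x) (fibre M x) (fibre (image_rep M \<rho>) x)" if "x \<in> P" for x
  proof -
    have "bij_betw (\<rho> x) (fibre M x) (fibre (image_rep M \<rho>) x)"
      using inj[OF that] im(3) by (simp add: bij_betw_def)
    then show ?thesis using bij_betw_cong[of "fibre M x" "ext M \<rho> x" "\<rho> x"] that by simp
  qed
  then show ?thesis using that im(1) ext_in_homs[OF im(2) M] by blast
qed

text \<open>
  Each fibre of a finitely generated representation is a quotient of some \<open>F\<^sup>n\<close>; only the resulting bound on the
  cardinality matters, so the surjection from coefficient lists need not be linear.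
\<close>

lemma gen_card:
  assumes M: "is_rep M" and fin: "finite G" and y: "y \<in> P" and G: "G \<subseteq> Sigma P (fibre M)"
  shows "\<exists>f. gen M G y \<subseteq> f ` lists (carrier F)"
  using fin G
proof (induction G)
  case empty
  have "gen M {} y = {\<zero>\<^bsub>Val M y\<^esub>}" by (rule gen_empty[OF M y]) simp
  also have "\<dots> \<subseteq> (\<lambda>l. \<zero>\<^bsub>Val M y\<^esub>) ` lists (carrier F)" by auto
  finally show ?case by blast
next
  case (insert g G)
  interpret M: module F "Val M y" using M y by (rule rep_module)
  obtain x v where g: "g = (x, v)" by force
  obtain f where f: "gen M G y \<subseteq> f ` lists (carrier F)" using insert by auto
  \<comment> \<open>The head of the coefficient list is the coefficient of the new generator.\<close>
  define h where "h l = (if (y, x) \<in> r then hd l \<odot>\<^bsub>Val M y\<^esub> Res M y x v \<oplus>\<^bsub>Val M y\<^esub> f (tl l) else f (tl l))" for l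
  have "w \<in> h ` lists (carrier F)" if w: "w \<in> gen M (insert g G) y" for w
  proof -
    have G: "G \<subseteq> Sigma P (fibre M)" using insert by simp
    consider "w \<in> gen M G y" | c m where "(y, x) \<in> r" "c \<in> carrier F" "m \<in> gen M G y"
      "w = c \<odot>\<^bsub>Val M y\<^esub> Res M y x v \<oplus>\<^bsub>Val M y\<^esub> m"
      using gen_insert[OF M _ y, of x v G w] insert.prems w g by blast
    then show ?thesis
    proof cases
      case 1
      then obtain l where l: "l \<in> lists (carrier F)" "w = f l" using f by auto
      have "w \<in> fibre M y" using gen_in_fibre[OF M G y 1] .
      moreover have "Res M y x v \<in> fibre M y" if "(y, x) \<in> r"
        using insert.prems g that by (auto simp: res_closed M)
      ultimately have "w = h (\<zero>\<^bsub>F\<^esub> # l)" using l by (simp add: h_def)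
      moreover have "\<zero>\<^bsub>F\<^esub> # l \<in> lists (carrier F)" using l by simp
      ultimately show ?thesis by blast
    next
      case 2
      then obtain l where l: "l \<in> lists (carrier F)" "m = f l" using f by auto
      then have "w = h (c # l)" using 2 by (simp add: h_def)
      moreover have "c # l \<in> lists (carrier F)" using l 2 by simp
      ultimately show ?thesis by blast
    qed
  qed
  then show ?case by blast
qed

end

text \<open>
  The universe \<open>'v\<close> is assumed to contain coefficient lists of all lengths.  Together with the bound \<open>gen_card\<close> this lets
  every finitely generated representation, whatever type it was constructed in, be copied into \<open>'v\<close>.
\<close>

locale poset_universe = poset_over_field P r F
  for P :: "'p set" and r :: "'p rel" and F :: "'f ring" +
  fixes \<iota> :: "'f list \<Rightarrow> 'v"
  assumes inj_\<iota>: "inj_on \<iota> (lists (carrier F))"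
begin

lemma transport_fin_gen:
  fixes M :: "('p, 'f, 'w) representation"
  assumes M: "is_rep M" and fg: "fin_gen M (fibre M)"
  obtains N :: "('p, 'f, 'v) representation" and q where "is_rep N" "q \<in> homs M N"
    "\<And>x. x \<in> P \<Longrightarrow> bij_betw (q x) (fibre M x) (fibre N x)"
proof -
  obtain G where G: "finite G" "G \<subseteq> Sigma P (fibre M)" "\<forall>y\<in>P. fibre M y \<subseteq> gen M G y"
    using fg by (auto simp: fin_gen_def)
  have "\<exists>f. fibre M y \<subseteq> f ` lists (carrier F)" if "y \<in> P" for y
    using gen_card[OF M G(1) that G(2)] G(3) that subset_trans by meson
  then obtain f where f: "\<And>y. y \<in> P \<Longrightarrow> fibre M y \<subseteq> f y ` lists (carrier F)" by metis
  define \<rho> where "\<rho> y = \<iota> \<circ> inv_into (lists (carrier F)) (f y)" for y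
  have "inj_on (\<rho> y) (fibre M y)" if y: "y \<in> P" for y
    unfolding \<rho>_def
  proof (rule comp_inj_on)
    show "inj_on (inv_into (lists (carrier F)) (f y)) (fibre M y)" using f[OF y] by (rule inj_on_inv_into)
    show "inj_on \<iota> (inv_into (lists (carrier F)) (f y) ` fibre M y)"
      by (rule inj_on_subset[OF inj_\<iota>]) (use f[OF y] inv_into_into[of _ "f y" "lists (carrier F)"] in blast)
  qed
  then show ?thesis using that by (rule transport_rep[OF M])
qed

end

context poset_over_field begin

section \<open>Categories of representations\<close>

abbreviation comp_hom :: "('p, 'f, 'u) representation \<Rightarrow> ('p \<Rightarrow> 'v \<Rightarrow> 'w) \<Rightarrow> ('p \<Rightarrow> 'u \<Rightarrow> 'v) \<Rightarrow> 'p \<Rightarrow> 'u \<Rightarrow> 'w" where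
  "comp_hom L \<psi> \<phi> \<equiv> ext L (\<lambda>x v. \<psi> x (\<phi> x v))"

abbreviation id_hom :: "('p, 'f, 'v) representation \<Rightarrow> 'p \<Rightarrow> 'v \<Rightarrow> 'v" where
  "id_hom M \<equiv> ext M (\<lambda>x v. v)"

abbreviation zero_hom :: "('p, 'f, 'v) representation \<Rightarrow> ('p, 'f, 'w) representation \<Rightarrow> 'p \<Rightarrow> 'v \<Rightarrow> 'w" where
  "zero_hom M N \<equiv> ext M (\<lambda>x v. \<zero>\<^bsub>Val N x\<^esub>)"

lemma comp_hom_in: "\<lbrakk>is_rep L; \<phi> \<in> homs L M; \<psi> \<in> homs M N\<rbrakk> \<Longrightarrow> comp_hom L \<psi> \<phi> \<in> homs L N"
  by (rule ext_in_homs[OF natural_comp[OF homs_natural homs_natural]])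

lemma id_hom_in: "is_rep M \<Longrightarrow> id_hom M \<in> homs M M"
  by (rule ext_in_homs[OF natural_id])

lemma zero_hom_in: "is_rep M \<Longrightarrow> is_rep N \<Longrightarrow> zero_hom M N \<in> homs M N"
  by (rule ext_in_homs[OF natural_zero])

lemma add_hom_in:
  "\<lbrakk>is_rep M; is_rep N; \<phi> \<in> homs M N; \<psi> \<in> homs M N\<rbrakk> \<Longrightarrow>
    ext M (\<lambda>x v. \<phi> x v \<oplus>\<^bsub>Val N x\<^esub> \<psi> x v) \<in> homs M N"
  by (rule ext_in_homs[OF natural_add[OF _ _ homs_natural homs_natural]])

lemmas homs_intros = comp_hom_in id_hom_in zero_hom_in add_hom_in

text \<open>
  The full subcategory of the representations that satisfy \<open>Q\<close>.  Both \<open>Rep\<close>, with the trivial \<open>Q\<close>, and \<open>rep\<close> are of this form,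
  and in the noetherian case \<open>rep\<close> is also the one for finite generation.  Facts about all three are proved once.
\<close>

definition RC :: "(('p, 'f, 'v) representation \<Rightarrow> bool) \<Rightarrow> ('p, 'f, 'v) rep_category" where
  "RC Q = full_subcategory (Rep P r F) Q"

lemma Rep_as_RC: "Rep P r F = RC (\<lambda>_. True)"
  by (simp add: RC_def full_subcategory_def)

lemma rep_as_RC: "rep P r F = RC (finitely_presented P r F)"
  by (simp add: RC_def rep_def)

lemma RC_simps [simp]:
  "Obj (RC Q) = {M. is_rep M \<and> Q M}"
  "Hom (RC Q) M N = homs M N"
  "Comp (RC Q) L M N \<psi> \<phi> = comp_hom L \<psi> \<phi>"
  "Id (RC Q) M = id_hom M"
  "Add (RC Q) M N \<phi> \<psi> = ext M (\<lambda>x v. \<phi> x v \<oplus>\<^bsub>Val N x\<^esub> \<psi> x v)"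
  "Zero (RC Q) M N = zero_hom M N"
  by (auto simp: RC_def full_subcategory_def Rep_def ext_def)

lemma hom_group_RC [simp]:
  "carrier (hom_group (RC Q) M N) = homs M N"
  "\<phi> \<otimes>\<^bsub>hom_group (RC Q) M N\<^esub> \<psi> = ext M (\<lambda>x v. \<phi> x v \<oplus>\<^bsub>Val N x\<^esub> \<psi> x v)"
  "\<one>\<^bsub>hom_group (RC Q) M N\<^esub> = zero_hom M N"
  by (simp_all add: hom_group_def)

lemma hom_group_comm_group:
  assumes M: "is_rep M" and N: "is_rep N"
  shows "comm_group (hom_group (RC Q) M N)"
proof (rule comm_groupI)
  have mod: "module F (Val N x)" if "x \<in> P" for x using N that by (rule rep_module)
  note grp = module.axioms(2)[OF mod] and mon = abelian_group.axioms(1)[OF module.axioms(2)[OF mod]]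
  fix f assume f: "f \<in> carrier (hom_group (RC Q) M N)"
  then have f': "f \<in> homs M N" by simp
  show "\<one>\<^bsub>hom_group (RC Q) M N\<^esub> \<otimes>\<^bsub>hom_group (RC Q) M N\<^esub> f = f"
    by (rule homs_eqI[of _ M N _ N])
      (use M N f' in \<open>simp_all add: homs_intros homD(1)[OF f'] abelian_monoid.l_zero[OF mon]\<close>)
  \<comment> \<open>Scaling by \<open>-1\<close> gives additive inverses as a special case of scaling a morphism.\<close>
  have neg: "ext M (\<lambda>x v. (\<ominus>\<^bsub>F\<^esub> \<one>\<^bsub>F\<^esub>) \<odot>\<^bsub>Val N x\<^esub> f x v) \<in> homs M N"
    using M N homs_natural[OF f'] by (auto intro!: ext_in_homs natural_smult)
  show "\<exists>g\<in>carrier (hom_group (RC Q) M N). g \<otimes>\<^bsub>hom_group (RC Q) M N\<^esub> f = \<one>\<^bsub>hom_group (RC Q) M N\<^esub>"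
  proof (rule bexI, simp, rule ext_cong)
    show "ext M (\<lambda>x v. (\<ominus>\<^bsub>F\<^esub> \<one>\<^bsub>F\<^esub>) \<odot>\<^bsub>Val N x\<^esub> f x v) \<in> carrier (hom_group (RC Q) M N)"
      using neg by simp
    fix x v assume x: "x \<in> P" "v \<in> fibre M x"
    interpret N: module F "Val N x" using mod x(1) .
    show "ext M (\<lambda>x v. (\<ominus>\<^bsub>F\<^esub> \<one>\<^bsub>F\<^esub>) \<odot>\<^bsub>Val N x\<^esub> f x v) x v \<oplus>\<^bsub>Val N x\<^esub> f x v = \<zero>\<^bsub>Val N x\<^esub>"
      using x homD(1)[OF f'] by (simp add: N.smult_l_minus N.l_neg)
  qed
  fix g assume "g \<in> carrier (hom_group (RC Q) M N)"
  then have g': "g \<in> homs M N" by simp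
  show "f \<otimes>\<^bsub>hom_group (RC Q) M N\<^esub> g \<in> carrier (hom_group (RC Q) M N)"
    using M N f' g' by (simp add: homs_intros)
  show "f \<otimes>\<^bsub>hom_group (RC Q) M N\<^esub> g = g \<otimes>\<^bsub>hom_group (RC Q) M N\<^esub> f"
    by (simp, rule ext_cong) (simp add: abelian_monoid.a_comm[OF mon] homD(1)[OF f'] homD(1)[OF g'])
  fix h assume "h \<in> carrier (hom_group (RC Q) M N)"
  then have h': "h \<in> homs M N" by simp
  show "f \<otimes>\<^bsub>hom_group (RC Q) M N\<^esub> g \<otimes>\<^bsub>hom_group (RC Q) M N\<^esub> h =
      f \<otimes>\<^bsub>hom_group (RC Q) M N\<^esub> (g \<otimes>\<^bsub>hom_group (RC Q) M N\<^esub> h)"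
    by (simp, rule ext_cong)
      (simp add: abelian_monoid.a_assoc[OF mon] homD(1)[OF f'] homD(1)[OF g'] homD(1)[OF h'])
qed (use M N in \<open>simp add: homs_intros\<close>)

lemma preadditive_RC: "preadditive_category (RC Q)"
proof (rule preadditive_category.intro, goal_cases)
  case (3 X Y f)
  then show ?case by (auto intro!: homs_eqI[of _ X Y f Y] intro: homs_intros simp: homD(1))
next
  case (4 X Y f)
  then show ?case by (auto intro!: homs_eqI[of _ X Y f Y] intro: homs_intros simp: homD(1))
next
  case (5 W X Y Z f g h)
  then show ?case by (auto intro!: ext_cong simp: homD(1))
next
  case (6 X Y)
  then show ?case by (auto intro: hom_group_comm_group)
next
  case (7 X Y Z f g g')
  then show ?case by (auto intro!: ext_cong simp: homD(1))
next
  case (8 X Y Z f f' g)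
  then show ?case by (auto intro!: ext_cong simp: homD(1,2))
qed (auto intro: homs_intros)

text \<open>
  The sums of morphisms in the definition of a direct sum are evaluated by induction on the number of summands.
\<close>

lemma hom_sum_Suc:
  assumes M: "is_rep M" and N: "is_rep N" and f: "\<And>k. k < n \<Longrightarrow> f k \<in> homs M N" and m: "m < n"
  shows "finprod (hom_group (RC Q) M N) f {..<Suc m} =
    ext M (\<lambda>x v. f m x v \<oplus>\<^bsub>Val N x\<^esub> finprod (hom_group (RC Q) M N) f {..<m} x v)"
proof -
  interpret G: comm_group "hom_group (RC Q) M N" by (rule hom_group_comm_group[OF M N])
  have "finprod (hom_group (RC Q) M N) f (insert m {..<m}) =
      f m \<otimes>\<^bsub>hom_group (RC Q) M N\<^esub> finprod (hom_group (RC Q) M N) f {..<m}"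
    by (rule G.finprod_insert) (use f m in auto)
  then show ?thesis by (simp add: lessThan_Suc)
qed

lemma hom_sum_in:
  assumes M: "is_rep M" and N: "is_rep N" and f: "\<And>k. k < n \<Longrightarrow> f k \<in> homs M N"
  shows "finprod (hom_group (RC Q) M N) f {..<n} \<in> homs M N"
proof -
  interpret G: comm_group "hom_group (RC Q) M N" by (rule hom_group_comm_group[OF M N])
  show ?thesis using G.finprod_closed[of f "{..<n}"] f by auto
qed

lemma hom_sum_0: "is_rep M \<Longrightarrow> is_rep N \<Longrightarrow> finprod (hom_group (RC Q) M N) f {..<0::nat} = zero_hom M N"
  using comm_monoid.finprod_empty[OF comm_group.axioms(1)[OF hom_group_comm_group]] by simp

text \<open>
  Kernels and cokernels can be recognised fibrewise, in every full subcategory: these are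
  the universal properties of subobjects and quotients proved above.
\<close>

lemma kernelI:
  assumes X: "is_rep X" "Q X" and Y: "is_rep Y" "Q Y" and K: "is_rep K" "Q K"
    and f: "f \<in> homs X Y" and k: "k \<in> homs K X"
    and inj: "\<And>x. x \<in> P \<Longrightarrow> inj_on (k x) (fibre K x)"
    and ker: "\<And>x v. x \<in> P \<Longrightarrow> v \<in> fibre X x \<Longrightarrow> f x v = \<zero>\<^bsub>Val Y x\<^esub> \<longleftrightarrow> v \<in> k x ` fibre K x"
  shows "is_kernel (RC Q) X Y f K k"
proof -
  have univ: "\<exists>!u. u \<in> homs Z K \<and> comp_hom Z k u = g"
    if Z: "is_rep Z" and g: "g \<in> homs Z X" and 0: "comp_hom Z f g = zero_hom Z Y" for Z g
  proof -
    have im: "g x v \<in> k x ` fibre K x" if "x \<in> P" "v \<in> fibre Z x" for x v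
    proof -
      have "f x (g x v) = \<zero>\<^bsub>Val Y x\<^esub>" using fun_cong[OF fun_cong[OF 0, of x], of v] that by simp
      then show ?thesis using ker that homD(1)[OF g] by simp
    qed
    obtain u where u: "u \<in> homs Z K" "\<And>x v. x \<in> P \<Longrightarrow> v \<in> fibre Z x \<Longrightarrow> k x (u x v) = g x v"
      using factor_through_injection[OF Z K(1) k g inj im] by blast
    show ?thesis
    proof (rule ex1I[of _ u], intro conjI)
      show "u \<in> homs Z K" by fact
      show "comp_hom Z k u = g" by (rule homs_eqI[OF comp_hom_in[OF Z u(1) k] g]) (simp add: u)
      fix w assume w: "w \<in> homs Z K \<and> comp_hom Z k w = g"
      show "w = u"
      proof (rule homs_eqI)
        show "w \<in> homs Z K" "u \<in> homs Z K" using w u by auto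
        fix x v assume x: "x \<in> P" "v \<in> fibre Z x"
        have "k x (w x v) = g x v" using w x by (metis ext_apply)
        then show "w x v = u x v"
          using u x inj_onD[OF inj[OF x(1)]] homD(1)[OF u(1) x] homD(1)[OF conjunct1[OF w] x] by simp
      qed
    qed
  qed
  have zero: "comp_hom K f k = zero_hom K Y" by (rule ext_cong) (simp add: ker homD(1)[OF k])
  show ?thesis
    unfolding is_kernel_def RC_simps
    by (intro conjI ballI impI; (rule univ, auto simp: zero; fail)?) (simp_all add: X Y K f k zero)
qed

lemma cokernelI:
  assumes X: "is_rep X" "Q X" and Y: "is_rep Y" "Q Y" and C: "is_rep C" "Q C"
    and f: "f \<in> homs X Y" and c: "c \<in> homs Y C"
    and surj: "\<And>x. x \<in> P \<Longrightarrow> fibre C x \<subseteq> c x ` fibre Y x"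
    and ker: "\<And>x v. x \<in> P \<Longrightarrow> v \<in> fibre Y x \<Longrightarrow> c x v = \<zero>\<^bsub>Val C x\<^esub> \<longleftrightarrow> v \<in> f x ` fibre X x"
  shows "is_cokernel (RC Q) X Y f C c"
proof -
  have univ: "\<exists>!u. u \<in> homs C Z \<and> comp_hom Y u c = g"
    if Z: "is_rep Z" and g: "g \<in> homs Y Z" and 0: "comp_hom X g f = zero_hom X Z" for Z g
  proof -
    have ker': "g x v = \<zero>\<^bsub>Val Z x\<^esub>" if x: "x \<in> P" "v \<in> fibre Y x" "c x v = \<zero>\<^bsub>Val C x\<^esub>" for x v
    proof -
      obtain w where w: "w \<in> fibre X x" "v = f x w" using ker x by auto
      then show ?thesis using fun_cong[OF fun_cong[OF 0, of x], of w] x by simp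
    qed
    obtain u where u: "u \<in> homs C Z" "\<And>x v. x \<in> P \<Longrightarrow> v \<in> fibre Y x \<Longrightarrow> u x (c x v) = g x v"
      using factor_through_surjection[OF Y(1) C(1) Z c g surj ker'] by blast
    show ?thesis
    proof (rule ex1I[of _ u], intro conjI)
      show "u \<in> homs C Z" by fact
      show "comp_hom Y u c = g" by (rule homs_eqI[OF comp_hom_in[OF Y(1) c u(1)] g]) (simp add: u)
      fix w assume w: "w \<in> homs C Z \<and> comp_hom Y w c = g"
      show "w = u"
      proof (rule homs_eqI)
        show "w \<in> homs C Z" "u \<in> homs C Z" using w u by auto
        fix x v assume x: "x \<in> P" "v \<in> fibre C x"
        then obtain v' where v': "v' \<in> fibre Y x" "v = c x v'" using surj by blast
        have "w x (c x v') = g x v'" using w x(1) v'(1) by (metis ext_apply)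
        then show "w x v = u x v" using u x v' by simp
      qed
    qed
  qed
  have zero: "comp_hom X c f = zero_hom X C" by (rule ext_cong) (simp add: ker homD(1)[OF f])
  show ?thesis
    unfolding is_cokernel_def RC_simps
    by (intro conjI ballI impI; (rule univ, auto simp: zero; fail)?) (simp_all add: X Y C f c zero)
qed

lemma zero_objectI:
  assumes M: "is_rep M" "Q M" and zero: "\<And>x. x \<in> P \<Longrightarrow> fibre M x \<subseteq> {\<zero>\<^bsub>Val M x\<^esub>}"
  shows "zero_object (RC Q) M"
proof -
  have "(\<exists>!f. f \<in> homs M Y) \<and> (\<exists>!f. f \<in> homs Y M)" if Y: "is_rep Y" for Y
  proof (intro conjI ex1I)
    show "zero_hom M Y \<in> homs M Y" "zero_hom Y M \<in> homs Y M" using M Y by (auto intro: zero_hom_in)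
    show "f = zero_hom M Y" if f: "f \<in> homs M Y" for f
    proof (rule homs_eqI[OF f zero_hom_in[OF M(1) Y]])
      fix x v assume "x \<in> P" "v \<in> fibre M x"
      moreover from this have "v = \<zero>\<^bsub>Val M x\<^esub>" using zero by auto
      ultimately show "f x v = zero_hom M Y x v" using hom_zero[OF f M(1) Y] by simp
    qed
    show "f = zero_hom Y M" if f: "f \<in> homs Y M" for f
      by (rule homs_eqI[OF f zero_hom_in[OF Y M(1)]]) (use homD(1)[OF f] zero in auto)
  qed
  then show ?thesis using M unfolding zero_object_def RC_simps mem_Collect_eq by blast
qed

lemma monoI:
  assumes "is_rep M" "Q M" "is_rep N" "Q N" "k \<in> homs M N" "\<And>x. x \<in> P \<Longrightarrow> inj_on (k x) (fibre M x)"
  shows "is_mono (RC Q) M N k"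
  unfolding is_mono_def RC_simps
proof (intro conjI ballI impI)
  fix Z g h assume Z: "Z \<in> {M. is_rep M \<and> Q M}" and g: "g \<in> homs Z M" and h: "h \<in> homs Z M"
    and eq: "comp_hom Z k g = comp_hom Z k h"
  show "g = h"
  proof (rule homs_eqI[OF g h])
    fix x v assume x: "x \<in> P" "v \<in> fibre Z x"
    have "k x (g x v) = k x (h x v)" using fun_cong[OF fun_cong[OF eq, of x], of v] x by simp
    then show "g x v = h x v"
      using inj_onD[OF assms(6)[OF x(1)]] homD(1)[OF g x] homD(1)[OF h x] by simp
  qed
qed (use assms in auto)

lemma bij_inverse:
  assumes M: "is_rep M" and N: "is_rep N" and q: "q \<in> homs M N"
    and bij: "\<And>x. x \<in> P \<Longrightarrow> bij_betw (q x) (fibre M x) (fibre N x)"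
  obtains u where "u \<in> homs N M"
    "\<And>x v. x \<in> P \<Longrightarrow> v \<in> fibre M x \<Longrightarrow> u x (q x v) = v"
    "\<And>x v. x \<in> P \<Longrightarrow> v \<in> fibre N x \<Longrightarrow> q x (u x v) = v"
proof -
  have inj: "inj_on (q x) (fibre M x)" if "x \<in> P" for x using bij[OF that] by (rule bij_betw_imp_inj_on)
  have im: "id_hom N x v \<in> q x ` fibre M x" if "x \<in> P" "v \<in> fibre N x" for x v
    using bij_betw_imp_surj_on[OF bij[OF that(1)]] that by simp
  obtain u where u: "u \<in> homs N M" "\<And>x v. x \<in> P \<Longrightarrow> v \<in> fibre N x \<Longrightarrow> q x (u x v) = id_hom N x v"
    using factor_through_injection[OF N M q id_hom_in[OF N] inj im] by blast
  have "u x (q x v) = v" if x: "x \<in> P" "v \<in> fibre M x" for x v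
    using u(2)[OF x(1) homD(1)[OF q x]] homD(1)[OF q x] homD(1)[OF u(1) x(1)] inj_onD[OF inj[OF x(1)]] x
    by simp
  then show ?thesis using that u by simp
qed

lemma isoI:
  assumes "is_rep M" "Q M" "is_rep N" "Q N" "q \<in> homs M N"
    and "\<And>x. x \<in> P \<Longrightarrow> bij_betw (q x) (fibre M x) (fibre N x)"
  shows "is_iso (RC Q) M N q"
proof -
  obtain u where u: "u \<in> homs N M" "\<And>x v. x \<in> P \<Longrightarrow> v \<in> fibre M x \<Longrightarrow> u x (q x v) = v"
    "\<And>x v. x \<in> P \<Longrightarrow> v \<in> fibre N x \<Longrightarrow> q x (u x v) = v"
    using bij_inverse[OF assms(1,3,5,6)] by blast
  have "comp_hom M u q = id_hom M" "comp_hom N q u = id_hom N" by (auto intro!: ext_cong simp: u)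
  then show ?thesis using assms u(1) by (auto simp: is_iso_def)
qed

lemma isoD:
  assumes "is_iso (RC Q) M N q"
  shows "is_rep M" "is_rep N" "q \<in> homs M N" "x \<in> P \<Longrightarrow> bij_betw (q x) (fibre M x) (fibre N x)"
proof -
  show q: "is_rep M" "is_rep N" "q \<in> homs M N" using assms by (auto simp: is_iso_def)
  obtain u where u: "u \<in> homs N M" "comp_hom M u q = id_hom M" "comp_hom N q u = id_hom N"
    using assms by (auto simp: is_iso_def)
  show "bij_betw (q x) (fibre M x) (fibre N x)" if x: "x \<in> P"
  proof (rule bij_betw_byWitness[of _ "u x"])
    show "\<forall>v\<in>fibre M x. u x (q x v) = v" using u(2) x by (metis ext_apply)
    show "\<forall>v\<in>fibre N x. q x (u x v) = v" using u(3) x by (metis ext_apply)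
  qed (use x homD(1)[OF q(3)] homD(1)[OF u(1)] in auto)
qed

definition sub_rep :: "('p, 'f, 'v) representation \<Rightarrow> ('p \<Rightarrow> 'v set) \<Rightarrow> ('p, 'f, 'v) representation" where
  "sub_rep M S = \<lparr>Val = (\<lambda>x. (Val M x)\<lparr>carrier := S x\<rparr>), Res = Res M\<rparr>"

lemma sub_rep_simps [simp]:
  "fibre (sub_rep M S) x = S x" "\<zero>\<^bsub>Val (sub_rep M S) x\<^esub> = \<zero>\<^bsub>Val M x\<^esub>"
  "u \<oplus>\<^bsub>Val (sub_rep M S) x\<^esub> v = u \<oplus>\<^bsub>Val M x\<^esub> v" "c \<odot>\<^bsub>Val (sub_rep M S) x\<^esub> v = c \<odot>\<^bsub>Val M x\<^esub> v"
  "Res (sub_rep M S) = Res M"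
  by (simp_all add: sub_rep_def)

lemma sub_rep:
  assumes M: "is_rep M" and S: "subrep M S"
  shows "is_rep (sub_rep M S)" and "id_hom (sub_rep M S) \<in> homs (sub_rep M S) M"
proof -
  show R: "is_rep (sub_rep M S)" unfolding is_representation_def
  proof (intro conjI ballI impI)
    fix x assume x: "x \<in> P"
    interpret M: module F "Val M x" using M x by (rule rep_module)
    note S' = subrepD[OF S]
    show "module F (Val (sub_rep M S) x)"
    proof (rule moduleI)
      show "cring F" ..
      show "abelian_group (Val (sub_rep M S) x)"
      proof (rule abelian_groupI)
        fix a assume a: "a \<in> fibre (sub_rep M S) x"
        show "\<exists>b\<in>fibre (sub_rep M S) x. b \<oplus>\<^bsub>Val (sub_rep M S) x\<^esub> a = \<zero>\<^bsub>Val (sub_rep M S) x\<^esub>"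
        proof (rule bexI[of _ "(\<ominus>\<^bsub>F\<^esub> \<one>\<^bsub>F\<^esub>) \<odot>\<^bsub>Val M x\<^esub> a"])
          show "(\<ominus>\<^bsub>F\<^esub> \<one>\<^bsub>F\<^esub>) \<odot>\<^bsub>Val M x\<^esub> a \<in> fibre (sub_rep M S) x"
            using a S'(4)[OF x] by simp
          show "(\<ominus>\<^bsub>F\<^esub> \<one>\<^bsub>F\<^esub>) \<odot>\<^bsub>Val M x\<^esub> a \<oplus>\<^bsub>Val (sub_rep M S) x\<^esub> a = \<zero>\<^bsub>Val (sub_rep M S) x\<^esub>"
            using a S'(1)[OF x] by (simp add: M.smult_l_minus M.l_neg)
        qed
      qed (use x S' in \<open>auto simp: M.a_ac\<close>)
    qed (use x S' in \<open>auto simp: M.smult_l_distr M.smult_r_distr M.smult_assoc1\<close>)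
  qed (use subrepD[OF S] in \<open>auto simp: linear_map_def res_id res_res res_add res_smult M\<close>)
  show "id_hom (sub_rep M S) \<in> homs (sub_rep M S) M"
    by (rule ext_in_homs[OF naturalI R]) (auto dest: subrepD(1)[OF S])
qed

lemma sub_rep_inj: "x \<in> P \<Longrightarrow> inj_on (id_hom (sub_rep M S) x) (fibre (sub_rep M S) x)"
  by (auto intro: inj_onI)

lemma sub_rep_range: "x \<in> P \<Longrightarrow> id_hom (sub_rep M S) x ` S x = S x"
  by (force simp: image_iff)

lemma gen_sub_rep: "gen (sub_rep M S) G y = gen M G y"
proof (intro subset_antisym subsetI)
  fix w assume "w \<in> gen (sub_rep M S) G y"
  then show "w \<in> gen M G y" by induction (auto intro: gen.intros)
next
  fix w assume "w \<in> gen M G y"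
  then show "w \<in> gen (sub_rep M S) G y"
  proof induction
    case (gen_res x v) then show ?case using gen.gen_res[of x v G y "sub_rep M S"] by simp
  next
    case gen_zero then show ?case using gen.gen_zero[of "sub_rep M S" y G] by simp
  next
    case (gen_add u v) then show ?case using gen.gen_add[of u "sub_rep M S" G y v] by simp
  next
    case (gen_smult c v) then show ?case using gen.gen_smult[of c v "sub_rep M S" G y] by simp
  qed
qed

lemma fin_gen_sub_rep: "fin_gen (sub_rep M S) T \<longleftrightarrow> fin_gen M T"
  by (simp add: fin_gen_def gen_sub_rep)

lemma homs_eq_on_gen:
  assumes M: "is_rep M" and N: "is_rep N" and \<phi>: "\<phi> \<in> homs M N" and \<psi>: "\<psi> \<in> homs M N"
    and G: "G \<subseteq> Sigma P (fibre M)" "\<And>y. y \<in> P \<Longrightarrow> fibre M y \<subseteq> gen M G y"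
    and eq: "\<And>x v. (x, v) \<in> G \<Longrightarrow> \<phi> x v = \<psi> x v"
  shows "\<phi> = \<psi>"
proof (rule homs_eqI[OF \<phi> \<psi>])
  have sub: "subrep M (\<lambda>x. {v \<in> fibre M x. \<phi> x v = \<psi> x v})"
    by (rule subrepI) (auto simp: rep_closed res_closed M N homD[OF \<phi>] homD[OF \<psi>] hom_zero[OF \<phi> M N]
        hom_zero[OF \<psi> M N] le_in)
  fix x v assume x: "x \<in> P" "v \<in> fibre M x"
  have "gen M G x \<subseteq> {v \<in> fibre M x. \<phi> x v = \<psi> x v}"
    by (rule gen_least[OF sub _ x(1)]) (use G eq in auto)
  then show "\<phi> x v = \<psi> x v" using G(2)[OF x(1)] x(2) by auto
qed

lemma RC_kernelD:
  assumes ker: "is_kernel (RC Q) X Y f K k"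
  shows "is_rep X" "Q X" "is_rep Y" "Q Y" "is_rep K" "Q K" "f \<in> homs X Y" "k \<in> homs K X"
    and "x \<in> P \<Longrightarrow> v \<in> fibre K x \<Longrightarrow> f x (k x v) = \<zero>\<^bsub>Val Y x\<^esub>"
    and "\<lbrakk>is_rep Z; Q Z; g \<in> homs Z X; \<And>x v. x \<in> P \<Longrightarrow> v \<in> fibre Z x \<Longrightarrow> f x (g x v) = \<zero>\<^bsub>Val Y x\<^esub>\<rbrakk>
      \<Longrightarrow> \<exists>!u. u \<in> homs Z K \<and> comp_hom Z k u = g"
proof -
  show "is_rep X" "Q X" "is_rep Y" "Q Y" "is_rep K" "Q K" "f \<in> homs X Y" and k: "k \<in> homs K X"
    using ker unfolding is_kernel_def RC_simps by simp_all
  have fk: "comp_hom K f k = zero_hom K Y" using ker unfolding is_kernel_def RC_simps by (elim conjE)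
  show "f x (k x v) = \<zero>\<^bsub>Val Y x\<^esub>" if "x \<in> P" "v \<in> fibre K x"
    using fun_cong[OF fun_cong[OF fk, of x], of v] that by simp
  have univ: "\<forall>Z\<in>Obj (RC Q). \<forall>g\<in>homs Z X. comp_hom Z f g = zero_hom Z Y \<longrightarrow>
      (\<exists>!u. u \<in> homs Z K \<and> comp_hom Z k u = g)"
    using ker unfolding is_kernel_def RC_simps(2-6) by (elim conjE)
  assume "is_rep Z" "Q Z" "g \<in> homs Z X" "\<And>x v. x \<in> P \<Longrightarrow> v \<in> fibre Z x \<Longrightarrow> f x (g x v) = \<zero>\<^bsub>Val Y x\<^esub>"
  then show "\<exists>!u. u \<in> homs Z K \<and> comp_hom Z k u = g"
    by (intro univ[rule_format] ext_cong) auto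
qed

lemma RC_cokernelD:
  assumes cok: "is_cokernel (RC Q) X Y f M c"
  shows "is_rep X" "Q X" "is_rep Y" "Q Y" "is_rep M" "Q M" "f \<in> homs X Y" "c \<in> homs Y M"
    and "x \<in> P \<Longrightarrow> v \<in> fibre X x \<Longrightarrow> c x (f x v) = \<zero>\<^bsub>Val M x\<^esub>"
    and "\<lbrakk>is_rep Z; Q Z; g \<in> homs Y Z; \<And>x v. x \<in> P \<Longrightarrow> v \<in> fibre X x \<Longrightarrow> g x (f x v) = \<zero>\<^bsub>Val Z x\<^esub>\<rbrakk>
      \<Longrightarrow> \<exists>!u. u \<in> homs M Z \<and> comp_hom Y u c = g"
proof -
  show "is_rep X" "Q X" "is_rep Y" "Q Y" "is_rep M" "Q M" "f \<in> homs X Y" and c: "c \<in> homs Y M"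
    using cok unfolding is_cokernel_def RC_simps by simp_all
  have cf: "comp_hom X c f = zero_hom X M" using cok unfolding is_cokernel_def RC_simps by (elim conjE)
  show "c x (f x v) = \<zero>\<^bsub>Val M x\<^esub>" if "x \<in> P" "v \<in> fibre X x"
    using fun_cong[OF fun_cong[OF cf, of x], of v] that by simp
  have univ: "\<forall>Z\<in>Obj (RC Q). \<forall>g\<in>homs Y Z. comp_hom X g f = zero_hom X Z \<longrightarrow>
      (\<exists>!u. u \<in> homs M Z \<and> comp_hom Y u c = g)"
    using cok unfolding is_cokernel_def RC_simps(2-6) by (elim conjE)
  assume "is_rep Z" "Q Z" "g \<in> homs Y Z" "\<And>x v. x \<in> P \<Longrightarrow> v \<in> fibre X x \<Longrightarrow> g x (f x v) = \<zero>\<^bsub>Val Z x\<^esub>"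
  then show "\<exists>!u. u \<in> homs M Z \<and> comp_hom Y u c = g"
    by (intro univ[rule_format] ext_cong) auto
qed

lemma RC_monoD:
  assumes mono: "is_mono (RC Q) K X k"
  shows "is_rep K" "Q K" "is_rep X" "Q X" "k \<in> homs K X"
    and "\<lbrakk>is_rep Z; Q Z; g \<in> homs Z K; h \<in> homs Z K; \<And>x v. x \<in> P \<Longrightarrow> v \<in> fibre Z x \<Longrightarrow> k x (g x v) = k x (h x v)\<rbrakk>
      \<Longrightarrow> g = h"
proof -
  show "is_rep K" "Q K" "is_rep X" "Q X" "k \<in> homs K X"
    using mono unfolding is_mono_def RC_simps by simp_all
  have can: "\<forall>Z\<in>Obj (RC Q). \<forall>g\<in>homs Z K. \<forall>h\<in>homs Z K. comp_hom Z k g = comp_hom Z k h \<longrightarrow> g = h"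
    using mono unfolding is_mono_def RC_simps(2-6) by (elim conjE)
  assume a: "is_rep Z" "Q Z" "g \<in> homs Z K" "h \<in> homs Z K"
    "\<And>x v. x \<in> P \<Longrightarrow> v \<in> fibre Z x \<Longrightarrow> k x (g x v) = k x (h x v)"
  have "comp_hom Z k g = comp_hom Z k h" by (rule ext_cong) (rule a(5))
  then show "g = h" using can a(1-4) by simp
qed

lemma comp_homD: "comp_hom L g f = h \<Longrightarrow> x \<in> P \<Longrightarrow> v \<in> fibre L x \<Longrightarrow> g x (f x v) = h x v"
  by auto

section \<open>Representable functors\<close>

lemma hom_functor_simps [simp]:
  "fibre (hom_functor r F x) y = (if (y, x) \<in> r then carrier F else {\<zero>\<^bsub>F\<^esub>})"
  "\<zero>\<^bsub>Val (hom_functor r F x) y\<^esub> = \<zero>\<^bsub>F\<^esub>"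
  "a \<oplus>\<^bsub>Val (hom_functor r F x) y\<^esub> b = a \<oplus>\<^bsub>F\<^esub> b"
  "c \<odot>\<^bsub>Val (hom_functor r F x) y\<^esub> b = c \<otimes>\<^bsub>F\<^esub> b"
  "Res (hom_functor r F x) z y a = a"
  by (simp_all add: hom_functor_def)

lemma hom_functor_rep: "is_rep (hom_functor r F x)"
  unfolding is_representation_def
proof (intro conjI ballI impI)
  fix y assume y: "y \<in> P"
  show "module F (Val (hom_functor r F x) y)"
  proof (rule moduleI)
    show "cring F" ..
    show "abelian_group (Val (hom_functor r F x) y)"
    proof (rule abelian_groupI)
      fix a assume a: "a \<in> fibre (hom_functor r F x) y"
      show "\<exists>b\<in>fibre (hom_functor r F x) y. b \<oplus>\<^bsub>Val (hom_functor r F x) y\<^esub> a = \<zero>\<^bsub>Val (hom_functor r F x) y\<^esub>"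
        by (rule bexI[of _ "\<ominus>\<^bsub>F\<^esub> a"]) (use a in \<open>auto simp: F.l_neg split: if_splits\<close>)
    qed (auto simp: F.a_ac split: if_splits)
  qed (auto simp: F.l_distr F.r_distr F.m_assoc split: if_splits)
qed (auto simp: linear_map_def dest: le_trans)

text \<open>
  A universal element in the sense of Yoneda.  The nonvanishing of its restrictions records that the support of a
  functor represented by \<open>x\<close> is the whole down-set of \<open>x\<close>, which is how down-sets are recovered from representations.
\<close>

definition universal_element :: "('p, 'f, 'v) representation \<Rightarrow> 'p \<Rightarrow> 'v \<Rightarrow> bool" where
  "universal_element H x e \<longleftrightarrow> e \<in> fibre H x \<and> (\<forall>y\<in>P. fibre H y \<subseteq> gen H {(x, e)} y) \<and>
     (\<forall>y. (y, x) \<in> r \<longrightarrow> Res H y x e \<noteq> \<zero>\<^bsub>Val H y\<^esub>) \<and>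
     (\<forall>M :: ('p, 'f, 'v) representation. \<forall>v. is_rep M \<longrightarrow> v \<in> fibre M x \<longrightarrow> (\<exists>\<phi>\<in>homs H M. \<phi> x e = v))"

lemma universal_elementD:
  fixes H M :: "('p, 'f, 'v) representation"
  assumes "universal_element H x e"
  shows "e \<in> fibre H x" and "y \<in> P \<Longrightarrow> fibre H y \<subseteq> gen H {(x, e)} y"
    and "(y, x) \<in> r \<Longrightarrow> Res H y x e \<noteq> \<zero>\<^bsub>Val H y\<^esub>"
    and "is_rep M \<Longrightarrow> v \<in> fibre M x \<Longrightarrow> \<exists>\<phi>\<in>homs H M. \<phi> x e = v"
  using assms by (simp_all add: universal_element_def)

text \<open>
  The universal element corresponds to the identity of \<open>x\<close>, that is to \<open>1 \<in> F = Hom(x, x)\<close>.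
\<close>

lemma representable_universal_element:
  fixes H :: "('p, 'f, 'v) representation"
  assumes H: "representable_by P r F x H" and x: "x \<in> P"
  shows "\<exists>e. universal_element H x e"
proof -
  let ?h = "hom_functor r F x"
  have rep: "is_rep H" using H by (simp add: representable_by_def)
  obtain \<eta> where \<eta>: "\<eta> \<in> homs ?h H" "\<And>y. y \<in> P \<Longrightarrow> bij_betw (\<eta> y) (fibre ?h y) (fibre H y)"
    using H unfolding representable_by_def by blast
  have xx: "(x, x) \<in> r" using x by (rule le_refl)
  define e where "e = \<eta> x \<one>\<^bsub>F\<^esub>"
  have one: "\<one>\<^bsub>F\<^esub> \<in> fibre ?h y" if "(y, x) \<in> r" for y using that by simp
  have res_e: "Res H y x e = \<eta> y \<one>\<^bsub>F\<^esub>" if "(y, x) \<in> r" for y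
    using homD(4)[OF \<eta>(1) that one[OF xx]] by (simp add: e_def)
  have e: "e \<in> fibre H x" using homD(1)[OF \<eta>(1) x one[OF xx]] by (simp add: e_def)
  have zero: "\<eta> y \<zero>\<^bsub>F\<^esub> = \<zero>\<^bsub>Val H y\<^esub>" if "y \<in> P" for y
    using hom_zero[OF \<eta>(1) hom_functor_rep rep that] by simp
  have "fibre H y \<subseteq> gen H {(x, e)} y" if y: "y \<in> P" for y
  proof
    fix w assume "w \<in> fibre H y"
    then obtain a where a: "a \<in> fibre ?h y" "w = \<eta> y a"
      using bij_betw_imp_surj_on[OF \<eta>(2)[OF y]] by auto
    show "w \<in> gen H {(x, e)} y"
    proof (cases "(y, x) \<in> r")
      case True
      have aF: "a \<in> carrier F" using a True by simp
      have "w = a \<odot>\<^bsub>Val H y\<^esub> Res H y x e"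
        using homD(3)[OF \<eta>(1) y aF one[OF True]] a True aF by (simp add: res_e)
      then show ?thesis using True aF by (auto intro: gen.intros)
    next
      case False
      then show ?thesis using a zero[OF y] by (auto intro: gen.intros)
    qed
  qed
  moreover have "Res H y x e \<noteq> \<zero>\<^bsub>Val H y\<^esub>" if "(y, x) \<in> r" for y
  proof
    have y: "y \<in> P" using that le_in by blast
    assume "Res H y x e = \<zero>\<^bsub>Val H y\<^esub>"
    then have "\<eta> y \<one>\<^bsub>F\<^esub> = \<eta> y \<zero>\<^bsub>F\<^esub>" using zero[OF y] that by (simp add: res_e)
    then have "\<one>\<^bsub>F\<^esub> = \<zero>\<^bsub>F\<^esub>"
      by (rule inj_onD[OF bij_betw_imp_inj_on[OF \<eta>(2)[OF y]]]) (use that in auto)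
    then show False by simp
  qed
  moreover have "\<exists>\<phi>\<in>homs H M. \<phi> x e = v" if M: "is_rep M" and v: "v \<in> fibre M x"
    for M :: "('p, 'f, 'v) representation" and v
  proof -
    define g where "g y a = (if (y, x) \<in> r then a \<odot>\<^bsub>Val M y\<^esub> Res M y x v else \<zero>\<^bsub>Val M y\<^esub>)" for y a
    have rv: "Res M y x v \<in> fibre M y" if "(y, x) \<in> r" for y using res_closed[OF M that v] .
    have "natural ?h M g"
    proof (rule naturalI)
      fix y assume y: "y \<in> P"
      interpret M: module F "Val M y" using M y by (rule rep_module)
      show "g y a \<in> fibre M y" if "a \<in> fibre ?h y" for a
        using that rv[of y] by (auto simp: g_def split: if_splits)
      show "g y (a \<oplus>\<^bsub>Val ?h y\<^esub> b) = g y a \<oplus>\<^bsub>Val M y\<^esub> g y b" if "a \<in> fibre ?h y" "b \<in> fibre ?h y" for a b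
        using that rv[of y] by (auto simp: g_def M.smult_l_distr split: if_splits)
      show "g y (c \<odot>\<^bsub>Val ?h y\<^esub> a) = c \<odot>\<^bsub>Val M y\<^esub> g y a" if "c \<in> carrier F" "a \<in> fibre ?h y" for c a
        using that rv[of y] by (auto simp: g_def M.smult_assoc1 split: if_splits)
    next
      fix y z a assume zy: "(z, y) \<in> r" and a: "a \<in> fibre ?h y"
      have z: "z \<in> P" and y: "y \<in> P" using le_in zy by auto
      interpret M: module F "Val M z" using M z by (rule rep_module)
      show "g z (Res ?h z y a) = Res M z y (g y a)"
      proof (cases "(y, x) \<in> r")
        case True
        then show ?thesis using a le_trans[OF zy True] rv[OF True] v
          by (simp add: g_def res_smult[OF M zy] res_res[OF M True zy])
      next
        case False
        then show ?thesis using a rv[of z] by (auto simp: g_def res_zero[OF M zy])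
      qed
    qed
    then have g: "ext ?h g \<in> homs ?h M" using hom_functor_rep by (rule ext_in_homs)
    have surj: "fibre H y \<subseteq> \<eta> y ` fibre ?h y" if "y \<in> P" for y
      using bij_betw_imp_surj_on[OF \<eta>(2)[OF that]] by simp
    have ker: "ext ?h g y a = \<zero>\<^bsub>Val M y\<^esub>" if "y \<in> P" "a \<in> fibre ?h y" "\<eta> y a = \<zero>\<^bsub>Val H y\<^esub>" for y a
    proof -
      have "\<eta> y a = \<eta> y \<zero>\<^bsub>F\<^esub>" using that zero by simp
      then have "a = \<zero>\<^bsub>Val ?h y\<^esub>"
        using inj_onD[OF bij_betw_imp_inj_on[OF \<eta>(2)[OF that(1)]], of a "\<zero>\<^bsub>F\<^esub>"] that by (auto split: if_splits)
      then show ?thesis using hom_zero[OF g hom_functor_rep M that(1)] by simp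
    qed
    obtain u where u: "u \<in> homs H M" "\<And>y a. y \<in> P \<Longrightarrow> a \<in> fibre ?h y \<Longrightarrow> u y (\<eta> y a) = ext ?h g y a"
      using factor_through_surjection[OF hom_functor_rep rep M \<eta>(1) g surj ker] by blast
    have "u x e = g x \<one>\<^bsub>F\<^esub>" using u(2)[OF x one[OF xx]] xx x by (simp add: e_def)
    also have "\<dots> = v" using xx v module.smult_one[OF rep_module[OF M x]] res_id[OF M x v] by (simp add: g_def)
    finally show ?thesis using u(1) by blast
  qed
  ultimately have "universal_element H x e" using e unfolding universal_element_def by blast
  then show ?thesis ..
qed

section \<open>Direct sums\<close>

text \<open>
  The direct sum is first formed with tuples as elements, that is in the universe \<open>nat \<Rightarrow> 'v\<close>, and moved to \<open>'v\<close> afterwards.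
\<close>

definition dsum :: "nat \<Rightarrow> (nat \<Rightarrow> ('p, 'f, 'v) representation) \<Rightarrow> ('p, 'f, nat \<Rightarrow> 'v) representation" where
  "dsum n X = \<lparr>Val = (\<lambda>x. \<lparr>carrier = (\<Pi>\<^sub>E k\<in>{..<n}. fibre (X k) x), monoid.mult = undefined, one = undefined,
      zero = (\<lambda>k\<in>{..<n}. \<zero>\<^bsub>Val (X k) x\<^esub>),
      add = (\<lambda>a b. \<lambda>k\<in>{..<n}. a k \<oplus>\<^bsub>Val (X k) x\<^esub> b k),
      smult = (\<lambda>c a. \<lambda>k\<in>{..<n}. c \<odot>\<^bsub>Val (X k) x\<^esub> a k)\<rparr>),
    Res = (\<lambda>y x a. \<lambda>k\<in>{..<n}. Res (X k) y x (a k))\<rparr>"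

lemma dsum_simps [simp]:
  "fibre (dsum n X) x = (\<Pi>\<^sub>E k\<in>{..<n}. fibre (X k) x)"
  "\<zero>\<^bsub>Val (dsum n X) x\<^esub> = (\<lambda>k\<in>{..<n}. \<zero>\<^bsub>Val (X k) x\<^esub>)"
  "a \<oplus>\<^bsub>Val (dsum n X) x\<^esub> b = (\<lambda>k\<in>{..<n}. a k \<oplus>\<^bsub>Val (X k) x\<^esub> b k)"
  "c \<odot>\<^bsub>Val (dsum n X) x\<^esub> a = (\<lambda>k\<in>{..<n}. c \<odot>\<^bsub>Val (X k) x\<^esub> a k)"
  "Res (dsum n X) y x a = (\<lambda>k\<in>{..<n}. Res (X k) y x (a k))"
  by (simp_all add: dsum_def)

lemma dsum_eqI:
  assumes "a \<in> (\<Pi>\<^sub>E k\<in>{..<n}. A k)" "b \<in> (\<Pi>\<^sub>E k\<in>{..<n}. B k)" "\<And>k. k < n \<Longrightarrow> a k = b k"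
  shows "a = b"
  using assms by (metis PiE_ext PiE_iff extensionalityI lessThan_iff)

lemma dsum_rep:
  assumes X: "\<And>k. k < n \<Longrightarrow> is_rep (X k)"
  shows "is_rep (dsum n X)"
  unfolding is_representation_def
proof (intro conjI ballI impI)
  fix x assume x: "x \<in> P"
  have mod: "module F (Val (X k) x)" if "k < n" for k using rep_module[OF X[OF that] x] .
  note grp = module.axioms(2)[OF mod] and mon = abelian_group.axioms(1)[OF module.axioms(2)[OF mod]]
  show "module F (Val (dsum n X) x)"
  proof (rule moduleI)
    show "cring F" ..
    show "abelian_group (Val (dsum n X) x)"
    proof (rule abelian_groupI)
      fix a assume a: "a \<in> fibre (dsum n X) x"
      show "\<zero>\<^bsub>Val (dsum n X) x\<^esub> \<oplus>\<^bsub>Val (dsum n X) x\<^esub> a = a"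
        by (rule dsum_eqI[of _ n "\<lambda>_. UNIV" _ "\<lambda>_. UNIV"])
          (use a in \<open>auto simp: abelian_monoid.l_zero[OF mon] PiE_iff\<close>)
      show "\<exists>b\<in>fibre (dsum n X) x. b \<oplus>\<^bsub>Val (dsum n X) x\<^esub> a = \<zero>\<^bsub>Val (dsum n X) x\<^esub>"
        by (rule bexI[of _ "\<lambda>k\<in>{..<n}. \<ominus>\<^bsub>Val (X k) x\<^esub> a k"])
          (use a in \<open>auto simp: abelian_group.l_neg[OF grp] abelian_group.a_inv_closed[OF grp] PiE_iff\<close>)
      fix b assume b: "b \<in> fibre (dsum n X) x"
      show "a \<oplus>\<^bsub>Val (dsum n X) x\<^esub> b \<in> fibre (dsum n X) x"
        using a b by (auto simp: abelian_monoid.a_closed[OF mon] PiE_iff)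
      show "a \<oplus>\<^bsub>Val (dsum n X) x\<^esub> b = b \<oplus>\<^bsub>Val (dsum n X) x\<^esub> a"
        using a b by (auto simp: abelian_monoid.a_comm[OF mon] PiE_iff restrict_def)
      fix c assume c: "c \<in> fibre (dsum n X) x"
      show "a \<oplus>\<^bsub>Val (dsum n X) x\<^esub> b \<oplus>\<^bsub>Val (dsum n X) x\<^esub> c = a \<oplus>\<^bsub>Val (dsum n X) x\<^esub> (b \<oplus>\<^bsub>Val (dsum n X) x\<^esub> c)"
        using a b c by (auto simp: abelian_monoid.a_assoc[OF mon] PiE_iff restrict_def)
    qed (auto simp: abelian_monoid.zero_closed[OF mon])
    fix c a assume ca: "c \<in> carrier F" "a \<in> fibre (dsum n X) x"
    show "c \<odot>\<^bsub>Val (dsum n X) x\<^esub> a \<in> fibre (dsum n X) x"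
      using ca by (auto simp: module.smult_closed[OF mod] PiE_iff)
    fix b assume b: "b \<in> fibre (dsum n X) x"
    show "c \<odot>\<^bsub>Val (dsum n X) x\<^esub> (a \<oplus>\<^bsub>Val (dsum n X) x\<^esub> b) =
        c \<odot>\<^bsub>Val (dsum n X) x\<^esub> a \<oplus>\<^bsub>Val (dsum n X) x\<^esub> c \<odot>\<^bsub>Val (dsum n X) x\<^esub> b"
      using ca b by (auto simp: module.smult_r_distr[OF mod] PiE_iff restrict_def)
  next
    fix c d a assume h: "c \<in> carrier F" "d \<in> carrier F" "a \<in> fibre (dsum n X) x"
    show "(c \<oplus>\<^bsub>F\<^esub> d) \<odot>\<^bsub>Val (dsum n X) x\<^esub> a = c \<odot>\<^bsub>Val (dsum n X) x\<^esub> a \<oplus>\<^bsub>Val (dsum n X) x\<^esub> d \<odot>\<^bsub>Val (dsum n X) x\<^esub> a"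
      using h by (auto simp: module.smult_l_distr[OF mod] PiE_iff restrict_def)
    show "(c \<otimes>\<^bsub>F\<^esub> d) \<odot>\<^bsub>Val (dsum n X) x\<^esub> a = c \<odot>\<^bsub>Val (dsum n X) x\<^esub> (d \<odot>\<^bsub>Val (dsum n X) x\<^esub> a)"
      using h by (auto simp: module.smult_assoc1[OF mod] PiE_iff restrict_def)
  next
    fix a assume a: "a \<in> fibre (dsum n X) x"
    show "\<one>\<^bsub>F\<^esub> \<odot>\<^bsub>Val (dsum n X) x\<^esub> a = a"
      by (rule dsum_eqI[of _ n "\<lambda>_. UNIV" _ "\<lambda>_. UNIV"])
        (use a in \<open>auto simp: module.smult_one[OF mod] PiE_iff\<close>)
  qed
  show "Res (dsum n X) x x a = a" if a: "a \<in> fibre (dsum n X) x" for a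
    by (rule dsum_eqI[of _ n "\<lambda>_. UNIV" _ "\<lambda>_. UNIV"])
      (use a in \<open>auto simp: res_id[OF X x] PiE_iff\<close>)
next
  fix x y assume x: "x \<in> P" and y: "y \<in> P" and yx: "(y, x) \<in> r"
  have comp: "a k \<in> fibre (X k) x" if "a \<in> fibre (dsum n X) x" "k < n" for a k
    using PiE_mem[of a "{..<n}" _ k] that by simp
  show "linear_map F (Val (dsum n X) x) (Val (dsum n X) y) (Res (dsum n X) y x)"
    unfolding linear_map_def
  proof (intro conjI ballI Pi_I)
    fix a assume a: "a \<in> fibre (dsum n X) x"
    show "Res (dsum n X) y x a \<in> fibre (dsum n X) y"
      by (simp add: restrict_PiE_iff res_closed[OF X yx] comp[OF a])
    show "Res (dsum n X) y x (c \<odot>\<^bsub>Val (dsum n X) x\<^esub> a) = c \<odot>\<^bsub>Val (dsum n X) y\<^esub> Res (dsum n X) y x a"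
      if "c \<in> carrier F" for c
      unfolding dsum_simps by (rule restrict_ext) (simp add: res_smult[OF X yx] comp[OF a] that)
    fix b assume b: "b \<in> fibre (dsum n X) x"
    show "Res (dsum n X) y x (a \<oplus>\<^bsub>Val (dsum n X) x\<^esub> b) =
        Res (dsum n X) y x a \<oplus>\<^bsub>Val (dsum n X) y\<^esub> Res (dsum n X) y x b"
      unfolding dsum_simps by (rule restrict_ext) (simp add: res_add[OF X yx] comp[OF a] comp[OF b])
  qed
next
  fix x y z a assume yx: "(y, x) \<in> r" and zy: "(z, y) \<in> r" and a: "a \<in> fibre (dsum n X) x"
  have comp: "a k \<in> fibre (X k) x" if "k < n" for k
    using PiE_mem[of a "{..<n}" _ k] a that by simp
  show "Res (dsum n X) z y (Res (dsum n X) y x a) = Res (dsum n X) z x a"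
    unfolding dsum_simps by (rule restrict_ext) (simp add: res_res[OF X yx zy] comp)
qed

definition inj_dsum :: "nat \<Rightarrow> (nat \<Rightarrow> ('p, 'f, 'v) representation) \<Rightarrow> nat \<Rightarrow> 'p \<Rightarrow> 'v \<Rightarrow> nat \<Rightarrow> 'v" where
  "inj_dsum n X k = ext (X k) (\<lambda>x v. \<lambda>l\<in>{..<n}. if l = k then v else \<zero>\<^bsub>Val (X l) x\<^esub>)"

definition proj_dsum :: "nat \<Rightarrow> (nat \<Rightarrow> ('p, 'f, 'v) representation) \<Rightarrow> nat \<Rightarrow> 'p \<Rightarrow> (nat \<Rightarrow> 'v) \<Rightarrow> 'v" where
  "proj_dsum n X k = ext (dsum n X) (\<lambda>x a. a k)"

lemma inj_dsum_in:
  assumes X: "\<And>k. k < n \<Longrightarrow> is_rep (X k)" and k: "k < n"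
  shows "inj_dsum n X k \<in> homs (X k) (dsum n X)"
  unfolding inj_dsum_def
proof (rule ext_in_homs[OF naturalI X[OF k]])
  fix x assume x: "x \<in> P"
  have mod: "module F (Val (X k) x)" if "k < n" for k using rep_module[OF X[OF that] x] .
  note mon = abelian_group.axioms(1)[OF module.axioms(2)[OF mod]]
  fix v assume v: "v \<in> fibre (X k) x"
  show "(\<lambda>l\<in>{..<n}. if l = k then v else \<zero>\<^bsub>Val (X l) x\<^esub>) \<in> fibre (dsum n X) x"
    using v by (auto simp: abelian_monoid.zero_closed[OF mon])
  show "(\<lambda>l\<in>{..<n}. if l = k then c \<odot>\<^bsub>Val (X k) x\<^esub> v else \<zero>\<^bsub>Val (X l) x\<^esub>) =
      c \<odot>\<^bsub>Val (dsum n X) x\<^esub> (\<lambda>l\<in>{..<n}. if l = k then v else \<zero>\<^bsub>Val (X l) x\<^esub>)" if "c \<in> carrier F" for c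
    using that by (auto simp: module.smult_r_null[OF mod] restrict_def)
  fix u assume u: "u \<in> fibre (X k) x"
  show "(\<lambda>l\<in>{..<n}. if l = k then v \<oplus>\<^bsub>Val (X k) x\<^esub> u else \<zero>\<^bsub>Val (X l) x\<^esub>) =
      (\<lambda>l\<in>{..<n}. if l = k then v else \<zero>\<^bsub>Val (X l) x\<^esub>) \<oplus>\<^bsub>Val (dsum n X) x\<^esub>
      (\<lambda>l\<in>{..<n}. if l = k then u else \<zero>\<^bsub>Val (X l) x\<^esub>)"
    by (auto simp: abelian_monoid.l_zero[OF mon] abelian_monoid.zero_closed[OF mon] restrict_def)
qed (auto simp: res_zero[OF X] restrict_def)

lemma proj_dsum_in:
  assumes X: "\<And>k. k < n \<Longrightarrow> is_rep (X k)" and k: "k < n"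
  shows "proj_dsum n X k \<in> homs (dsum n X) (X k)"
  unfolding proj_dsum_def
  by (rule ext_in_homs[OF naturalI dsum_rep[OF X]]) (use k in \<open>auto simp: PiE_iff\<close>)

text \<open>\<open>truncate_sum n X m x a\<close> is the sum of the first \<open>m\<close> components of \<open>a\<close>.\<close>

definition truncate_sum :: "nat \<Rightarrow> (nat \<Rightarrow> ('p, 'f, 'v) representation) \<Rightarrow> nat \<Rightarrow> 'p \<Rightarrow> (nat \<Rightarrow> 'v) \<Rightarrow> nat \<Rightarrow> 'v" where
  "truncate_sum n X m x a = (\<lambda>l\<in>{..<n}. if l < m then a l else \<zero>\<^bsub>Val (X l) x\<^esub>)"

lemma truncate_sum:
  assumes X: "\<And>k. k < n \<Longrightarrow> is_rep (X k)" and x: "x \<in> P" and a: "a \<in> fibre (dsum n X) x"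
  shows "truncate_sum n X 0 x a = \<zero>\<^bsub>Val (dsum n X) x\<^esub>"
    and "truncate_sum n X n x a = a"
    and "m < n \<Longrightarrow> truncate_sum n X (Suc m) x a =
      inj_dsum n X m x (a m) \<oplus>\<^bsub>Val (dsum n X) x\<^esub> truncate_sum n X m x a"
    and "truncate_sum n X m x a \<in> fibre (dsum n X) x"
proof -
  have mod: "module F (Val (X k) x)" if "k < n" for k using rep_module[OF X[OF that] x] .
  note mon = abelian_group.axioms(1)[OF module.axioms(2)[OF mod]]
  show "truncate_sum n X 0 x a = \<zero>\<^bsub>Val (dsum n X) x\<^esub>" by (simp add: truncate_sum_def)
  show "truncate_sum n X n x a = a"
    by (rule dsum_eqI[of _ n "\<lambda>_. UNIV" _ "\<lambda>_. UNIV"])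
      (use a in \<open>auto simp: truncate_sum_def PiE_iff\<close>)
  show "truncate_sum n X (Suc m) x a = inj_dsum n X m x (a m) \<oplus>\<^bsub>Val (dsum n X) x\<^esub> truncate_sum n X m x a"
    if m: "m < n"
  proof -
    have am: "a m \<in> fibre (X m) x" using a m by (auto simp: PiE_iff)
    show ?thesis
      using a m x am by (auto simp: truncate_sum_def inj_dsum_def restrict_def PiE_iff fun_eq_iff less_Suc_eq
          abelian_monoid.l_zero[OF mon] abelian_monoid.r_zero[OF mon] abelian_monoid.zero_closed[OF mon])
  qed
  show "truncate_sum n X m x a \<in> fibre (dsum n X) x"
    using a by (auto simp: truncate_sum_def PiE_iff abelian_monoid.zero_closed[OF mon])
qed

text \<open>
  The images of the generators of the summands generate the sum, because each tuple is the sum of its components.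
  Finite generation is what allows the sum to be moved to the universe of its summands.
\<close>

lemma dsum_fin_gen:
  assumes X: "\<And>k. k < n \<Longrightarrow> is_rep (X k)" and fg: "\<And>k. k < n \<Longrightarrow> fin_gen (X k) (fibre (X k))"
  shows "fin_gen (dsum n X) (fibre (dsum n X))"
proof -
  note D = dsum_rep[of n X, OF X]
  have "\<forall>k. \<exists>G. k < n \<longrightarrow> finite G \<and> G \<subseteq> Sigma P (fibre (X k)) \<and> (\<forall>y\<in>P. fibre (X k) y \<subseteq> gen (X k) G y)"
    using fg by (auto simp: fin_gen_def)
  then obtain G where G: "\<And>k. k < n \<Longrightarrow> finite (G k)" "\<And>k. k < n \<Longrightarrow> G k \<subseteq> Sigma P (fibre (X k))"
    "\<And>k y. k < n \<Longrightarrow> y \<in> P \<Longrightarrow> fibre (X k) y \<subseteq> gen (X k) (G k) y" by metis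
  define E where "E k = (\<lambda>(x, v). (x, inj_dsum n X k x v)) ` G k" for k
  define U where "U = (\<Union>k<n. E k)"
  have fin: "finite U" using G(1) by (auto simp: U_def E_def)
  have E: "E k \<subseteq> Sigma P (fibre (dsum n X))" if "k < n" for k
    unfolding E_def using G(2)[OF that] homD(1)[OF inj_dsum_in[of n X k, OF X that]] by fast
  then have U: "U \<subseteq> Sigma P (fibre (dsum n X))" by (auto simp: U_def)
  have "a \<in> gen (dsum n X) U x" if x: "x \<in> P" and a: "a \<in> fibre (dsum n X) x" for x a
  proof -
    have "m \<le> n \<Longrightarrow> truncate_sum n X m x a \<in> gen (dsum n X) U x" for m
    proof (induction m)
      case 0
      then show ?case using truncate_sum(1)[of n X, OF X x a] by (metis gen_zero)
    next
      case (Suc m)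
      then have m: "m < n" by simp
      have "a m \<in> gen (X m) (G m) x" using G(3)[OF m x] a m by (auto simp: PiE_iff)
      then have "inj_dsum n X m x (a m) \<in> gen (dsum n X) (E m) x"
        using gen_image[OF X[OF m] D inj_dsum_in[of n X m, OF X m] G(2)[OF m] x] by (simp add: E_def)
      moreover have "E m \<subseteq> U" using m by (auto simp: U_def)
      ultimately have "inj_dsum n X m x (a m) \<in> gen (dsum n X) U x" using gen_mono by blast
      moreover have "truncate_sum n X m x a \<in> gen (dsum n X) U x" using Suc by simp
      ultimately show ?case using truncate_sum(3)[of n X, OF X x a m] gen_add by metis
    qed
    from this[of n] show ?thesis using truncate_sum(2)[of n X, OF X x a] by simp
  qed
  then show ?thesis unfolding fin_gen_def using fin U by (intro exI[of _ U]) blast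
qed

text \<open>
  Every isomorphic copy \<open>S\<close> of the sum of tuples is a biproduct; the statement has to be about copies because the sum of
  tuples itself is not an object of the category.
\<close>

lemma dsum_is_direct_sum:
  assumes X: "\<And>k. k < n \<Longrightarrow> is_rep (X k)" "\<And>k. k < n \<Longrightarrow> Q (X k)" and S: "is_rep S" "Q S"
    and q: "q \<in> homs (dsum n X) S" and bij: "\<And>x. x \<in> P \<Longrightarrow> bij_betw (q x) (fibre (dsum n X) x) (fibre S x)"
  shows "\<exists>i p. is_direct_sum (RC Q) n X S i p"
proof -
  note D = dsum_rep[of n X, OF X(1)]
  obtain u where u: "u \<in> homs S (dsum n X)" "\<And>x a. x \<in> P \<Longrightarrow> a \<in> fibre (dsum n X) x \<Longrightarrow> u x (q x a) = a"
    "\<And>x v. x \<in> P \<Longrightarrow> v \<in> fibre S x \<Longrightarrow> q x (u x v) = v"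
    using bij_inverse[OF D S(1) q bij] by blast
  define i where "i k = comp_hom (X k) q (inj_dsum n X k)" for k
  define p where "p k = comp_hom S (proj_dsum n X k) u" for k
  have i: "i k \<in> homs (X k) S" if "k < n" for k
    unfolding i_def by (rule comp_hom_in[OF X(1)[OF that] inj_dsum_in[of n X, OF X(1) that] q])
  have p: "p k \<in> homs S (X k)" if "k < n" for k
    unfolding p_def by (rule comp_hom_in[OF S(1) u(1) proj_dsum_in[of n X, OF X(1) that]])
  have pi: "comp_hom (X k) (p l) (i k) = (if k = l then id_hom (X k) else zero_hom (X k) (X l))"
    if k: "k < n" and l: "l < n" for k l
  proof -
    have "p l x (i k x v) = (if k = l then v else \<zero>\<^bsub>Val (X l) x\<^esub>)" if x: "x \<in> P" "v \<in> fibre (X k) x" for x v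
    proof -
      note iv = homD(1)[OF inj_dsum_in[of n X, OF X(1) k] x]
      have "p l x (i k x v) = inj_dsum n X k x v l"
        using u(2)[OF x(1) iv] x homD(1)[OF q x(1) iv] iv by (simp add: p_def i_def proj_dsum_def)
      then show ?thesis using x l by (simp add: inj_dsum_def)
    qed
    then show ?thesis by (auto intro!: ext_cong)
  qed
  let ?s = "\<lambda>m. finprod (hom_group (RC Q) S S) (\<lambda>k. comp_hom S (i k) (p k)) {..<m}"
  have ip: "comp_hom S (i k) (p k) \<in> homs S S" if "k < n" for k
    by (rule comp_hom_in[OF S(1) p[OF that] i[OF that]])
  have "m \<le> n \<Longrightarrow> x \<in> P \<Longrightarrow> v \<in> fibre S x \<Longrightarrow> ?s m x v = q x (truncate_sum n X m x (u x v))" for m x v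
  proof (induction m)
    case 0
    note tr = truncate_sum[of n X, OF X(1) 0(2) homD(1)[OF u(1) 0(2,3)]]
    have "q x (truncate_sum n X 0 x (u x v)) = \<zero>\<^bsub>Val S x\<^esub>"
      using hom_zero[OF q D S(1) 0(2)] by (simp only: tr(1))
    then show ?case using 0 hom_sum_0[OF S(1) S(1)] by simp
  next
    case (Suc m)
    then have m: "m < n" and x: "x \<in> P" and v: "v \<in> fibre S x" by auto
    note uv = homD(1)[OF u(1) x v]
    note tr = truncate_sum[of n X, OF X(1) x uv]
    have um: "u x v m \<in> fibre (X m) x" using uv m by (auto simp: PiE_iff)
    have "?s (Suc m) x v = i m x (p m x v) \<oplus>\<^bsub>Val S x\<^esub> ?s m x v"
      using hom_sum_Suc[OF S(1) S(1) ip m] x v by simp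
    also have "i m x (p m x v) = q x (inj_dsum n X m x (u x v m))"
      using x v uv um by (simp add: i_def p_def proj_dsum_def)
    also have "?s m x v = q x (truncate_sum n X m x (u x v))" using Suc by simp
    also have "q x (inj_dsum n X m x (u x v m)) \<oplus>\<^bsub>Val S x\<^esub> q x (truncate_sum n X m x (u x v)) =
        q x (truncate_sum n X (Suc m) x (u x v))"
      using homD(2)[OF q x homD(1)[OF inj_dsum_in[of n X, OF X(1) m] x um] tr(4)] tr(3)[OF _ m] by simp
    finally show ?case .
  qed
  from this[of n] have "?s n = id_hom S"
    using truncate_sum(2)[of n X, OF X(1) _ homD(1)[OF u(1)]]
    by (intro homs_eqI[OF hom_sum_in[OF S(1) S(1) ip] id_hom_in[OF S(1)]]) (simp_all add: u(3))
  then have "is_direct_sum (RC Q) n X S i p"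
    unfolding is_direct_sum_def RC_simps using X S i p pi by simp
  then show ?thesis by blast
qed

text \<open>
  Freeness is stated by its universal property, the form in which it is used to lift maps.
\<close>

definition free_on :: "('p, 'f, 'v) representation \<Rightarrow> nat \<Rightarrow> (nat \<Rightarrow> 'p) \<Rightarrow> (nat \<Rightarrow> 'v) \<Rightarrow> bool" where
  "free_on S n x e \<longleftrightarrow> (\<forall>k<n. x k \<in> P \<and> e k \<in> fibre S (x k)) \<and>
     (\<forall>y\<in>P. fibre S y \<subseteq> gen S ((\<lambda>k. (x k, e k)) ` {..<n}) y) \<and>
     (\<forall>(M :: ('p, 'f, 'v) representation) v. is_rep M \<longrightarrow> (\<forall>k<n. v k \<in> fibre M (x k)) \<longrightarrow>
        (\<exists>\<phi>\<in>homs S M. \<forall>k<n. \<phi> (x k) (e k) = v k))"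

text \<open>
  The images of the universal elements of the summands form a basis.  They generate since \<open>s\<close> is the sum of its
  components \<open>i k (p k s)\<close>, and a morphism with prescribed values on them is the sum of the \<open>f k \<circ> p k\<close>, where \<open>f k\<close> is
  given by the universal element of the \<open>k\<close>-th summand.
\<close>

lemma direct_sum_of_representables_free:
  fixes S :: "('p, 'f, 'v) representation"
  assumes x: "\<And>k. k < n \<Longrightarrow> x k \<in> P" and H: "\<And>k. k < n \<Longrightarrow> representable_by P r F (x k) (H k)"
    and sum: "is_direct_sum (RC Q) n H S i p"
  shows "\<exists>e. free_on S n x e"
proof -
  have S: "is_rep S" and Hr: "\<And>k. k < n \<Longrightarrow> is_rep (H k)"
    and i: "\<And>k. k < n \<Longrightarrow> i k \<in> homs (H k) S" and p: "\<And>k. k < n \<Longrightarrow> p k \<in> homs S (H k)"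
    and pi: "\<And>k l. k < n \<Longrightarrow> l < n \<Longrightarrow> comp_hom (H k) (p l) (i k) = (if k = l then id_hom (H k) else zero_hom (H k) (H l))"
    and ip: "finprod (hom_group (RC Q) S S) (\<lambda>k. comp_hom S (i k) (p k)) {..<n} = id_hom S"
    using sum unfolding is_direct_sum_def RC_simps by auto
  have "\<exists>g. k < n \<longrightarrow> universal_element (H k) (x k) g" for k
    using representable_universal_element[OF H x] by (cases "k < n") auto
  then obtain g where g': "\<And>k. k < n \<Longrightarrow> universal_element (H k) (x k) (g k)" by metis
  note g = universal_elementD[OF g']
  define e where "e k = i k (x k) (g k)" for k
  define E where "E = (\<lambda>k. (x k, e k)) ` {..<n}"
  have e: "e k \<in> fibre S (x k)" if "k < n" for k
    unfolding e_def by (rule homD(1)[OF i[OF that] x[OF that] g(1)[OF that]])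
  have "s \<in> gen S E y" if y: "y \<in> P" and s: "s \<in> fibre S y" for y s
  proof -
    let ?s = "\<lambda>m. finprod (hom_group (RC Q) S S) (\<lambda>k. comp_hom S (i k) (p k)) {..<m}"
    have ip_in: "comp_hom S (i k) (p k) \<in> homs S S" if "k < n" for k
      by (rule comp_hom_in[OF S p[OF that] i[OF that]])
    have "m \<le> n \<Longrightarrow> ?s m y s \<in> gen S E y" for m
    proof (induction m)
      case 0
      have "?s 0 y s = \<zero>\<^bsub>Val S y\<^esub>" unfolding hom_sum_0[OF S S] using y s by simp
      then show ?case by (simp add: gen_zero)
    next
      case (Suc m)
      then have m: "m < n" by simp
      have "p m y s \<in> gen (H m) {(x m, g m)} y" using g(2)[OF m y] homD(1)[OF p[OF m] y s] by blast
      then have "i m y (p m y s) \<in> gen S {(x m, e m)} y"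
        using gen_image[OF Hr[OF m] S i[OF m] _ y, of "{(x m, g m)}"] g(1)[OF m] x[OF m] by (auto simp: e_def)
      moreover have "{(x m, e m)} \<subseteq> E" using m by (auto simp: E_def)
      ultimately have "i m y (p m y s) \<in> gen S E y" using gen_mono by blast
      then show ?case using hom_sum_Suc[OF S S ip_in m] Suc y s by (simp add: gen_add)
    qed
    from this[of n] show ?thesis using ip y s by simp
  qed
  moreover have "\<exists>\<phi>\<in>homs S M. \<forall>k<n. \<phi> (x k) (e k) = v k"
    if M: "is_rep M" and v: "\<And>k. k < n \<Longrightarrow> v k \<in> fibre M (x k)" for M :: "('p, 'f, 'v) representation" and v
  proof -
    have "\<exists>f. k < n \<longrightarrow> f \<in> homs (H k) M \<and> f (x k) (g k) = v k" for k
      using g(4)[OF _ M v, of k] by (cases "k < n") auto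
    then obtain f where f: "\<And>k. k < n \<Longrightarrow> f k \<in> homs (H k) M" "\<And>k. k < n \<Longrightarrow> f k (x k) (g k) = v k" by metis
    let ?\<phi> = "\<lambda>m. finprod (hom_group (RC Q) S M) (\<lambda>k. comp_hom S (f k) (p k)) {..<m}"
    have fp: "comp_hom S (f k) (p k) \<in> homs S M" if "k < n" for k
      by (rule comp_hom_in[OF S p[OF that] f(1)[OF that]])
    have "m \<le> n \<Longrightarrow> k < n \<Longrightarrow> ?\<phi> m (x k) (e k) = (if k < m then v k else \<zero>\<^bsub>Val M (x k)\<^esub>)" for m k
    proof (induction m)
      case 0
      then show ?case unfolding hom_sum_0[OF S M] using x e by simp
    next
      case (Suc m)
      then have m: "m < n" and k: "k < n" by auto
      interpret M: module F "Val M (x k)" using M x[OF k] by (rule rep_module)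
      have "p m (x k) (e k) = (if k = m then id_hom (H k) else zero_hom (H k) (H m)) (x k) (g k)"
        using fun_cong[OF fun_cong[OF pi[OF k m], of "x k"], of "g k"] x[OF k] g(1)[OF k] by (simp add: e_def)
      then have "p m (x k) (e k) = (if k = m then g k else \<zero>\<^bsub>Val (H m) (x k)\<^esub>)"
        using x[OF k] g(1)[OF k] by auto
      then have "f m (x k) (p m (x k) (e k)) = (if k = m then v k else \<zero>\<^bsub>Val M (x k)\<^esub>)"
        using f(2)[OF k] hom_zero[OF f(1)[OF m] Hr[OF m] M x[OF k]] by auto
      then have "?\<phi> (Suc m) (x k) (e k) =
          (if k = m then v k else \<zero>\<^bsub>Val M (x k)\<^esub>) \<oplus>\<^bsub>Val M (x k)\<^esub> ?\<phi> m (x k) (e k)"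
        using hom_sum_Suc[OF S M fp m] x[OF k] e[OF k] by simp
      also have "?\<phi> m (x k) (e k) = (if k < m then v k else \<zero>\<^bsub>Val M (x k)\<^esub>)" using Suc by simp
      also have "(if k = m then v k else \<zero>\<^bsub>Val M (x k)\<^esub>) \<oplus>\<^bsub>Val M (x k)\<^esub> \<dots> =
          (if k < Suc m then v k else \<zero>\<^bsub>Val M (x k)\<^esub>)"
      proof (cases k m rule: linorder_cases)
        case equal
        have "v k \<oplus>\<^bsub>Val M (x k)\<^esub> \<zero>\<^bsub>Val M (x k)\<^esub> = v k" using v[OF k] by simp
        then show ?thesis using equal by simp
      qed (use v[OF k] in simp_all)
      finally show ?case .
    qed
    from this[of n] show ?thesis using hom_sum_in[OF S M fp] by (intro bexI[of _ "?\<phi> n"]) auto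
  qed
  ultimately show ?thesis using x e unfolding free_on_def E_def by blast
qed

lemma free_onD:
  fixes S M :: "('p, 'f, 'v) representation"
  assumes free: "free_on S n x e"
  shows "k < n \<Longrightarrow> x k \<in> P" "k < n \<Longrightarrow> e k \<in> fibre S (x k)"
    and "y \<in> P \<Longrightarrow> fibre S y \<subseteq> gen S ((\<lambda>k. (x k, e k)) ` {..<n}) y"
    and "is_rep M \<Longrightarrow> (\<And>k. k < n \<Longrightarrow> v k \<in> fibre M (x k)) \<Longrightarrow> \<exists>\<phi>\<in>homs S M. \<forall>k<n. \<phi> (x k) (e k) = v k"
  using free by (simp_all add: free_on_def)

end

context poset_universe begin

lemma ex_representable:
  assumes x: "x \<in> P"
  shows "\<exists>H :: ('p, 'f, 'v) representation. representable_by P r F x H"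
proof -
  let ?h = "hom_functor r F x"
  have "fibre ?h y \<subseteq> gen ?h {(x, \<one>\<^bsub>F\<^esub>)} y" if y: "y \<in> P" for y
  proof
    fix a assume a: "a \<in> fibre ?h y"
    show "a \<in> gen ?h {(x, \<one>\<^bsub>F\<^esub>)} y"
    proof (cases "(y, x) \<in> r")
      case True
      then have aF: "a \<in> carrier F" using a by simp
      have "a \<odot>\<^bsub>Val ?h y\<^esub> Res ?h y x \<one>\<^bsub>F\<^esub> \<in> gen ?h {(x, \<one>\<^bsub>F\<^esub>)} y"
        by (rule gen_smult[OF aF gen_res]) (use True in auto)
      then show ?thesis using aF by simp
    next
      case False
      then have "a = \<zero>\<^bsub>Val ?h y\<^esub>" using a by simp
      then show ?thesis by (metis gen_zero)
    qed
  qed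
  then have "fin_gen ?h (fibre ?h)"
    unfolding fin_gen_def by (intro exI[of _ "{(x, \<one>\<^bsub>F\<^esub>)}"]) (use x le_refl in auto)
  then obtain N :: "('p, 'f, 'v) representation" and q where "is_rep N" "q \<in> homs ?h N"
    "\<And>y. y \<in> P \<Longrightarrow> bij_betw (q y) (fibre ?h y) (fibre N y)"
    using transport_fin_gen[OF hom_functor_rep] by metis
  then show ?thesis unfolding representable_by_def by blast
qed

text \<open>
  A fixed choice of a functor represented by \<open>x\<close> within the universe \<open>'v\<close>, and of a universal element in it.
\<close>

definition hrep :: "'p \<Rightarrow> ('p, 'f, 'v) representation" where
  "hrep x = (SOME H. representable_by P r F x H)"

definition hgen :: "'p \<Rightarrow> 'v" where
  "hgen x = (SOME e. universal_element (hrep x) x e)"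

lemma hrep_representable: "x \<in> P \<Longrightarrow> representable_by P r F x (hrep x)"
  unfolding hrep_def by (rule someI_ex[OF ex_representable])

lemma hrep_rep: "x \<in> P \<Longrightarrow> is_rep (hrep x)"
  using hrep_representable by (simp add: representable_by_def)

lemma hgen_universal: "x \<in> P \<Longrightarrow> universal_element (hrep x) x (hgen x)"
  unfolding hgen_def by (rule someI_ex[OF representable_universal_element[OF hrep_representable]])

lemmas hgen = universal_elementD[OF hgen_universal]

lemma hrep_homs_eqI:
  assumes x: "x \<in> P" and M: "is_rep M" and "\<phi> \<in> homs (hrep x) M" "\<psi> \<in> homs (hrep x) M"
    and "\<phi> x (hgen x) = \<psi> x (hgen x)"
  shows "\<phi> = \<psi>"
  by (rule homs_eq_on_gen[OF hrep_rep[OF x] M assms(3,4), of "{(x, hgen x)}"])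
    (use assms hgen(1,2)[OF x] in auto)

lemma fin_gen_hrep: "x \<in> P \<Longrightarrow> fin_gen (hrep x) (fibre (hrep x))"
  unfolding fin_gen_def by (intro exI[of _ "{(x, hgen x)}"]) (use hgen in auto)

text \<open>
  The sum of tuples is finitely generated, so it has an isomorphic copy in the universe \<open>'v\<close>.
\<close>

lemma ex_direct_sum:
  fixes X :: "nat \<Rightarrow> ('p, 'f, 'v) representation"
  assumes X: "\<And>k. k < n \<Longrightarrow> is_rep (X k)" and fg: "\<And>k. k < n \<Longrightarrow> fin_gen (X k) (fibre (X k))"
    and Q: "\<And>k. k < n \<Longrightarrow> Q (X k)" "\<And>S. is_rep S \<Longrightarrow> fin_gen S (fibre S) \<Longrightarrow> Q S"
  obtains S i p where "is_rep S" "fin_gen S (fibre S)" "is_direct_sum (RC Q) n X S i p"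
proof -
  have D: "is_rep (dsum n X)" using X by (rule dsum_rep)
  have fgD: "fin_gen (dsum n X) (fibre (dsum n X))" using X fg by (rule dsum_fin_gen)
  obtain S :: "('p, 'f, 'v) representation" and q where S: "is_rep S" "q \<in> homs (dsum n X) S"
    "\<And>x. x \<in> P \<Longrightarrow> bij_betw (q x) (fibre (dsum n X) x) (fibre S x)"
    using transport_fin_gen[OF D fgD] by metis
  have fgS: "fin_gen S (fibre S)"
    by (rule fin_gen_surjection[OF D S(1,2) _ fgD]) (use bij_betw_imp_surj_on[OF S(3)] in blast)
  obtain i p where "is_direct_sum (RC Q) n X S i p"
    using dsum_is_direct_sum[of n X Q S q] X Q S fgS by auto
  then show ?thesis using that S(1) fgS by blast
qed

section \<open>Finitely presented representations\<close>

lemma finite_sum_free: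
  fixes S :: "('p, 'f, 'v) representation"
  assumes "finite_sum_of_representables P r F S"
  shows "is_rep S" and "\<exists>n x e. free_on S n x e"
proof -
  obtain n H i p where H: "\<forall>k<n. \<exists>x\<in>P. representable_by P r F x (H k)" and sum: "is_direct_sum (Rep P r F) n H S i p"
    using assms unfolding finite_sum_of_representables_def by blast
  obtain x where x: "\<And>k. k < n \<Longrightarrow> x k \<in> P" "\<And>k. k < n \<Longrightarrow> representable_by P r F (x k) (H k)"
    using H by metis
  show "is_rep S" using sum unfolding is_direct_sum_def Rep_as_RC by simp
  show "\<exists>n x e. free_on S n x e"
    using direct_sum_of_representables_free[OF x sum[unfolded Rep_as_RC]] by blast
qed

lemma ex_free:
  assumes x: "\<And>k. k < n \<Longrightarrow> x k \<in> P"
  obtains S :: "('p, 'f, 'v) representation" and e where "finite_sum_of_representables P r F S" "free_on S n x e"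
proof -
  have H: "is_rep (hrep (x k))" "fin_gen (hrep (x k)) (fibre (hrep (x k)))" "representable_by P r F (x k) (hrep (x k))"
    if "k < n" for k
    using that x by (auto intro: hrep_rep fin_gen_hrep hrep_representable)
  obtain S i p where S: "is_direct_sum (RC (\<lambda>_. True)) n (\<lambda>k. hrep (x k)) S i p"
    using ex_direct_sum[of n "\<lambda>k. hrep (x k)" "\<lambda>_. True"] H(1,2) by metis
  moreover have "\<forall>k<n. \<exists>y\<in>P. representable_by P r F y (hrep (x k))" using H(3) x by blast
  ultimately have "finite_sum_of_representables P r F S"
    unfolding finite_sum_of_representables_def Rep_as_RC by (metis (no_types, lifting))
  moreover obtain e where "free_on S n x e"
    using direct_sum_of_representables_free[OF x H(3) S] by blast
  ultimately show ?thesis using that by blast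
qed

lemma hrep_finite_sum:
  assumes x: "x \<in> P"
  shows "finite_sum_of_representables P r F (hrep x)"
proof -
  have H: "is_rep (hrep x)" using hrep_rep[OF x] .
  have "is_direct_sum (RC (\<lambda>_. True)) 1 (\<lambda>_. hrep x) (hrep x) (\<lambda>_. id_hom (hrep x)) (\<lambda>_. id_hom (hrep x))"
  proof -
    have c: "comp_hom (hrep x) (id_hom (hrep x)) (id_hom (hrep x)) = id_hom (hrep x)"
      by (rule ext_cong) simp
    interpret G: comm_group "hom_group (RC (\<lambda>_. True)) (hrep x) (hrep x)" by (rule hom_group_comm_group[OF H H])
    have "finprod (hom_group (RC (\<lambda>_. True)) (hrep x) (hrep x)) (\<lambda>_::nat. id_hom (hrep x)) {0} = id_hom (hrep x)"
      using G.finprod_insert[of "{}" "0::nat" "\<lambda>_. id_hom (hrep x)"] G.r_one[of "id_hom (hrep x)"] id_hom_in[OF H]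
      by (auto simp del: hom_group_RC(2,3))
    moreover have "{..<1::nat} = {0}" by auto
    ultimately show ?thesis unfolding is_direct_sum_def RC_simps using H id_hom_in[OF H] c by simp
  qed
  moreover have "\<forall>k<1::nat. \<exists>y\<in>P. representable_by P r F y (hrep x)" using hrep_representable[OF x] x by blast
  ultimately show ?thesis
    unfolding finite_sum_of_representables_def Rep_as_RC by (metis (no_types, lifting))
qed

text \<open>
  \<open>presented B G c M\<close> displays \<open>M\<close> as the fibrewise quotient of \<open>B\<close> by finitely many relations; this
  replaces the categorical cokernel in the definition of a finite presentation.
\<close>

definition presented ::
  "('p, 'f, 'v) representation \<Rightarrow> ('p \<times> 'v) set \<Rightarrow> ('p \<Rightarrow> 'v \<Rightarrow> 'v) \<Rightarrow> ('p, 'f, 'v) representation \<Rightarrow> bool" where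
  "presented B G c M \<longleftrightarrow> finite_sum_of_representables P r F B \<and> finite G \<and> G \<subseteq> Sigma P (fibre B) \<and>
     c \<in> homs B M \<and> (\<forall>x\<in>P. fibre M x \<subseteq> c x ` fibre B x) \<and>
     (\<forall>x\<in>P. \<forall>v\<in>fibre B x. c x v = \<zero>\<^bsub>Val M x\<^esub> \<longleftrightarrow> v \<in> gen B G x)"

text \<open>
  Comparison with two fibrewise quotients: that of \<open>B\<close> by the image of \<open>f\<close> bounds the kernel of \<open>c\<close>, and that of \<open>M\<close> by the
  image of \<open>c\<close> vanishes because \<open>c\<close> is an epimorphism.
\<close>

lemma Rep_cokernel_pointwise:
  fixes M :: "('p, 'f, 'a) representation"
  assumes cok: "is_cokernel (RC (\<lambda>_. True)) A B f M c"
  shows "x \<in> P \<Longrightarrow> fibre M x \<subseteq> c x ` fibre B x"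
    and "x \<in> P \<Longrightarrow> v \<in> fibre B x \<Longrightarrow> c x v = \<zero>\<^bsub>Val M x\<^esub> \<longleftrightarrow> v \<in> f x ` fibre A x"
proof -
  note D = RC_cokernelD[OF cok]
  note A = D(1) and B = D(3) and M = D(5) and f = D(7) and c = D(8) and cf = D(9)
  have univ: "\<exists>!u. u \<in> homs M Z \<and> comp_hom B u c = g"
    if "is_rep Z" "g \<in> homs B Z" "\<And>x v. x \<in> P \<Longrightarrow> v \<in> fibre A x \<Longrightarrow> g x (f x v) = \<zero>\<^bsub>Val Z x\<^esub>"
    for Z :: "('p, 'f, 'a) representation" and g
    by (rule D(10)) (use that in auto)
  obtain N :: "('p, 'f, 'a) representation" and q where N: "is_rep N" "q \<in> homs B N"
    "\<And>x v. x \<in> P \<Longrightarrow> v \<in> fibre B x \<Longrightarrow> q x v = \<zero>\<^bsub>Val N x\<^esub> \<longleftrightarrow> v \<in> f x ` fibre A x"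
    using quotient_rep[OF B subrep_image[OF A B f subrep_whole[OF A]]] by metis
  have "q x (f x v) = \<zero>\<^bsub>Val N x\<^esub>" if "x \<in> P" "v \<in> fibre A x" for x v
    using that N(3) homD(1)[OF f] by simp
  from ex1_implies_ex[OF univ[OF N(1,2) this]]
  obtain u where u: "u \<in> homs M N" "comp_hom B u c = q" by auto
  show "c x v = \<zero>\<^bsub>Val M x\<^esub> \<longleftrightarrow> v \<in> f x ` fibre A x" if x: "x \<in> P" "v \<in> fibre B x"
  proof
    assume "c x v = \<zero>\<^bsub>Val M x\<^esub>"
    then have "q x v = \<zero>\<^bsub>Val N x\<^esub>"
      using hom_zero[OF u(1) M N(1) x(1)] comp_homD[of B u c q, OF u(2) x] by simp
    then show "v \<in> f x ` fibre A x" using N(3) x by simp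
  next
    assume "v \<in> f x ` fibre A x"
    then show "c x v = \<zero>\<^bsub>Val M x\<^esub>" using cf x(1) by auto
  qed
  obtain L :: "('p, 'f, 'a) representation" and p where L: "is_rep L" "p \<in> homs M L"
    "\<And>x v. x \<in> P \<Longrightarrow> v \<in> fibre M x \<Longrightarrow> p x v = \<zero>\<^bsub>Val L x\<^esub> \<longleftrightarrow> v \<in> c x ` fibre B x"
    using quotient_rep[OF M subrep_image[OF B M c subrep_whole[OF B]]] by metis
  have z: "zero_hom M L \<in> homs M L" "zero_hom B L \<in> homs B L" using M L B by (auto intro: zero_hom_in)
  have 0: "zero_hom B L x (f x v) = \<zero>\<^bsub>Val L x\<^esub>" if "x \<in> P" "v \<in> fibre A x" for x v
    using that homD(1)[OF f] by simp
  have pc: "comp_hom B p c = zero_hom B L" by (rule ext_cong) (simp add: L(3) homD(1)[OF c])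
  have zc: "comp_hom B (zero_hom M L) c = zero_hom B L" by (rule ext_cong) (simp add: homD(1)[OF c])
  have "p = zero_hom M L"
    by (rule ex1E[OF univ[OF L(1) z(2) 0]]) (use pc zc z(1) L(2) in auto)
  then show "fibre M x \<subseteq> c x ` fibre B x" if "x \<in> P" using L(3) that by auto
qed

text \<open>
  The relations are the images under \<open>f\<close> of the free generators of the source of a presentation.
\<close>

lemma finitely_presented_imp_presented:
  fixes M :: "('p, 'f, 'v) representation"
  assumes "finitely_presented P r F M"
  shows "is_rep M" and "\<exists>B G c. presented B G c M"
proof -
  obtain A B f c where AB: "finite_sum_of_representables P r F A" "finite_sum_of_representables P r F B"
    and cok: "is_cokernel (RC (\<lambda>_. True)) A B f M c"
    using assms unfolding finitely_presented_def Rep_as_RC by blast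
  note D = RC_cokernelD[OF cok]
  note A = D(1) and B = D(3) and f = D(7) and c = D(8)
  show "is_rep M" by (rule D(5))
  obtain n x e where free: "free_on A n x e" using finite_sum_free(2)[OF AB(1)] by blast
  define E where "E = (\<lambda>k. (x k, e k)) ` {..<n}"
  have E: "E \<subseteq> Sigma P (fibre A)" "\<And>y. y \<in> P \<Longrightarrow> fibre A y = gen A E y" "finite E"
    using free gen_in_fibre[OF A, of E] unfolding free_on_def E_def by auto
  define G where "G = (\<lambda>(x, v). (x, f x v)) ` E"
  have "gen B G y = f y ` fibre A y" if "y \<in> P" for y
    using gen_image[OF A B f E(1) that] E(2)[OF that] by (simp add: G_def)
  moreover have "G \<subseteq> Sigma P (fibre B)" using E(1) homD(1)[OF f] by (auto simp: G_def)
  ultimately have "presented B G c M"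
    unfolding presented_def using AB(2) c E(3) Rep_cokernel_pointwise[OF cok] by (simp add: G_def)
  then show "\<exists>B G c. presented B G c M" by blast
qed

lemma ex_free_cover:
  fixes M :: "('p, 'f, 'v) representation"
  assumes M: "is_rep M" and fin: "finite G" and G: "G \<subseteq> Sigma P (fibre M)"
  obtains B :: "('p, 'f, 'v) representation" and E f where
    "finite_sum_of_representables P r F B" "is_rep B" "finite E" "E \<subseteq> Sigma P (fibre B)"
    "\<And>y. y \<in> P \<Longrightarrow> fibre B y = gen B E y" "f \<in> homs B M" "\<And>y. y \<in> P \<Longrightarrow> gen M G y = f y ` fibre B y"
proof -
  obtain n :: nat and g where g: "G = g ` {..<n}"
    using fin by (metis finite_imp_nat_seg_image_inj_on lessThan_def)
  have gP: "fst (g k) \<in> P" "snd (g k) \<in> fibre M (fst (g k))" if "k < n" for k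
  proof -
    have "g k \<in> Sigma P (fibre M)" using G g that by blast
    then show "fst (g k) \<in> P" "snd (g k) \<in> fibre M (fst (g k))" by (cases "g k"; simp)+
  qed
  obtain B :: "('p, 'f, 'v) representation" and e where
    B: "finite_sum_of_representables P r F B" and free: "free_on B n (\<lambda>k. fst (g k)) e"
    using ex_free[of n "\<lambda>k. fst (g k)"] gP(1) by blast
  have Br: "is_rep B" using finite_sum_free(1)[OF B] .
  obtain f where f: "f \<in> homs B M" "\<And>k. k < n \<Longrightarrow> f (fst (g k)) (e k) = snd (g k)"
    using free_onD(4)[OF free M, of "\<lambda>k. snd (g k)"] gP(2) by auto
  define E where "E = (\<lambda>k. (fst (g k), e k)) ` {..<n}"
  have E: "finite E" "E \<subseteq> Sigma P (fibre B)" "\<And>y. y \<in> P \<Longrightarrow> fibre B y = gen B E y"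
    using free gen_in_fibre[OF Br, of E] unfolding free_on_def E_def by auto
  have "(\<lambda>(x, v). (x, f x v)) ` E = G" using f(2) unfolding E_def g by (force simp: image_iff)
  then have "gen M G y = f y ` fibre B y" if "y \<in> P" for y
    using gen_image[OF Br M f(1) E(2) that] E(3)[OF that] by simp
  from that[OF B Br E f(1) this] show ?thesis .
qed

text \<open>
  Finitely many relations in \<open>B\<close> are the image of a map from another finite sum of representables.
\<close>

lemma presented_imp_finitely_presented:
  assumes M: "is_rep M" and pres: "presented B G c M"
  shows "finitely_presented P r F M"
proof -
  have B: "finite_sum_of_representables P r F B" "is_rep B" and G: "finite G" "G \<subseteq> Sigma P (fibre B)"
    and c: "c \<in> homs B M" "\<And>x. x \<in> P \<Longrightarrow> fibre M x \<subseteq> c x ` fibre B x"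
    "\<And>x v. x \<in> P \<Longrightarrow> v \<in> fibre B x \<Longrightarrow> c x v = \<zero>\<^bsub>Val M x\<^esub> \<longleftrightarrow> v \<in> gen B G x"
    using pres finite_sum_free(1) unfolding presented_def by auto
  obtain A :: "('p, 'f, 'v) representation" and E f where A: "finite_sum_of_representables P r F A" "is_rep A"
    and "finite E" "E \<subseteq> Sigma P (fibre A)" "\<And>y. y \<in> P \<Longrightarrow> fibre A y = gen A E y"
    and f: "f \<in> homs A B" "\<And>y. y \<in> P \<Longrightarrow> gen B G y = f y ` fibre A y"
    using ex_free_cover[OF B(2) G] by metis
  have "is_cokernel (RC (\<lambda>_. True)) A B f M c"
    using c f(2) by (intro cokernelI A(2) B(2) M f(1)) auto
  then show ?thesis unfolding finitely_presented_def Rep_as_RC using A(1) B(1) by blast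
qed

lemma fp_hrep:
  assumes x: "x \<in> P"
  shows "finitely_presented P r F (hrep x)"
proof (rule presented_imp_finitely_presented[OF hrep_rep[OF x]])
  show "presented (hrep x) {} (id_hom (hrep x)) (hrep x)"
    unfolding presented_def
    using hrep_finite_sum[OF x] id_hom_in[OF hrep_rep[OF x]] gen_empty[OF hrep_rep[OF x]] by auto
qed

lemma fp_fin_gen:
  fixes M :: "('p, 'f, 'v) representation"
  assumes "finitely_presented P r F M"
  shows "fin_gen M (fibre M)"
proof -
  note M = finitely_presented_imp_presented(1)[OF assms]
  obtain B G c where "presented B G c M" using finitely_presented_imp_presented(2)[OF assms] by blast
  then have B: "finite_sum_of_representables P r F B" and c: "c \<in> homs B M" "\<forall>x\<in>P. fibre M x \<subseteq> c x ` fibre B x"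
    unfolding presented_def by auto
  note Br = finite_sum_free(1)[OF B]
  obtain n x e where free: "free_on B n x e" using finite_sum_free(2)[OF B] by blast
  have "fin_gen B (fibre B)" unfolding fin_gen_def
    by (rule exI[of _ "(\<lambda>k. (x k, e k)) ` {..<n}"]) (use free in \<open>auto simp: free_on_def\<close>)
  from fin_gen_surjection[OF Br M c(1) _ this] show ?thesis using c(2) by blast
qed

text \<open>
  Finitely presented representations are closed under dividing out finitely many elements: lift these to the
  representable cover \<open>B\<close> of \<open>M\<close> and add them to the relations of \<open>M\<close>.
\<close>

lemma fp_quotient:
  fixes M N :: "('p, 'f, 'v) representation"
  assumes fp: "finitely_presented P r F M" and N: "is_rep N" and q: "q \<in> homs M N"
    and surj: "\<And>x. x \<in> P \<Longrightarrow> fibre N x \<subseteq> q x ` fibre M x"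
    and G: "finite G" "G \<subseteq> Sigma P (fibre M)"
    and ker: "\<And>x v. x \<in> P \<Longrightarrow> v \<in> fibre M x \<Longrightarrow> q x v = \<zero>\<^bsub>Val N x\<^esub> \<longleftrightarrow> v \<in> gen M G x"
  shows "finitely_presented P r F N"
proof -
  note M = finitely_presented_imp_presented(1)[OF fp]
  obtain B R c where "presented B R c M" using finitely_presented_imp_presented(2)[OF fp] by blast
  then have Bs: "finite_sum_of_representables P r F B" and R: "finite R" "R \<subseteq> Sigma P (fibre B)"
    and c: "c \<in> homs B M" "\<And>x. x \<in> P \<Longrightarrow> fibre M x \<subseteq> c x ` fibre B x"
    "\<And>x v. x \<in> P \<Longrightarrow> v \<in> fibre B x \<Longrightarrow> c x v = \<zero>\<^bsub>Val M x\<^esub> \<longleftrightarrow> v \<in> gen B R x"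
    unfolding presented_def by auto
  note B = finite_sum_free(1)[OF Bs]
  define G' where "G' = (\<lambda>(x, v). (x, inv_into (fibre B x) (c x) v)) ` G"
  have lift: "inv_into (fibre B x) (c x) v \<in> fibre B x" "c x (inv_into (fibre B x) (c x) v) = v"
    if "x \<in> P" "v \<in> fibre M x" for x v
    using c(2)[OF that(1)] that(2) by (auto intro: inv_into_into f_inv_into_f)
  have G': "finite G'" "G' \<subseteq> Sigma P (fibre B)" "(\<lambda>(x, v). (x, c x v)) ` G' = G"
    using G lift by (auto simp: G'_def) force+
  have RG: "finite (R \<union> G')" "R \<union> G' \<subseteq> Sigma P (fibre B)" using R G' by auto
  note sub = gen_subrep[OF B RG(2)]
  let ?d = "comp_hom B q c"
  have d: "?d \<in> homs B N" by (rule comp_hom_in[OF B c(1) q])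
  have im: "gen M G x = c x ` gen B G' x" if "x \<in> P" for x
    using gen_image[OF B M c(1) G'(2) that] G'(3) by simp
  have "?d x v = \<zero>\<^bsub>Val N x\<^esub> \<longleftrightarrow> v \<in> gen B (R \<union> G') x" if x: "x \<in> P" "v \<in> fibre B x" for x v
  proof
    assume "?d x v = \<zero>\<^bsub>Val N x\<^esub>"
    then have "c x v \<in> gen M G x" using ker[OF x(1) homD(1)[OF c(1) x]] x by simp
    then obtain w where w: "w \<in> gen B G' x" "c x v = c x w" using im[OF x(1)] by auto
    have wB: "w \<in> fibre B x" using gen_in_fibre[OF B G'(2) x(1) w(1)] .
    interpret MM: module F "Val M x" using M x(1) by (rule rep_module)
    interpret BB: module F "Val B x" using B x(1) by (rule rep_module)
    have "c x (v \<ominus>\<^bsub>Val B x\<^esub> w) = \<zero>\<^bsub>Val M x\<^esub>"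
      using hom_diff[OF c(1) B M x wB] w(2) homD(1)[OF c(1) x(1) wB] by (simp add: MM.diff_eq_zero_iff)
    then have "v \<ominus>\<^bsub>Val B x\<^esub> w \<in> gen B R x" using c(3)[OF x(1)] x(2) wB by simp
    then have "v \<ominus>\<^bsub>Val B x\<^esub> w \<in> gen B (R \<union> G') x" using gen_mono[of R "R \<union> G'" B x] by auto
    moreover have "w \<in> gen B (R \<union> G') x" using w(1) gen_mono[of G' "R \<union> G'" B x] by auto
    ultimately show "v \<in> gen B (R \<union> G') x" using subrep_cancel[OF B sub x] by blast
  next
    assume v: "v \<in> gen B (R \<union> G') x"
    have "R \<union> G' \<subseteq> Sigma P (\<lambda>x. {v \<in> fibre B x. ?d x v = \<zero>\<^bsub>Val N x\<^esub>})"
    proof -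
      have "?d y w = \<zero>\<^bsub>Val N y\<^esub>" if "(y, w) \<in> R" for y w
        using that R(2) c(3)[of y w] gen_base[OF B R(2) that] hom_zero[OF q M N, of y] by auto
      moreover have "?d y w = \<zero>\<^bsub>Val N y\<^esub>" if "(y, w) \<in> G'" for y w
      proof -
        have y: "y \<in> P" "w \<in> fibre B y" using that G'(2) by auto
        have "c y w \<in> gen M G y" using im[OF y(1)] gen_base[OF B G'(2) that] by blast
        then show ?thesis using ker[OF y(1) homD(1)[OF c(1) y]] y by simp
      qed
      ultimately show ?thesis using RG(2) by blast
    qed
    from gen_least[OF kernel_subrep[OF B N d] this x(1)] show "?d x v = \<zero>\<^bsub>Val N x\<^esub>" using v by blast
  qed
  moreover have "fibre N x \<subseteq> ?d x ` fibre B x" if x: "x \<in> P" for x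
  proof
    fix w assume "w \<in> fibre N x"
    then obtain v where "v \<in> fibre M x" "w = q x v" using surj[OF x] by blast
    moreover from this obtain b where "b \<in> fibre B x" "v = c x b" using c(2)[OF x] by blast
    ultimately show "w \<in> ?d x ` fibre B x" using x by force
  qed
  ultimately have "presented B (R \<union> G') ?d N"
    unfolding presented_def using Bs RG d by blast
  then show ?thesis by (rule presented_imp_finitely_presented[OF N])
qed

lemma fp_gen_quotient:
  fixes M :: "('p, 'f, 'v) representation"
  assumes fp: "finitely_presented P r F M" and G: "finite G" "G \<subseteq> Sigma P (fibre M)"
  obtains N :: "('p, 'f, 'v) representation" and q where "is_rep N" "finitely_presented P r F N" "q \<in> homs M N"
    "\<And>x v. x \<in> P \<Longrightarrow> v \<in> fibre M x \<Longrightarrow> q x v = \<zero>\<^bsub>Val N x\<^esub> \<longleftrightarrow> v \<in> gen M G x"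
proof -
  note M = finitely_presented_imp_presented(1)[OF fp]
  obtain N :: "('p, 'f, 'v) representation" and q where N: "is_rep N" "q \<in> homs M N"
    "\<And>x. x \<in> P \<Longrightarrow> fibre N x = q x ` fibre M x"
    "\<And>x v. x \<in> P \<Longrightarrow> v \<in> fibre M x \<Longrightarrow> q x v = \<zero>\<^bsub>Val N x\<^esub> \<longleftrightarrow> v \<in> gen M G x"
    using quotient_rep[OF M gen_subrep[OF M G(2)]] by metis
  have "finitely_presented P r F N" by (rule fp_quotient[OF fp N(1,2) _ G N(4)]) (simp add: N(3))
  from that[OF N(1) this N(2,4)] show ?thesis .
qed

section \<open>Detecting elements by maps from representable functors\<close>

text \<open>
  In a full subcategory that contains the representables, monomorphisms, zero objects and kernels are what they are
  fibrewise, because a categorical property can be tested on the maps from \<open>hrep x\<close>, which are the elements at \<open>x\<close>.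
\<close>

lemma mono_inj:
  assumes mono: "is_mono (RC Q) K X k" and Q: "Q (hrep x)" and x: "x \<in> P"
  shows "inj_on (k x) (fibre K x)"
proof (rule inj_onI)
  note D = RC_monoD[OF mono]
  fix v w assume v: "v \<in> fibre K x" and w: "w \<in> fibre K x" and eq: "k x v = k x w"
  obtain g h where g: "g \<in> homs (hrep x) K" "g x (hgen x) = v" and h: "h \<in> homs (hrep x) K" "h x (hgen x) = w"
    using hgen(4)[OF x D(1) v] hgen(4)[OF x D(1) w] by metis
  have c: "comp_hom (hrep x) k g = comp_hom (hrep x) k h"
    by (rule hrep_homs_eqI[OF x D(3) comp_hom_in[OF hrep_rep[OF x] g(1) D(5)] comp_hom_in[OF hrep_rep[OF x] h(1) D(5)]])
      (use g h eq hgen(1)[OF x] x in simp)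
  have "k y (g y v) = k y (h y v)" if "y \<in> P" "v \<in> fibre (hrep x) y" for y v
    using fun_cong[OF fun_cong[OF c, of y], of v] that by simp
  then have "g = h" by (rule D(6)[OF hrep_rep[OF x] Q g(1) h(1)])
  then show "v = w" using g h by simp
qed

lemma zero_object_fibre:
  assumes zero: "zero_object (RC Q) A" and Q: "Q (hrep x)" and x: "x \<in> P" and v: "v \<in> fibre A x"
  shows "v = \<zero>\<^bsub>Val A x\<^esub>"
proof -
  have A: "is_rep A" using zero by (simp add: zero_object_def)
  have "\<exists>!f. f \<in> homs (hrep x) A" using zero hrep_rep[OF x] Q unfolding zero_object_def by auto
  moreover obtain g where g: "g \<in> homs (hrep x) A" "g x (hgen x) = v" using hgen(4)[OF x A v] by metis
  ultimately have "g = zero_hom (hrep x) A" using zero_hom_in[OF hrep_rep[OF x] A] by blast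
  then show ?thesis using g(2) x hgen(1)[OF x] by auto
qed

lemma kernel_pointwise:
  assumes ker: "is_kernel (RC Q) X Y f K k" and Q: "Q (hrep x)" and x: "x \<in> P" and v: "v \<in> fibre X x"
  shows "f x v = \<zero>\<^bsub>Val Y x\<^esub> \<longleftrightarrow> v \<in> k x ` fibre K x"
proof
  note D = RC_kernelD[OF ker]
  note H = hrep_rep[OF x]
  assume 0: "f x v = \<zero>\<^bsub>Val Y x\<^esub>"
  obtain g where g: "g \<in> homs (hrep x) X" "g x (hgen x) = v" using hgen(4)[OF x D(1) v] by metis
  have c: "comp_hom (hrep x) f g = zero_hom (hrep x) Y"
    by (rule hrep_homs_eqI[OF x D(3) comp_hom_in[OF H g(1) D(7)] zero_hom_in[OF H D(3)]])
      (use g 0 x hgen(1)[OF x] in simp)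
  have "f y (g y w) = \<zero>\<^bsub>Val Y y\<^esub>" if "y \<in> P" "w \<in> fibre (hrep x) y" for y w
    using fun_cong[OF fun_cong[OF c, of y], of w] that by simp
  from ex1_implies_ex[OF D(10)[OF H Q g(1) this]]
  obtain u where u: "u \<in> homs (hrep x) K" "comp_hom (hrep x) k u = g" by auto
  have "v = k x (u x (hgen x))"
    using g(2) comp_homD[of "hrep x" k u g, OF u(2) x hgen(1)[OF x]] by simp
  then show "v \<in> k x ` fibre K x" using homD(1)[OF u(1) x hgen(1)[OF x]] by blast
next
  assume "v \<in> k x ` fibre K x"
  then show "f x v = \<zero>\<^bsub>Val Y x\<^esub>" using RC_kernelD(9)[OF ker x] by auto
qed

lemma kernel_is_mono:
  assumes ker: "is_kernel (RC Q) X Y f K k"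
  shows "is_mono (RC Q) K X k"
  unfolding is_mono_def
proof (intro conjI ballI impI)
  note D = RC_kernelD[OF ker]
  fix Z g h assume "Z \<in> Obj (RC Q)" and "g \<in> Hom (RC Q) Z K" and "h \<in> Hom (RC Q) Z K"
    and "Comp (RC Q) Z K X k g = Comp (RC Q) Z K X k h"
  then have Z: "is_rep Z" "Q Z" and g: "g \<in> homs Z K" and h: "h \<in> homs Z K"
    and eq: "comp_hom Z k g = comp_hom Z k h" by simp_all
  have "f x (comp_hom Z k g x v) = \<zero>\<^bsub>Val Y x\<^esub>" if "x \<in> P" "v \<in> fibre Z x" for x v
    using D(9)[OF that(1) homD(1)[OF g that]] that by simp
  from D(10)[OF Z comp_hom_in[OF Z(1) g D(8)] this] show "g = h"
    by (rule ex1E) (use g h eq in auto)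
qed (use RC_kernelD[OF ker] in simp_all)

end

section \<open>Chains of ideals\<close>

context poset_over_field begin

text \<open>
  A failure of the chain condition for ideals below \<open>x\<close>, witnessed by points instead of ideals.
\<close>

definition bad_sequence :: "'p \<Rightarrow> (nat \<Rightarrow> 'p) \<Rightarrow> bool" where
  "bad_sequence x z \<longleftrightarrow> (\<forall>n. (z n, x) \<in> r) \<and> (\<forall>n. \<forall>i<n. (z n, z i) \<notin> r)"

text \<open>
  The initial segments of a bad sequence generate a strictly ascending chain of ideals.  Conversely, if a chain does
  not stabilise, pass to a strictly ascending subchain and pick one new point from each step; a later point lies
  below no earlier one, for otherwise it would belong to an earlier ideal.
\<close>

lemma ideal_chains_iff_no_bad_sequence:
  assumes x: "x \<in> P"
  shows "ascending_chains_of_ideals_stabilise (down P r x) r \<longleftrightarrow> (\<nexists>z. bad_sequence x z)"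
proof
  assume acc: "ascending_chains_of_ideals_stabilise (down P r x) r"
  show "\<nexists>z. bad_sequence x z"
  proof
    assume "\<exists>z. bad_sequence x z"
    then obtain z :: "nat \<Rightarrow> 'p" where z: "\<And>n. (z n, x) \<in> r" "\<And>i n. i < n \<Longrightarrow> (z n, z i) \<notin> r"
      unfolding bad_sequence_def by blast
    define I where "I n = {y \<in> down P r x. \<exists>i<n. (y, z i) \<in> r}" for n
    have "\<forall>n. poset_ideal (down P r x) r (I n)"
      by (auto simp: poset_ideal_def I_def intro: le_trans)
    moreover have "\<forall>n. I n \<subseteq> I (Suc n)" by (auto simp: I_def less_Suc_eq)
    ultimately obtain N where "\<forall>n\<ge>N. I n = I N"
      using acc unfolding ascending_chains_of_ideals_stabilise_def by blast
    then have "I (Suc N) = I N" using le_SucI[OF order_refl] by blast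
    moreover have "z N \<in> I (Suc N)"
      unfolding I_def down_def using z(1)[of N] le_in(1)[OF z(1)[of N]] le_refl[of "z N"] by blast
    ultimately have "z N \<in> I N" by simp
    then show False using z(2) unfolding I_def by blast
  qed
next
  assume nobad: "\<nexists>z. bad_sequence x z"
  show "ascending_chains_of_ideals_stabilise (down P r x) r"
    unfolding ascending_chains_of_ideals_stabilise_def
  proof (intro allI impI, elim conjE)
    fix I :: "nat \<Rightarrow> 'p set" assume ideal: "\<forall>n. poset_ideal (down P r x) r (I n)" and inc: "\<forall>n. I n \<subseteq> I (Suc n)"
    have up: "I m \<subseteq> I n" if "m \<le> n" for m n
      by (rule lift_Suc_mono_le[of I, OF _ that]) (use inc in auto)
    show "\<exists>N. \<forall>n\<ge>N. I n = I N"
    proof (rule ccontr)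
      assume "\<nexists>N. \<forall>n\<ge>N. I n = I N"
      then have "\<forall>N. \<exists>n. n \<ge> N \<and> I n \<noteq> I N" by blast
      then obtain g where g: "\<And>N. g N \<ge> N \<and> I (g N) \<noteq> I N" by metis
      \<comment> \<open>The indices of a strictly ascending subchain.\<close>
      define m where "m k = (g ^^ k) 0" for k
      have m: "m (Suc k) = g (m k)" for k by (simp add: m_def)
      have step: "m k \<le> m (Suc k)" for k using g[of "m k"] m by simp
      have m_mono: "m i \<le> m j" if "i \<le> j" for i j
        by (rule lift_Suc_mono_le[of m, OF step that])
      have "\<exists>y. y \<in> I (m (Suc k)) - I (m k)" for k
        using up[OF step[of k]] g[of "m k"] m[of k] by auto
      then obtain z where z: "\<And>k. z k \<in> I (m (Suc k)) - I (m k)" by metis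
      have down: "z k \<in> down P r x" for k
        using z ideal unfolding poset_ideal_def by blast
      have "(z n, z i) \<notin> r" if "i < n" for i n
      proof
        assume le: "(z n, z i) \<in> r"
        have "z i \<in> I (m n)" using z[of i] up[OF m_mono[of "Suc i" n]] that by auto
        then have "z n \<in> I (m n)" using ideal down le unfolding poset_ideal_def by blast
        then show False using z by blast
      qed
      then have "bad_sequence x z" using down by (auto simp: bad_sequence_def down_def)
      then show False using nobad by blast
    qed
  qed
qed

text \<open>
  If no finite subset of \<open>I\<close> dominated \<open>I\<close>, a bad sequence could be chosen point by point.
\<close>

lemma finitely_many_maximal:
  assumes nobad: "\<nexists>z. bad_sequence x z" and I: "\<And>y. y \<in> I \<Longrightarrow> (y, x) \<in> r"
  obtains Z where "finite Z" "Z \<subseteq> I" "\<And>y. y \<in> I \<Longrightarrow> \<exists>z\<in>Z. (y, z) \<in> r"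
proof (rule ccontr)
  assume no: "\<not> thesis"
  define R where "R f n y \<longleftrightarrow> y \<in> I \<and> (\<forall>i<n. (y, f i) \<notin> r)" for f :: "nat \<Rightarrow> 'p" and n :: nat and y
  have "\<exists>f. \<forall>n. R f n (f n)"
  proof (rule dependent_wellorder_choice)
    fix n and f :: "nat \<Rightarrow> 'p" assume "\<And>i. i < n \<Longrightarrow> R f i (f i)"
    then have "f ` {..<n} \<subseteq> I" by (auto simp: R_def)
    then have "\<exists>y\<in>I. \<forall>z\<in>f ` {..<n}. (y, z) \<notin> r" using no that[of "f ` {..<n}"] by auto
    then show "\<exists>y. R f n y" by (auto simp: R_def)
  qed (auto simp: R_def)
  then obtain f where "\<And>n. R f n (f n)" by blast
  then have "bad_sequence x f" using I by (auto simp: R_def bad_sequence_def)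
  then show False using nobad by blast
qed

section \<open>Noetherian representations\<close>

definition no_bad_sequences :: bool where
  "no_bad_sequences \<longleftrightarrow> (\<forall>x\<in>P. \<nexists>z. bad_sequence x z)"

text \<open>
  The noetherian property, by induction on the number of generators of the ambient representation.  For a new generator
  \<open>v\<close> at \<open>x\<close>, the induction hypothesis deals with the part of \<open>S\<close> that does not involve \<open>v\<close>.  The points over which \<open>S\<close>
  contains some \<open>v + m\<close> with \<open>m\<close> in the span of the old generators form an ideal \<open>I\<close>; one such element over each of the
  finitely many points that dominate \<open>I\<close> is enough, since subtracting a multiple of its restriction from a
  given element of \<open>S\<close> removes \<open>v\<close>.
\<close>

lemma subrep_fin_gen:
  assumes nobad: no_bad_sequences and M: "is_rep M" and fin: "finite G" and G: "G \<subseteq> Sigma P (fibre M)"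
    and S: "subrep M S" and SG: "\<And>y. y \<in> P \<Longrightarrow> S y \<subseteq> gen M G y"
  shows "fin_gen M S"
  using fin G S SG
proof (induction G arbitrary: S)
  case empty
  then show ?case unfolding fin_gen_def by (intro exI[of _ "{}"]) auto
next
  case (insert g G S)
  obtain x v where g: "g = (x, v)" by force
  have x: "x \<in> P" and v: "v \<in> fibre M x" and G: "G \<subseteq> Sigma P (fibre M)" using insert.prems g by auto
  note S = insert.prems(2)
  note gG = gen_subrep[OF M G]
  have "fin_gen M (\<lambda>y. S y \<inter> gen M G y)"
    by (rule insert.IH[OF G subrep_Int[OF S gG]]) auto
  then obtain G1 where G1: "finite G1" "G1 \<subseteq> Sigma P (\<lambda>y. S y \<inter> gen M G y)"
    "\<And>y. y \<in> P \<Longrightarrow> S y \<inter> gen M G y \<subseteq> gen M G1 y" unfolding fin_gen_def by auto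
  define I where "I = {y. (y, x) \<in> r \<and> (\<exists>m\<in>gen M G y. Res M y x v \<oplus>\<^bsub>Val M y\<^esub> m \<in> S y)}"
  have "\<nexists>z. bad_sequence x z" using nobad x by (simp add: no_bad_sequences_def)
  then obtain Z where Z: "finite Z" "Z \<subseteq> I" "\<And>y. y \<in> I \<Longrightarrow> \<exists>z\<in>Z. (y, z) \<in> r"
    by (rule finitely_many_maximal[of x I]) (auto simp: I_def)
  have "\<forall>z. \<exists>m. z \<in> Z \<longrightarrow> (z, x) \<in> r \<and> m \<in> gen M G z \<and> Res M z x v \<oplus>\<^bsub>Val M z\<^esub> m \<in> S z"
    using Z(2) by (auto simp: I_def)
  then obtain m where m: "\<And>z. z \<in> Z \<Longrightarrow> (z, x) \<in> r" "\<And>z. z \<in> Z \<Longrightarrow> m z \<in> gen M G z"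
    "\<And>z. z \<in> Z \<Longrightarrow> Res M z x v \<oplus>\<^bsub>Val M z\<^esub> m z \<in> S z" by metis
  define W where "W = (\<lambda>z. (z, Res M z x v \<oplus>\<^bsub>Val M z\<^esub> m z)) ` Z"
  have GW: "finite (G1 \<union> W)" "G1 \<union> W \<subseteq> Sigma P S"
    using G1 Z(1) m(3) le_in(1)[OF m(1)] by (auto simp: W_def)
  then have GWM: "G1 \<union> W \<subseteq> Sigma P (fibre M)" using subrepD(1)[OF S] by auto
  have "w \<in> gen M (G1 \<union> W) y" if y: "y \<in> P" and w: "w \<in> S y" for y w
  proof -
    interpret M: module F "Val M y" using M y by (rule rep_module)
    have small: "u \<in> gen M (G1 \<union> W) y" if "u \<in> S y" "u \<in> gen M G y" for u
      using that G1(3)[OF y] gen_mono[of G1 "G1 \<union> W" M y] by auto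
    have fib: "u \<in> fibre M y" if "u \<in> gen M G y" for u using gen_in_fibre[OF M G y that] .
    have "w \<in> gen M (insert (x, v) G) y" using insert.prems(3)[OF y] w g by auto
    then consider "w \<in> gen M G y" | c u where "(y, x) \<in> r" "c \<in> carrier F" "u \<in> gen M G y"
      "w = c \<odot>\<^bsub>Val M y\<^esub> Res M y x v \<oplus>\<^bsub>Val M y\<^esub> u"
      using gen_insert[OF M _ y, of x v G w] insert.prems(1) g by auto
    then show ?thesis
    proof cases
      case 1
      then show ?thesis using small w by simp
    next
      case 2
      have rv: "Res M y x v \<in> fibre M y" using res_closed[OF M 2(1) v] .
      note u = fib[OF 2(3)]
      show ?thesis
      proof (cases "c = \<zero>\<^bsub>F\<^esub>")
        case True
        then have "w = u" using 2 rv u by simp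
        then show ?thesis using small w 2 by simp
      next
        case False
        \<comment> \<open>Normalise the coefficient of \<open>v\<close> to \<open>1\<close>; this shows that \<open>y\<close> belongs to \<open>I\<close>.\<close>
        define d where "d = inv\<^bsub>F\<^esub> c"
        have d: "d \<in> carrier F" "d \<otimes>\<^bsub>F\<^esub> c = \<one>\<^bsub>F\<^esub>"
          using False 2(2) F.field_Units by (auto simp: d_def)
        have "d \<odot>\<^bsub>Val M y\<^esub> w = (d \<otimes>\<^bsub>F\<^esub> c) \<odot>\<^bsub>Val M y\<^esub> Res M y x v \<oplus>\<^bsub>Val M y\<^esub> d \<odot>\<^bsub>Val M y\<^esub> u"
          using 2 rv u d(1) by (simp add: M.smult_r_distr M.smult_assoc1)
        then have "Res M y x v \<oplus>\<^bsub>Val M y\<^esub> d \<odot>\<^bsub>Val M y\<^esub> u \<in> S y"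
          using subrepD(4)[OF S y d(1) w] rv by (simp add: d(2))
        moreover have "d \<odot>\<^bsub>Val M y\<^esub> u \<in> gen M G y" using d(1) 2(3) by (rule gen_smult)
        ultimately have "y \<in> I" using 2(1) by (auto simp: I_def)
        then obtain z where z: "z \<in> Z" "(y, z) \<in> r" using Z(3) by blast
        note zP = le_in(2)[OF z(2)]
        have mz: "m z \<in> fibre M z" using gen_in_fibre[OF M G zP m(2)[OF z(1)]] .
        have rz: "Res M z x v \<in> fibre M z" using res_closed[OF M m(1)[OF z(1)] v] .
        \<comment> \<open>The restriction to \<open>y\<close> of the chosen element over \<open>z\<close> also has \<open>v\<close>-coefficient \<open>1\<close>.\<close>
        define h where "h = Res M y z (Res M z x v \<oplus>\<^bsub>Val M z\<^esub> m z)"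
        define m' where "m' = Res M y z (m z)"
        have m': "m' \<in> gen M G y" unfolding m'_def by (rule subrepD(5)[OF gG z(2) m(2)[OF z(1)]])
        have h: "h = Res M y x v \<oplus>\<^bsub>Val M y\<^esub> m'"
          unfolding h_def m'_def using res_add[OF M z(2) rz mz] res_res[OF M m(1)[OF z(1)] z(2) v] by simp
        have hS: "h \<in> S y" unfolding h_def by (rule subrepD(5)[OF S z(2) m(3)[OF z(1)]])
        have "h \<in> gen M (G1 \<union> W) y" unfolding h_def by (rule gen_res) (use z in \<open>auto simp: W_def\<close>)
        then have ch: "c \<odot>\<^bsub>Val M y\<^esub> h \<in> gen M (G1 \<union> W) y" using 2(2) by (intro gen_smult)
        have chS: "c \<odot>\<^bsub>Val M y\<^esub> h \<in> S y" using subrepD(4)[OF S y 2(2) hS] .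
        have "w \<ominus>\<^bsub>Val M y\<^esub> c \<odot>\<^bsub>Val M y\<^esub> h = u \<ominus>\<^bsub>Val M y\<^esub> c \<odot>\<^bsub>Val M y\<^esub> m'"
        proof -
          let ?a = "c \<odot>\<^bsub>Val M y\<^esub> Res M y x v" and ?b = "c \<odot>\<^bsub>Val M y\<^esub> m'"
          have a: "?a \<in> fibre M y" "?b \<in> fibre M y" using rv 2(2) fib[OF m'] by auto
          have "w \<ominus>\<^bsub>Val M y\<^esub> c \<odot>\<^bsub>Val M y\<^esub> h = (?a \<oplus>\<^bsub>Val M y\<^esub> u) \<oplus>\<^bsub>Val M y\<^esub> (\<ominus>\<^bsub>Val M y\<^esub> ?a \<oplus>\<^bsub>Val M y\<^esub> \<ominus>\<^bsub>Val M y\<^esub> ?b)"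
            using 2 rv fib[OF m'] a by (simp add: h M.smult_r_distr M.minus_eq M.minus_add)
          also have "\<dots> = (?a \<oplus>\<^bsub>Val M y\<^esub> \<ominus>\<^bsub>Val M y\<^esub> ?a) \<oplus>\<^bsub>Val M y\<^esub> (u \<oplus>\<^bsub>Val M y\<^esub> \<ominus>\<^bsub>Val M y\<^esub> ?b)"
            using a u by (simp only: M.a_ac M.a_inv_closed M.a_closed)
          also have "\<dots> = u \<ominus>\<^bsub>Val M y\<^esub> ?b" using a u by (simp add: M.r_neg M.minus_eq)
          finally show ?thesis .
        qed
        moreover have "u \<ominus>\<^bsub>Val M y\<^esub> c \<odot>\<^bsub>Val M y\<^esub> m' \<in> gen M G y"
          by (rule subrep_diff[OF M gG y 2(3) gen_smult[OF 2(2) m']])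
        moreover have "w \<ominus>\<^bsub>Val M y\<^esub> c \<odot>\<^bsub>Val M y\<^esub> h \<in> S y" by (rule subrep_diff[OF M S y w chS])
        ultimately have "w \<ominus>\<^bsub>Val M y\<^esub> c \<odot>\<^bsub>Val M y\<^esub> h \<in> gen M (G1 \<union> W) y" using small by simp
        then show ?thesis
          using subrep_cancel[OF M gen_subrep[OF M GWM] y _ ch] subrepD(1)[OF S y w] by simp
      qed
    qed
  qed
  then show ?case unfolding fin_gen_def using GW by (intro exI[of _ "G1 \<union> W"]) auto
qed

lemma sub_rep_fin_gen:
  assumes nobad: no_bad_sequences and M: "is_rep M" and fg: "fin_gen M (fibre M)" and S: "subrep M S"
  shows "fin_gen M S"
proof -
  obtain G where G: "finite G" "G \<subseteq> Sigma P (fibre M)" "\<forall>y\<in>P. fibre M y \<subseteq> gen M G y"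
    using fg unfolding fin_gen_def by auto
  show ?thesis
    by (rule subrep_fin_gen[OF nobad M G(1,2) S]) (use G(3) subrepD(1)[OF S] in auto)
qed

lemma RC_cong: "(\<And>M. is_rep M \<Longrightarrow> Q M = Q' M) \<Longrightarrow> RC Q = RC Q'"
  by (auto simp: RC_def full_subcategory_def Rep_def)

definition fg :: "('p, 'f, 'v) representation \<Rightarrow> bool" where
  "fg M \<longleftrightarrow> fin_gen M (fibre M)"

lemma fg_quotient:
  fixes M :: "('p, 'f, 'v) representation"
  assumes M: "is_rep M" "fg M" and S: "subrep M S"
  obtains N :: "('p, 'f, 'v) representation" and q where "is_rep N" "fg N" "q \<in> homs M N"
    "\<And>x. x \<in> P \<Longrightarrow> fibre N x = q x ` fibre M x"
    "\<And>x v. x \<in> P \<Longrightarrow> v \<in> fibre M x \<Longrightarrow> q x v = \<zero>\<^bsub>Val N x\<^esub> \<longleftrightarrow> v \<in> S x"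
proof -
  obtain N :: "('p, 'f, 'v) representation" and q where N: "is_rep N" "q \<in> homs M N"
    "\<And>x. x \<in> P \<Longrightarrow> fibre N x = q x ` fibre M x"
    "\<And>x v. x \<in> P \<Longrightarrow> v \<in> fibre M x \<Longrightarrow> q x v = \<zero>\<^bsub>Val N x\<^esub> \<longleftrightarrow> v \<in> S x"
    using quotient_rep[OF M(1) S] by metis
  have "fg N" unfolding fg_def
    by (rule fin_gen_surjection[OF M(1) N(1,2)]) (use N(3) M(2) in \<open>auto simp: fg_def\<close>)
  from that[OF N(1) this N(2-4)] show ?thesis .
qed

end

context poset_universe begin

lemma fg_hrep: "x \<in> P \<Longrightarrow> fg (hrep x)"
  by (simp add: fg_def fin_gen_hrep)

text \<open>
  The kernel of a free cover is finitely generated by \<open>subrep_fin_gen\<close>, so finitely many generators already give a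
  finite presentation.
\<close>

lemma fp_iff_fg:
  fixes M :: "('p, 'f, 'v) representation"
  assumes nobad: no_bad_sequences and M: "is_rep M"
  shows "finitely_presented P r F M \<longleftrightarrow> fg M"
proof
  show "finitely_presented P r F M \<Longrightarrow> fg M" unfolding fg_def by (rule fp_fin_gen)
  assume "fg M"
  then obtain G where G: "finite G" "G \<subseteq> Sigma P (fibre M)" "\<forall>y\<in>P. fibre M y \<subseteq> gen M G y"
    unfolding fg_def fin_gen_def by auto
  obtain B :: "('p, 'f, 'v) representation" and E f where
    B: "finite_sum_of_representables P r F B" and Br: "is_rep B" and E: "finite E" "E \<subseteq> Sigma P (fibre B)"
    "\<And>y. y \<in> P \<Longrightarrow> fibre B y = gen B E y"
    and f: "f \<in> homs B M" "\<And>y. y \<in> P \<Longrightarrow> gen M G y = f y ` fibre B y"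
    using ex_free_cover[OF M G(1,2)] by metis
  have surj: "fibre M y \<subseteq> f y ` fibre B y" if y: "y \<in> P" for y
    using G(3) f(2)[OF y] y by blast
  let ?K = "\<lambda>x. {v \<in> fibre B x. f x v = \<zero>\<^bsub>Val M x\<^esub>}"
  have K: "subrep B ?K" by (rule kernel_subrep[OF Br M f(1)])
  have "fin_gen B ?K"
    by (rule subrep_fin_gen[OF nobad Br E(1,2) K]) (use E(3) in auto)
  then obtain R where R: "finite R" "R \<subseteq> Sigma P ?K" "\<forall>y\<in>P. ?K y \<subseteq> gen B R y" unfolding fin_gen_def by auto
  have "f x v = \<zero>\<^bsub>Val M x\<^esub> \<longleftrightarrow> v \<in> gen B R x" if x: "x \<in> P" "v \<in> fibre B x" for x v
    using R(3) gen_least[OF K R(2) x(1)] x by auto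
  moreover have "R \<subseteq> Sigma P (fibre B)" using R(2) by auto
  ultimately have "presented B R f M"
    unfolding presented_def using B R(1) f(1) surj by simp
  then show "finitely_presented P r F M" by (rule presented_imp_finitely_presented[OF M])
qed

lemma rep_as_RC_fg:
  assumes no_bad_sequences
  shows "(rep P r F :: ('p, 'f, 'v) rep_category) = RC fg"
  unfolding rep_as_RC by (rule RC_cong) (rule fp_iff_fg[OF assms])

text \<open>
  The quotient of \<open>C\<close> by the image of \<open>c\<close> is again finitely generated, so it is an object of the category, and the
  quotient map agrees with zero after composition with the epimorphism \<open>c\<close>.
\<close>

lemma epi_surj:
  fixes Y C :: "('p, 'f, 'v) representation"
  assumes epi: "is_epi (RC fg) Y C c" and x: "x \<in> P"
  shows "fibre C x \<subseteq> c x ` fibre Y x"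
proof -
  have Y: "is_rep Y" "fg Y" and C: "is_rep C" "fg C" and c: "c \<in> homs Y C"
    using epi unfolding is_epi_def RC_simps by simp_all
  have can: "\<forall>Z\<in>Obj (RC fg :: ('p, 'f, 'v) rep_category). \<forall>g\<in>homs C Z. \<forall>h\<in>homs C Z. comp_hom Y g c = comp_hom Y h c \<longrightarrow> g = h"
    using epi unfolding is_epi_def RC_simps(2-6) by (elim conjE)
  obtain L :: "('p, 'f, 'v) representation" and p where L: "is_rep L" "fg L" "p \<in> homs C L"
    "\<And>x. x \<in> P \<Longrightarrow> fibre L x = p x ` fibre C x"
    "\<And>x v. x \<in> P \<Longrightarrow> v \<in> fibre C x \<Longrightarrow> p x v = \<zero>\<^bsub>Val L x\<^esub> \<longleftrightarrow> v \<in> c x ` fibre Y x"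
    using fg_quotient[OF C subrep_image[OF Y(1) C(1) c subrep_whole[OF Y(1)]]] by metis
  have "comp_hom Y p c = comp_hom Y (zero_hom C L) c"
    by (rule ext_cong) (simp add: L(5) homD(1)[OF c])
  then have "p = zero_hom C L"
    using can L(1-3) zero_hom_in[OF C(1) L(1)] by simp
  then show ?thesis using L(5) x by auto
qed

text \<open>
  All constructions are made fibrewise.  The chain condition is needed for kernels, which are subrepresentations;
  a monomorphism is the kernel of its fibrewise cokernel and an epimorphism the cokernel of its fibrewise kernel.
\<close>

lemma fg_abelian:
  assumes nobad: no_bad_sequences
  shows "abelian_category (RC fg :: ('p, 'f, 'v) rep_category)"
proof (rule abelian_category.intro[OF preadditive_RC abelian_category_axioms.intro])
  fix n and Xs :: "nat \<Rightarrow> ('p, 'f, 'v) representation" assume "\<forall>k<n. Xs k \<in> Obj (RC fg)"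
  then have X: "\<And>k. k < n \<Longrightarrow> is_rep (Xs k)" "\<And>k. k < n \<Longrightarrow> fg (Xs k)" by auto
  show "\<exists>S i p. is_direct_sum (RC fg) n Xs S i p"
    by (rule ex_direct_sum[of n Xs fg]) (use X in \<open>auto simp: fg_def\<close>)
next
  fix X Y :: "('p, 'f, 'v) representation" and f
  assume "X \<in> Obj (RC fg)" "Y \<in> Obj (RC fg)" "f \<in> Hom (RC fg) X Y"
  then have X: "is_rep X" "fg X" and Y: "is_rep Y" "fg Y" and f: "f \<in> homs X Y" by auto
  let ?S = "\<lambda>x. {v \<in> fibre X x. f x v = \<zero>\<^bsub>Val Y x\<^esub>}"
  have S: "subrep X ?S" by (rule kernel_subrep[OF X(1) Y(1) f])
  have "fg (sub_rep X ?S)"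
    using sub_rep_fin_gen[OF nobad X(1) _ S] X(2) by (simp add: fg_def fin_gen_sub_rep)
  then have "is_kernel (RC fg) X Y f (sub_rep X ?S) (id_hom (sub_rep X ?S))"
    by (intro kernelI X Y f sub_rep[OF X(1) S] sub_rep_inj) (simp_all add: sub_rep_range)
  then show "\<exists>K k. is_kernel (RC fg) X Y f K k" by blast
  obtain N :: "('p, 'f, 'v) representation" and q where N: "is_rep N" "fg N" "q \<in> homs Y N"
    "\<And>x. x \<in> P \<Longrightarrow> fibre N x = q x ` fibre Y x"
    "\<And>x v. x \<in> P \<Longrightarrow> v \<in> fibre Y x \<Longrightarrow> q x v = \<zero>\<^bsub>Val N x\<^esub> \<longleftrightarrow> v \<in> f x ` fibre X x"
    using fg_quotient[OF Y subrep_image[OF X(1) Y(1) f subrep_whole[OF X(1)]]] by metis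
  then have "is_cokernel (RC fg) X Y f N q"
    by (intro cokernelI X Y f N) (simp_all add: N)
  then show "\<exists>Q c. is_cokernel (RC fg) X Y f Q c" by blast
next
  fix K Y :: "('p, 'f, 'v) representation" and k assume mono: "is_mono (RC fg) K Y k"
  note D = RC_monoD[OF mono]
  obtain N :: "('p, 'f, 'v) representation" and q where N: "is_rep N" "fg N" "q \<in> homs Y N"
    "\<And>x. x \<in> P \<Longrightarrow> fibre N x = q x ` fibre Y x"
    "\<And>x v. x \<in> P \<Longrightarrow> v \<in> fibre Y x \<Longrightarrow> q x v = \<zero>\<^bsub>Val N x\<^esub> \<longleftrightarrow> v \<in> k x ` fibre K x"
    using fg_quotient[OF D(3,4) subrep_image[OF D(1,3,5) subrep_whole[OF D(1)]]] by metis
  then have "is_kernel (RC fg) Y N q K k"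
    by (intro kernelI D N mono_inj[OF mono] fg_hrep) (simp_all add: N)
  then show "\<exists>Z g. is_kernel (RC fg) Y Z g K k" by blast
next
  fix Y C :: "('p, 'f, 'v) representation" and c assume epi: "is_epi (RC fg) Y C c"
  then have Y: "is_rep Y" "fg Y" and C: "is_rep C" "fg C" and c: "c \<in> homs Y C"
    unfolding is_epi_def RC_simps by simp_all
  let ?S = "\<lambda>x. {v \<in> fibre Y x. c x v = \<zero>\<^bsub>Val C x\<^esub>}"
  have S: "subrep Y ?S" by (rule kernel_subrep[OF Y(1) C(1) c])
  have "fg (sub_rep Y ?S)"
    using sub_rep_fin_gen[OF nobad Y(1) _ S] Y(2) by (simp add: fg_def fin_gen_sub_rep)
  then have "is_cokernel (RC fg) (sub_rep Y ?S) Y (id_hom (sub_rep Y ?S)) C c"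
    by (intro cokernelI Y C c sub_rep[OF Y(1) S] epi_surj[OF epi]) (simp_all add: sub_rep_range)
  then show "\<exists>Z g. is_cokernel (RC fg) Z Y g C c" by blast
qed

lemma subobject_leI:
  fixes X :: "('p, 'f, 'v) representation"
  assumes a: "is_mono (RC Q) A X a" and b: "is_mono (RC Q) B X b" and Q: "\<And>x. x \<in> P \<Longrightarrow> Q (hrep x)"
    and sub: "\<And>x. x \<in> P \<Longrightarrow> a x ` fibre A x \<subseteq> b x ` fibre B x"
  shows "subobject_le (RC Q) X A a B b"
proof -
  note A = RC_monoD[OF a] and B = RC_monoD[OF b]
  have im: "a x v \<in> b x ` fibre B x" if "x \<in> P" "v \<in> fibre A x" for x v using sub[OF that(1)] that(2) by blast
  obtain u where u: "u \<in> homs A B" "\<And>x v. x \<in> P \<Longrightarrow> v \<in> fibre A x \<Longrightarrow> b x (u x v) = a x v"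
    using factor_through_injection[OF A(1) B(1) B(5) A(5) mono_inj[OF b Q] im] by metis
  have "comp_hom A b u = a" by (rule homs_eqI[OF comp_hom_in[OF A(1) u(1) B(5)] A(5)]) (simp add: u)
  then show ?thesis unfolding subobject_le_def using a b u(1) by auto
qed

lemma subobject_le_range:
  assumes "subobject_le (RC Q) X A a B b" "x \<in> P"
  shows "a x ` fibre A x \<subseteq> b x ` fibre B x"
proof -
  obtain u where u: "u \<in> homs A B" "comp_hom A b u = a" using assms(1) by (auto simp: subobject_le_def)
  have "a x v = b x (u x v)" if "v \<in> fibre A x" for v
    using fun_cong[OF fun_cong[OF u(2), of x], of v] assms(2) that by simp
  then show ?thesis using homD(1)[OF u(1) assms(2)] by auto
qed

text \<open>
  The union of the images of a chain of monomorphisms is a finitely generated subrepresentation of \<open>X\<close>, and its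
  generators already lie in one member of the chain.
\<close>

lemma fg_noetherian:
  fixes X :: "('p, 'f, 'v) representation"
  assumes nobad: no_bad_sequences and X: "is_rep X" "fg X"
  shows "noetherian_object (RC fg) X"
  unfolding noetherian_object_def
proof (rule conjI, use X in simp, intro allI impI, elim conjE)
  fix A :: "nat \<Rightarrow> ('p, 'f, 'v) representation" and a
  assume mono: "\<forall>n. is_mono (RC fg) (A n) X (a n)"
    and le: "\<forall>n. subobject_le (RC fg) X (A n) (a n) (A (Suc n)) (a (Suc n))"
  note D = RC_monoD[OF mono[rule_format]]
  define S where "S n x = a n x ` fibre (A n) x" for n x
  have S: "subrep X (S n)" for n
    unfolding S_def by (rule subrep_image[OF D(1) X(1) D(5) subrep_whole[OF D(1)]])
  have step: "S n x \<subseteq> S (Suc n) x" if "x \<in> P" for n x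
    unfolding S_def using subobject_le_range[OF le[rule_format] that] .
  have up: "S m x \<subseteq> S n x" if "m \<le> n" "x \<in> P" for m n x
    by (rule lift_Suc_mono_le[of "\<lambda>n. S n x", OF step[OF that(2)] that(1)])
  have "fin_gen X (\<lambda>x. \<Union>n. S n x)"
    by (rule sub_rep_fin_gen[OF nobad X(1) _ subrep_Union_chain[of X S, OF S step]]) (use X(2) in \<open>auto simp: fg_def\<close>)
  then obtain G where G: "finite G" "G \<subseteq> Sigma P (\<lambda>x. \<Union>n. S n x)" "\<forall>y\<in>P. (\<Union>n. S n y) \<subseteq> gen X G y"
    unfolding fin_gen_def by auto
  have "\<exists>N. G \<subseteq> Sigma P (S N)" using G(1,2)
  proof (induction G)
    case (insert g G)
    then obtain N where N: "G \<subseteq> Sigma P (S N)" by auto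
    obtain x v m where g: "g = (x, v)" "x \<in> P" "v \<in> S m x" using insert.prems by auto
    have "insert g G \<subseteq> Sigma P (S (max N m))"
      using N g up[of N "max N m"] up[of m "max N m"] by auto blast
    then show ?case by blast
  qed auto
  then obtain N where N: "G \<subseteq> Sigma P (S N)" by blast
  have "S n x \<subseteq> S N x" if "x \<in> P" for n x
    using G(3) gen_least[OF S N that] that by blast
  then have "subobject_le (RC fg) X (A n) (a n) (A N) (a N)" for n
    by (intro subobject_leI mono[rule_format] fg_hrep) (auto simp: S_def)
  moreover have "subobject_le (RC fg) X (A N) (a N) (A n) (a n)" if "n \<ge> N" for n
    using up[OF that] by (intro subobject_leI mono[rule_format] fg_hrep) (auto simp: S_def)
  ultimately show "\<exists>N. \<forall>n\<ge>N. subobject_le (RC fg) X (A N) (a N) (A n) (a n) \<and>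
      subobject_le (RC fg) X (A n) (a n) (A N) (a N)" by blast
qed

section \<open>From noetherian objects to chains of ideals\<close>

text \<open>
  For a bad sequence \<open>z\<close>, the kernels of the quotients of \<open>hrep x\<close> by the
  restrictions of \<open>hgen x\<close> to \<open>z 0, \<dots>, z (n - 1)\<close> form a chain of subobjects that grows at each step: the restriction
  of \<open>hgen x\<close> to \<open>z n\<close> is nonzero, whereas the \<open>n\<close>-th kernel vanishes at \<open>z n\<close> because none of its generators lies above \<open>z n\<close>.
\<close>

lemma noetherian_imp_no_bad_sequence:
  fixes C :: "('p, 'f, 'v) rep_category"
  defines "C \<equiv> RC (finitely_presented P r F)"
  assumes ab: "abelian_category C" and noeth: "noetherian_object C (hrep x)" and x: "x \<in> P"
  shows "\<not> bad_sequence x z"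
proof
  assume "bad_sequence x z"
  then have z: "\<And>n. (z n, x) \<in> r" "\<And>i n. i < n \<Longrightarrow> (z n, z i) \<notin> r" by (auto simp: bad_sequence_def)
  interpret C: abelian_category C by (rule ab)
  let ?H = "hrep x"
  note H = hrep_rep[OF x]
  note fpH = fp_hrep
  define G where "G n = (\<lambda>i. (z i, Res ?H (z i) x (hgen x))) ` {..<n}" for n :: nat
  have G: "finite (G n)" "G n \<subseteq> Sigma P (fibre ?H)" for n
    using res_closed[OF H z(1) hgen(1)[OF x]] le_in(1)[OF z(1)] by (auto simp: G_def)
  have "\<exists>K k. is_mono C K ?H k \<and> (\<forall>y\<in>P. k y ` fibre K y = gen ?H (G n) y)" for n
  proof -
    obtain T :: "('p, 'f, 'v) representation" and c where T: "is_rep T" "finitely_presented P r F T" "c \<in> homs ?H T"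
      "\<And>y v. y \<in> P \<Longrightarrow> v \<in> fibre ?H y \<Longrightarrow> c y v = \<zero>\<^bsub>Val T y\<^esub> \<longleftrightarrow> v \<in> gen ?H (G n) y"
      using fp_gen_quotient[OF fpH[OF x] G] by metis
    then obtain K k where ker: "is_kernel C ?H T c K k"
      using C.kernels[of ?H T c] H fpH[OF x] unfolding C_def by auto
    have "k y ` fibre K y = gen ?H (G n) y" if y: "y \<in> P" for y
    proof (intro subset_antisym subsetI)
      note D = RC_kernelD[OF ker[unfolded C_def]]
      fix v assume v: "v \<in> k y ` fibre K y"
      then have "v \<in> fibre ?H y" using homD(1)[OF D(8) y] by auto
      then show "v \<in> gen ?H (G n) y" using v kernel_pointwise[OF ker[unfolded C_def] fpH[OF y] y] T(4)[OF y] by blast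
    next
      fix v assume v: "v \<in> gen ?H (G n) y"
      then have "v \<in> fibre ?H y" by (rule gen_in_fibre[OF H G(2) y])
      then show "v \<in> k y ` fibre K y" using v kernel_pointwise[OF ker[unfolded C_def] fpH[OF y] y] T(4)[OF y] by blast
    qed
    moreover have "is_mono C K ?H k" using ker kernel_is_mono unfolding C_def by blast
    ultimately show ?thesis by blast
  qed
  then obtain K k where K: "\<And>n. is_mono C (K n) ?H (k n)" "\<And>n y. y \<in> P \<Longrightarrow> k n y ` fibre (K n) y = gen ?H (G n) y"
    by metis
  have "gen ?H (G n) y \<subseteq> gen ?H (G (Suc n)) y" for n y by (rule gen_mono) (auto simp: G_def)
  then have "subobject_le C ?H (K n) (k n) (K (Suc n)) (k (Suc n))" for n
    using K unfolding C_def by (intro subobject_leI fpH) auto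
  then obtain N where "\<forall>n\<ge>N. subobject_le C ?H (K N) (k N) (K n) (k n) \<and> subobject_le C ?H (K n) (k n) (K N) (k N)"
    using noeth K(1) unfolding noetherian_object_def by blast
  then have "subobject_le C ?H (K (Suc N)) (k (Suc N)) (K N) (k N)" by simp
  moreover have zP: "z N \<in> P" using le_in(1)[OF z(1)] .
  ultimately have "gen ?H (G (Suc N)) (z N) \<subseteq> gen ?H (G N) (z N)"
    using subobject_le_range[of "finitely_presented P r F" ?H "K (Suc N)" "k (Suc N)" "K N" "k N" "z N"] K(2)
    unfolding C_def by simp
  moreover have "Res ?H (z N) x (hgen x) \<in> gen ?H (G (Suc N)) (z N)"
    by (rule gen_base[OF H G(2)]) (auto simp: G_def)
  moreover have "gen ?H (G N) (z N) = {\<zero>\<^bsub>Val ?H (z N)\<^esub>}"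
    by (rule gen_empty[OF H zP]) (use z(2) in \<open>auto simp: G_def\<close>)
  ultimately show False using hgen(3)[OF x z(1)] by auto
qed

section \<open>From finite length to finite down-sets\<close>

text \<open>
  A simple object is generated by each of its nonzero elements \<open>v\<close>, because the kernel of the quotient by \<open>v\<close> contains
  \<open>v\<close>.  As \<open>y\<close> and \<open>z\<close> can be exchanged, it is supported at one point.
\<close>

lemma simple_support:
  fixes C :: "('p, 'f, 'v) rep_category"
  defines "C \<equiv> RC (finitely_presented P r F)"
  assumes ab: "abelian_category C" and simple: "simple_object C S"
    and y: "y \<in> P" "v \<in> fibre S y" "v \<noteq> \<zero>\<^bsub>Val S y\<^esub>" and z: "z \<in> P" "w \<in> fibre S z" "w \<noteq> \<zero>\<^bsub>Val S z\<^esub>"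
  shows "(z, y) \<in> r"
proof -
  interpret C: abelian_category C by (rule ab)
  have S: "is_rep S" "finitely_presented P r F S" using simple by (auto simp: simple_object_def C_def)
  have sim: "\<forall>A a. is_mono C A S a \<longrightarrow> zero_object C A \<or> is_iso C A S a" using simple by (simp add: simple_object_def)
  have G: "finite {(y, v)}" "{(y, v)} \<subseteq> Sigma P (fibre S)" using y by auto
  obtain T :: "('p, 'f, 'v) representation" and c where T: "is_rep T" "finitely_presented P r F T" "c \<in> homs S T"
    "\<And>x u. x \<in> P \<Longrightarrow> u \<in> fibre S x \<Longrightarrow> c x u = \<zero>\<^bsub>Val T x\<^esub> \<longleftrightarrow> u \<in> gen S {(y, v)} x"
    using fp_gen_quotient[OF S(2) G] by metis
  then obtain K k where ker: "is_kernel C S T c K k"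
    using C.kernels[of S T c] S unfolding C_def by auto
  note D = RC_kernelD[OF ker[unfolded C_def]]
  note kp = kernel_pointwise[OF ker[unfolded C_def] fp_hrep]
  have "v \<in> k y ` fibre K y"
    using kp[OF y(1) y(1,2)] T(4)[OF y(1,2)] gen_base[OF S(1) G(2)] by simp
  then obtain u where u: "u \<in> fibre K y" "v = k y u" by auto
  have "\<not> zero_object C K"
    using zero_object_fibre[of "finitely_presented P r F" K y u] fp_hrep[OF y(1)] y u
      hom_zero[OF D(8) D(5) S(1) y(1)] unfolding C_def by auto
  moreover have "is_mono C K S k" using kernel_is_mono[OF ker[unfolded C_def]] unfolding C_def .
  ultimately have "is_iso C K S k" using sim by blast
  then have "w \<in> k z ` fibre K z"
    using bij_betw_imp_surj_on[OF isoD(4)[of "finitely_presented P r F" K S k z]] z unfolding C_def by auto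
  then have "w \<in> gen S {(y, v)} z" using kp[OF z(1) z(1,2)] T(4)[OF z(1,2)] by simp
  then show ?thesis using gen_empty[OF S(1) z(1), of "{(y, v)}"] z(3) by auto
qed

definition support :: "('p, 'f, 'v) representation \<Rightarrow> 'p set" where
  "support M = {y \<in> P. \<not> fibre M y \<subseteq> {\<zero>\<^bsub>Val M y\<^esub>}}"

text \<open>
  The support grows by at most the support of a simple object, which has at most one point, in each step of a
  composition series.  That the sequence \<open>A k \<rightarrow> A (Suc k) \<rightarrow> Q\<close> is exact in the middle in each fibre holds because
  the monomorphism \<open>u\<close> is the kernel of some \<open>g\<close>, and \<open>g\<close> factors through the cokernel \<open>c\<close> of \<open>u\<close>.
\<close>

lemma finite_length_imp_finite_support:
  fixes C :: "('p, 'f, 'v) rep_category"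
  defines "C \<equiv> RC (finitely_presented P r F)"
  assumes ab: "abelian_category C" and fl: "finite_length_object C X"
  shows "finite (support X)"
proof -
  interpret C: abelian_category C by (rule ab)
  obtain n A a where mono: "\<And>k. k \<le> n \<Longrightarrow> is_mono C (A k) X (a k)" and zero: "zero_object C (A 0)"
    and iso: "is_iso C (A n) X (a n)"
    and step: "\<And>k. k < n \<Longrightarrow> \<exists>u\<in>Hom C (A k) (A (Suc k)). Comp C (A k) (A (Suc k)) X (a (Suc k)) u = a k \<and>
           (\<exists>Q c. is_cokernel C (A k) (A (Suc k)) u Q c \<and> simple_object C Q)"
    using fl unfolding finite_length_object_def by auto
  have "k \<le> n \<Longrightarrow> finite (support (A k))" for k
  proof (induction k)
    case 0
    have "support (A 0) = {}"
      using zero_object_fibre[OF zero[unfolded C_def] fp_hrep] by (auto simp: support_def)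
    then show ?case by simp
  next
    case (Suc k)
    then have k: "k < n" and fin: "finite (support (A k))" by auto
    obtain u Q c where u: "u \<in> homs (A k) (A (Suc k))" "comp_hom (A k) (a (Suc k)) u = a k"
      and cok: "is_cokernel C (A k) (A (Suc k)) u Q c" and simple: "simple_object C Q"
      using step[OF k] unfolding C_def by auto
    note D = RC_cokernelD[OF cok[unfolded C_def]]
    have mk: "is_mono (RC (finitely_presented P r F)) (A k) X (a k)" using mono[of k] k by (simp add: C_def)
    have "is_mono C (A k) (A (Suc k)) u"
      unfolding is_mono_def
    proof (intro conjI ballI impI)
      fix Z g h assume "Z \<in> Obj C" "g \<in> Hom C Z (A k)" "h \<in> Hom C Z (A k)"
        and "Comp C Z (A k) (A (Suc k)) u g = Comp C Z (A k) (A (Suc k)) u h"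
      then have Z: "is_rep Z" "finitely_presented P r F Z" and g: "g \<in> homs Z (A k)" and h: "h \<in> homs Z (A k)"
        and eq: "comp_hom Z u g = comp_hom Z u h" unfolding C_def by simp_all
      have "a k x (g x v) = a k x (h x v)" if x: "x \<in> P" "v \<in> fibre Z x" for x v
      proof -
        have "u x (g x v) = u x (h x v)" using fun_cong[OF fun_cong[OF eq, of x], of v] x by simp
        moreover have "a k x w = a (Suc k) x (u x w)" if "w \<in> fibre (A k) x" for w
          using fun_cong[OF fun_cong[OF u(2), of x], of w] x(1) that by simp
        ultimately show ?thesis using homD(1)[OF g x] homD(1)[OF h x] by simp
      qed
      then show "g = h" by (rule RC_monoD(6)[OF mk Z g h])
    qed (use D u in \<open>simp_all add: C_def\<close>)
    then obtain Z g where ker: "is_kernel C (A (Suc k)) Z g (A k) u" using C.mono_is_kernel by blast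
    note E = RC_kernelD[OF ker[unfolded C_def]]
    obtain g' where g': "g' \<in> homs Q Z" "comp_hom (A (Suc k)) g' c = g"
      using ex1_implies_ex[OF D(10)[OF E(3,4,7,9)]] by auto
    have "support (A (Suc k)) \<subseteq> support (A k) \<union> support Q"
    proof
      fix y assume ys: "y \<in> support (A (Suc k))"
      then have y: "y \<in> P" by (simp add: support_def)
      show "y \<in> support (A k) \<union> support Q"
      proof (rule ccontr)
        assume "y \<notin> support (A k) \<union> support Q"
        then have 0: "\<And>w. w \<in> fibre (A k) y \<Longrightarrow> w = \<zero>\<^bsub>Val (A k) y\<^esub>" "\<And>w. w \<in> fibre Q y \<Longrightarrow> w = \<zero>\<^bsub>Val Q y\<^esub>"
          using y by (auto simp: support_def)
        have "v = \<zero>\<^bsub>Val (A (Suc k)) y\<^esub>" if v: "v \<in> fibre (A (Suc k)) y" for v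
        proof -
          have "g y v = g' y (c y v)" using fun_cong[OF fun_cong[OF g'(2), of y], of v] y v by simp
          also have "c y v = \<zero>\<^bsub>Val Q y\<^esub>" using 0(2) homD(1)[OF D(8) y v] by simp
          also have "g' y \<dots> = \<zero>\<^bsub>Val Z y\<^esub>" by (rule hom_zero[OF g'(1) D(5) E(3) y])
          finally have "v \<in> u y ` fibre (A k) y"
            using kernel_pointwise[OF ker[unfolded C_def] fp_hrep[OF y] y v] by simp
          then show ?thesis using 0(1) hom_zero[OF u(1) D(1,3) y] by auto
        qed
        then show False using ys by (auto simp: support_def)
      qed
    qed
    moreover have "finite (support Q)"
    proof -
      have eq: "y = z" if yz: "y \<in> support Q" "z \<in> support Q" for y z
      proof -
        obtain v where v: "y \<in> P" "v \<in> fibre Q y" "v \<noteq> \<zero>\<^bsub>Val Q y\<^esub>" using yz(1) by (auto simp: support_def)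
        obtain w where w: "z \<in> P" "w \<in> fibre Q z" "w \<noteq> \<zero>\<^bsub>Val Q z\<^esub>" using yz(2) by (auto simp: support_def)
        show ?thesis
          by (rule le_antisym) (rule simple_support[OF ab[unfolded C_def] simple[unfolded C_def]]; fact v w)+
      qed
      show ?thesis
      proof (cases "support Q = {}")
        case False
        then obtain y where "y \<in> support Q" by blast
        then have "support Q \<subseteq> {y}" using eq by blast
        then show ?thesis by (rule finite_subset) simp
      qed simp
    qed
    ultimately show ?case using fin finite_subset by blast
  qed
  from this[of n] have "finite (support (A n))" by simp
  moreover have "support X \<subseteq> support (A n)"
  proof
    note I = isoD[OF iso[unfolded C_def]]
    fix y assume "y \<in> support X"
    then obtain v where v: "y \<in> P" "v \<in> fibre X y" "v \<noteq> \<zero>\<^bsub>Val X y\<^esub>" by (auto simp: support_def)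
    obtain w where w: "w \<in> fibre (A n) y" "v = a n y w" using bij_betw_imp_surj_on[OF I(4)[OF v(1)]] v(2) by auto
    then have "w \<noteq> \<zero>\<^bsub>Val (A n) y\<^esub>" using v(3) hom_zero[OF I(3,1,2) v(1)] by auto
    then show "y \<in> support (A n)" using v(1) w(1) by (auto simp: support_def)
  qed
  ultimately show ?thesis by (rule finite_subset[rotated])
qed

lemma down_subset_support_hrep:
  assumes x: "x \<in> P"
  shows "down P r x \<subseteq> support (hrep x)"
  using hgen(3)[OF x] res_closed[OF hrep_rep[OF x] _ hgen(1)[OF x]]
  by (force simp: down_def support_def)

end

section \<open>From finite down-sets to composition series\<close>

context poset_over_field begin

lemma finite_down_no_bad_sequence:
  assumes x: "finite (down P r x)"
  shows "\<not> bad_sequence x z"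
proof
  assume "bad_sequence x z"
  then have z: "\<And>n. (z n, x) \<in> r" and bad: "\<And>n i. i < n \<Longrightarrow> (z n, z i) \<notin> r" by (auto simp: bad_sequence_def)
  have "inj z"
  proof (rule inj_onI)
    fix m n assume eq: "z m = z n"
    have refl: "(z k, z k) \<in> r" for k using le_refl le_in(1)[OF z] by blast
    show "m = n" using bad[of m n] bad[of n m] eq refl[of m] by (cases m n rule: linorder_cases) auto
  qed
  moreover have "range z \<subseteq> down P r x" using z le_in(1)[OF z] by (auto simp: down_def)
  ultimately show False using x finite_subset finite_imageD infinite_UNIV_nat by metis
qed

text \<open>
  Composition series are built from subrepresentations of one ambient representation.  These are families of sets
  indexed by the whole type, of which only the members at points of \<open>P\<close> are meaningful; so they are compared on \<open>P\<close>.
\<close>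

definition minimal_extension :: "('p, 'f, 'v) representation \<Rightarrow> ('p \<Rightarrow> 'v set) \<Rightarrow> ('p \<Rightarrow> 'v set) \<Rightarrow> bool" where
  "minimal_extension M S T \<longleftrightarrow> (\<forall>x\<in>P. S x \<subseteq> T x) \<and> (\<exists>x\<in>P. S x \<noteq> T x) \<and>
     (\<forall>U. subrep M U \<longrightarrow> (\<forall>x\<in>P. S x \<subseteq> U x \<and> U x \<subseteq> T x) \<longrightarrow> (\<forall>x\<in>P. U x = S x) \<or> (\<forall>x\<in>P. U x = T x))"

definition has_series :: "('p, 'f, 'v) representation \<Rightarrow> ('p \<Rightarrow> 'v set) \<Rightarrow> bool" where
  "has_series M T \<longleftrightarrow> (\<exists>n S. (\<forall>k. subrep M (S k)) \<and> (\<forall>x\<in>P. S 0 x = {\<zero>\<^bsub>Val M x\<^esub>}) \<and>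
     (\<forall>x\<in>P. S n x = T x) \<and> (\<forall>k<n. minimal_extension M (S k) (S (Suc k))))"

lemma minimal_extension_cong:
  assumes "\<And>x. x \<in> P \<Longrightarrow> S x = S' x"
  shows "minimal_extension M S T \<longleftrightarrow> minimal_extension M S' T"
proof -
  have "(\<forall>x\<in>P. S x \<subseteq> U x \<and> U x \<subseteq> T x) = (\<forall>x\<in>P. S' x \<subseteq> U x \<and> U x \<subseteq> T x)"
    "(\<forall>x\<in>P. U x = S x) = (\<forall>x\<in>P. U x = S' x)" "(\<forall>x\<in>P. S x \<subseteq> T x) = (\<forall>x\<in>P. S' x \<subseteq> T x)"
    "(\<exists>x\<in>P. S x \<noteq> T x) = (\<exists>x\<in>P. S' x \<noteq> T x)" for U
    using assms by auto
  then show ?thesis unfolding minimal_extension_def by (simp only:)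
qed

lemma has_series_cong: "(\<And>x. x \<in> P \<Longrightarrow> S x = T x) \<Longrightarrow> has_series M S = has_series M T"
  by (simp add: has_series_def)

lemma has_series_zero: "is_rep M \<Longrightarrow> has_series M (\<lambda>x. {\<zero>\<^bsub>Val M x\<^esub>})"
  unfolding has_series_def
  by (intro exI[of _ 0] exI[of _ "\<lambda>_ x. {\<zero>\<^bsub>Val M x\<^esub>}"]) (simp add: subrep_zero)

lemma has_series_step:
  assumes S: "has_series M S" and T: "subrep M T" and ext: "minimal_extension M S T"
  shows "has_series M T"
proof -
  obtain n A where A: "\<forall>k. subrep M (A k)" "\<forall>x\<in>P. A 0 x = {\<zero>\<^bsub>Val M x\<^esub>}" "\<forall>x\<in>P. A n x = S x"
    "\<forall>k<n. minimal_extension M (A k) (A (Suc k))" using S unfolding has_series_def by auto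
  define B where "B k = (if k \<le> n then A k else T)" for k
  have "minimal_extension M (A n) T" using minimal_extension_cong[of "A n" S M T] A(3) ext by simp
  then have "\<forall>k<Suc n. minimal_extension M (B k) (B (Suc k))"
    using A(4) by (auto simp: B_def less_Suc_eq)
  moreover have "\<forall>k. subrep M (B k)" using A(1) T by (simp add: B_def)
  moreover have "\<forall>x\<in>P. B 0 x = {\<zero>\<^bsub>Val M x\<^esub>}" using A(2) by (simp add: B_def)
  moreover have "\<forall>x\<in>P. B (Suc n) x = T x" by (simp add: B_def)
  ultimately show ?thesis unfolding has_series_def by blast
qed

text \<open>
  Once all proper restrictions of \<open>v\<close> lie in \<open>gen M H\<close>, adding \<open>v\<close> changes the fibre at \<open>x\<close> only, and by at
  most one dimension.
\<close>

lemma has_series_add_socle: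
  assumes M: "is_rep M" and H: "H \<subseteq> Sigma P (fibre M)" and x: "x \<in> P" and v: "v \<in> fibre M x"
    and low: "\<And>y. (y, x) \<in> r \<Longrightarrow> y \<noteq> x \<Longrightarrow> Res M y x v \<in> gen M H y" and ser: "has_series M (gen M H)"
  shows "has_series M (gen M (insert (x, v) H))"
proof -
  let ?H = "insert (x, v) H"
  have HM: "?H \<subseteq> Sigma P (fibre M)" using H x v by auto
  note gH = gen_subrep[OF M H] and gHH = gen_subrep[OF M HM]
  have sub: "gen M H y \<subseteq> gen M ?H y" for y by (rule gen_mono) auto
  have vin: "v \<in> gen M ?H x" by (rule gen_base[OF M HM]) simp
  have off: "gen M ?H y = gen M H y" if y: "y \<in> P" "y \<noteq> x" for y
  proof (intro subset_antisym subsetI)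
    fix w assume "w \<in> gen M ?H y"
    then consider "w \<in> gen M H y" | c m where "(y, x) \<in> r" "c \<in> carrier F" "m \<in> gen M H y"
      "w = c \<odot>\<^bsub>Val M y\<^esub> Res M y x v \<oplus>\<^bsub>Val M y\<^esub> m"
      using gen_insert[OF M HM y(1), of w] by auto
    then show "w \<in> gen M H y"
    proof cases
      case 2
      then show ?thesis using low[OF 2(1) y(2)] by (auto intro: gen_add gen_smult)
    qed
  qed (use sub in blast)
  show ?thesis
  proof (cases "v \<in> gen M H x")
    case True
    then have "?H \<subseteq> Sigma P (gen M H)" using x gen_base[OF M H] H by auto
    then have "gen M ?H y = gen M H y" if "y \<in> P" for y
      using gen_trans[OF M H _ that] sub that by blast
    then show ?thesis using has_series_cong[of "gen M ?H" "gen M H"] ser by simp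
  next
    case False
    interpret V: module F "Val M x" using M x by (rule rep_module)
    have "minimal_extension M (gen M H) (gen M ?H)"
      unfolding minimal_extension_def
    proof (intro conjI allI impI)
      show "\<forall>y\<in>P. gen M H y \<subseteq> gen M ?H y" using sub by blast
      show "\<exists>y\<in>P. gen M H y \<noteq> gen M ?H y" using False vin x by blast
      fix U assume U: "subrep M U" and bd: "\<forall>y\<in>P. gen M H y \<subseteq> U y \<and> U y \<subseteq> gen M ?H y"
      show "(\<forall>y\<in>P. U y = gen M H y) \<or> (\<forall>y\<in>P. U y = gen M ?H y)"
      proof (cases "U x \<subseteq> gen M H x")
        case True
        have "U y = gen M H y" if "y \<in> P" for y
          using bd that off[OF that] True by (cases "y = x") blast+
        then show ?thesis by blast
      next
        case F: False
        then obtain u where u: "u \<in> U x" "u \<notin> gen M H x" by blast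
        then have "u \<in> gen M ?H x" using bd x by blast
        then obtain c m where c: "c \<in> carrier F" "m \<in> gen M H x" "u = c \<odot>\<^bsub>Val M x\<^esub> v \<oplus>\<^bsub>Val M x\<^esub> m"
          using gen_insert[OF M HM x, of u] u(2) res_id[OF M x v] by auto
        have m: "m \<in> fibre M x" using gen_in_fibre[OF M H x c(2)] .
        have c0: "c \<noteq> \<zero>\<^bsub>F\<^esub>" using u(2) c m v by auto
        define d where "d = inv\<^bsub>F\<^esub> c"
        have d: "d \<in> carrier F" "d \<otimes>\<^bsub>F\<^esub> c = \<one>\<^bsub>F\<^esub>"
          using c0 c(1) F.field_Units by (auto simp: d_def)
        have "u \<ominus>\<^bsub>Val M x\<^esub> m \<in> U x" using subrep_diff[OF M U x u(1)] bd x c(2) by blast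
        moreover have "u \<ominus>\<^bsub>Val M x\<^esub> m = c \<odot>\<^bsub>Val M x\<^esub> v"
          using c(1,3) v m by (simp add: V.minus_eq V.a_assoc V.r_neg)
        ultimately have "d \<odot>\<^bsub>Val M x\<^esub> (c \<odot>\<^bsub>Val M x\<^esub> v) \<in> U x" using subrepD(4)[OF U x d(1)] by simp
        then have "v \<in> U x" using d c(1) v by (simp flip: V.smult_assoc1)
        moreover have "b \<in> U a" if "(a, b) \<in> H" for a b
          using gen_base[OF M H that] bd H that by blast
        ultimately have "?H \<subseteq> Sigma P U" using x H by auto
        then have "U y = gen M ?H y" if "y \<in> P" for y
          using gen_least[OF U _ that, of ?H] bd that by blast
        then show ?thesis by blast
      qed
    qed
    then show ?thesis by (rule has_series_step[OF ser gHH])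
  qed
qed

text \<open>
  Induction on the number of points below \<open>x\<close>: first adjoin the restrictions of \<open>v\<close> to all points strictly below \<open>x\<close>,
  each of which has a smaller down-set, and then \<open>v\<close> itself.
\<close>

lemma has_series_add_generator:
  assumes fin: "\<And>x. x \<in> P \<Longrightarrow> finite (down P r x)" and M: "is_rep M"
  shows "\<lbrakk>G \<subseteq> Sigma P (fibre M); x \<in> P; v \<in> fibre M x; has_series M (gen M G)\<rbrakk>
    \<Longrightarrow> has_series M (gen M (insert (x, v) G))"
proof (induction "card (down P r x)" arbitrary: x v G rule: less_induct)
  case less
  note G = less.prems(1) and x = less.prems(2) and v = less.prems(3)
  have rv: "Res M y x v \<in> fibre M y" if "(y, x) \<in> r" for y using res_closed[OF M that v] .
  define D where "D = down P r x - {x}"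
  define R where "R = (\<lambda>y. (y, Res M y x v))"
  have RM: "R ` E \<subseteq> Sigma P (fibre M)" if "E \<subseteq> D" for E
    using that rv by (auto simp: R_def D_def down_def)
  have finD: "finite D" using fin[OF x] by (simp add: D_def)
  have "E \<subseteq> D \<Longrightarrow> has_series M (gen M (R ` E \<union> G))" if "finite E" for E
    using that
  proof induction
    case empty
    then show ?case using less.prems(4) by simp
  next
    case (insert y E)
    have y: "y \<in> P" "(y, x) \<in> r" "y \<noteq> x" using insert.prems by (auto simp: D_def down_def)
    have "down P r y \<subset> down P r x"
    proof (rule psubsetI)
      show "down P r y \<subseteq> down P r x" using le_trans[OF _ y(2)] by (auto simp: down_def)
      have "x \<in> down P r x" "x \<notin> down P r y"
        using x le_refl le_antisym[OF y(2)] y(3) by (auto simp: down_def)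
      then show "down P r y \<noteq> down P r x" by blast
    qed
    then have "card (down P r y) < card (down P r x)" by (rule psubset_card_mono[OF fin[OF x]])
    moreover have "R ` E \<union> G \<subseteq> Sigma P (fibre M)" using RM[of E] insert.prems G by auto
    moreover have "has_series M (gen M (R ` E \<union> G))" using insert by auto
    ultimately have "has_series M (gen M (insert (y, Res M y x v) (R ` E \<union> G)))"
      using less.hyps y(1) rv[OF y(2)] by blast
    then show ?case by (simp add: R_def)
  qed
  from this[OF finD] have ser: "has_series M (gen M (R ` D \<union> G))" by simp
  have H: "R ` D \<union> G \<subseteq> Sigma P (fibre M)" using RM[of D] G by auto
  have "Res M y x v \<in> gen M (R ` D \<union> G) y" if "(y, x) \<in> r" "y \<noteq> x" for y
    by (rule gen_base[OF M H]) (use that le_in in \<open>auto simp: R_def D_def down_def\<close>)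
  from has_series_add_socle[OF M H x v this ser]
  have ser': "has_series M (gen M (insert (x, v) (R ` D \<union> G)))" .
  have xG: "insert (x, v) G \<subseteq> Sigma P (fibre M)" using G x v by auto
  have "R ` D \<subseteq> Sigma P (gen M (insert (x, v) G))"
    by (auto simp: R_def D_def down_def intro!: gen_res)
  then have "insert (x, v) (R ` D \<union> G) \<subseteq> Sigma P (gen M (insert (x, v) G))"
    using gen_base[OF M xG] xG by auto
  then have "gen M (insert (x, v) (R ` D \<union> G)) y \<subseteq> gen M (insert (x, v) G) y" if "y \<in> P" for y
    by (rule gen_trans[OF M xG _ that])
  moreover have "gen M (insert (x, v) G) y \<subseteq> gen M (insert (x, v) (R ` D \<union> G)) y" for y
    by (rule gen_mono) auto
  ultimately show ?case
    using has_series_cong[of "gen M (insert (x, v) G)" "gen M (insert (x, v) (R ` D \<union> G))"] ser'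
    by (metis subset_antisym)
qed

lemma finite_down_has_series:
  assumes fin: "\<And>x. x \<in> P \<Longrightarrow> finite (down P r x)" and M: "is_rep M" and fg: "fg M"
  shows "has_series M (fibre M)"
proof -
  obtain G where G: "finite G" "G \<subseteq> Sigma P (fibre M)" "\<forall>y\<in>P. fibre M y \<subseteq> gen M G y"
    using fg unfolding fg_def fin_gen_def by auto
  have "has_series M (gen M G)" using G(1,2)
  proof induction
    case empty
    have "gen M {} x = {\<zero>\<^bsub>Val M x\<^esub>}" if "x \<in> P" for x by (rule gen_empty[OF M that]) simp
    then show ?case
      using has_series_cong[of "gen M {}" "\<lambda>x. {\<zero>\<^bsub>Val M x\<^esub>}"] has_series_zero[OF M] by simp
  next
    case (insert g G)
    obtain x v where g: "g = (x, v)" by force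
    then show ?case using has_series_add_generator[OF fin M, of G x v] insert by simp
  qed
  moreover have "fibre M x = gen M G x" if "x \<in> P" for x
    using G(3) gen_in_fibre[OF M G(2) that] that by blast
  ultimately show ?thesis using has_series_cong[of "fibre M" "gen M G"] by simp
qed

end

context poset_universe begin

text \<open>A minimal extension has a simple quotient, because subobjects of the quotient pull back to intermediate
  subrepresentations.\<close>

lemma minimal_extension_quotient:
  fixes M :: "('p, 'f, 'v) representation"
  assumes nobad: no_bad_sequences and M: "is_rep M" "fg M" and S: "subrep M S" and T: "subrep M T"
    and ext: "minimal_extension M S T"
  obtains u Q c where "u \<in> homs (sub_rep M S) (sub_rep M T)"
    "comp_hom (sub_rep M S) (id_hom (sub_rep M T)) u = id_hom (sub_rep M S)"
    "is_cokernel (RC fg) (sub_rep M S) (sub_rep M T) u Q c" "simple_object (RC fg) Q"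
proof -
  let ?A = "sub_rep M S" and ?B = "sub_rep M T"
  have ST: "S x \<subseteq> T x" if "x \<in> P" for x using ext that by (simp add: minimal_extension_def)
  have A: "is_rep ?A" "fg ?A" and B: "is_rep ?B" "fg ?B"
    using sub_rep(1)[OF M(1)] S T sub_rep_fin_gen[OF nobad M(1)] M(2)
    by (auto simp: fg_def fin_gen_sub_rep)
  define u where "u = id_hom ?A"
  have u: "u \<in> homs ?A ?B" unfolding u_def
    by (rule ext_in_homs[OF naturalI A(1)]) (use ST in auto)
  have inc: "comp_hom ?A (id_hom ?B) u = id_hom ?A"
    by (rule ext_cong) (simp add: u_def subsetD[OF ST])
  have S': "subrep ?B S"
    by (rule subrepI) (use ST in \<open>auto simp: subrepD[OF S]\<close>)
  obtain Q :: "('p, 'f, 'v) representation" and c where Q: "is_rep Q" "fg Q" "c \<in> homs ?B Q"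
    "\<And>x. x \<in> P \<Longrightarrow> fibre Q x = c x ` fibre ?B x"
    "\<And>x v. x \<in> P \<Longrightarrow> v \<in> fibre ?B x \<Longrightarrow> c x v = \<zero>\<^bsub>Val Q x\<^esub> \<longleftrightarrow> v \<in> S x"
    using fg_quotient[OF B S'] by metis
  have rng: "u x ` S x = S x" if "x \<in> P" for x using sub_rep_range[OF that] by (simp add: u_def)
  have cok: "is_cokernel (RC fg) ?A ?B u Q c"
    by (intro cokernelI A B Q(1-3) u) (use Q(4,5) rng in auto)
  have "simple_object (RC fg) Q"
    unfolding simple_object_def
  proof (intro conjI allI impI)
    show "Q \<in> Obj (RC fg)" using Q(1,2) by simp
    show "\<not> zero_object (RC fg) Q"
    proof
      assume zero: "zero_object (RC fg) Q"
      obtain x where x: "x \<in> P" "S x \<noteq> T x" using ext by (auto simp: minimal_extension_def)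
      have "T x \<subseteq> S x"
        using zero_object_fibre[OF zero fg_hrep[OF x(1)] x(1)] Q(4,5)[OF x(1)] by auto
      then show False using x ST by blast
    qed
    fix D b assume mono: "is_mono (RC fg) D Q b"
    note m = RC_monoD[OF mono]
    note inj = mono_inj[OF mono fg_hrep]
    define U where "U x = {v \<in> T x. c x v \<in> b x ` fibre D x}" for x
    have "subrep ?B U"
      using subrep_vimage[OF B(1) Q(1,3) subrep_image[OF m(1,3,5) subrep_whole[OF m(1)]]] by (simp add: U_def[abs_def])
    from subrepD[OF this] have U: "subrep M U"
      by (intro subrepI) (auto simp: subrepD(1)[OF T])
    have bD: "b x \<zero>\<^bsub>Val D x\<^esub> = \<zero>\<^bsub>Val Q x\<^esub>" if "x \<in> P" for x by (rule hom_zero[OF m(5,1,3) that])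
    have "S x \<subseteq> U x \<and> U x \<subseteq> T x" if x: "x \<in> P" for x
    proof -
      have zero: "\<zero>\<^bsub>Val Q x\<^esub> \<in> b x ` fibre D x" using bD[OF x] rep_zero_closed[OF m(1) x] by (metis imageI)
      have "v \<in> U x" if "v \<in> S x" for v
        using zero Q(5)[OF x, of v] subsetD[OF ST[OF x] that] that unfolding U_def by simp
      then show ?thesis by (auto simp: U_def)
    qed
    then consider "\<forall>x\<in>P. U x = S x" | "\<forall>x\<in>P. U x = T x"
      using ext U unfolding minimal_extension_def by blast
    then show "zero_object (RC fg) D \<or> is_iso (RC fg) D Q b"
    proof cases
      case 1
      have "fibre D x \<subseteq> {\<zero>\<^bsub>Val D x\<^esub>}" if x: "x \<in> P" for x
      proof
        fix d assume d: "d \<in> fibre D x"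
        then have "b x d \<in> fibre Q x" using homD(1)[OF m(5) x] by blast
        then obtain v where v: "v \<in> T x" "b x d = c x v" using Q(4)[OF x] by auto
        have "v \<in> U x" unfolding U_def using v d by (auto intro!: image_eqI)
        then have "v \<in> S x" using 1 x by simp
        then have "b x d = b x \<zero>\<^bsub>Val D x\<^esub>" using v Q(5)[OF x] bD[OF x] by simp
        then show "d \<in> {\<zero>\<^bsub>Val D x\<^esub>}" using inj_onD[OF inj[OF x x]] d rep_zero_closed[OF m(1) x] by simp
      qed
      then have "zero_object (RC fg) D" using m(1,2) by (intro zero_objectI)
      then show ?thesis ..
    next
      case 2
      have "bij_betw (b x) (fibre D x) (fibre Q x)" if x: "x \<in> P" for x
      proof -
        have "fibre Q x \<subseteq> b x ` fibre D x" using 2 x Q(4)[OF x] by (auto simp: U_def)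
        then show ?thesis using inj[OF x x] homD(1)[OF m(5) x] by (auto simp: bij_betw_def)
      qed
      then have "is_iso (RC fg) D Q b" by (intro isoI m(1-5) Q(1,2))
      then show ?thesis ..
    qed
  qed
  then show ?thesis using that[OF u inc cok] by simp
qed

text \<open>
  The subrepresentations of \<open>finite_down_has_series\<close>, with their inclusions, form a composition series.
\<close>

lemma finite_down_finite_length:
  fixes M :: "('p, 'f, 'v) representation"
  assumes fin: "\<And>x. x \<in> P \<Longrightarrow> finite (down P r x)" and M: "is_rep M" "fg M"
  shows "finite_length_object (RC fg) M"
proof -
  have nobad: no_bad_sequences
    using finite_down_no_bad_sequence[OF fin] by (simp add: no_bad_sequences_def)
  obtain n S where series: "\<forall>k. subrep M (S k)" "\<forall>x\<in>P. S 0 x = {\<zero>\<^bsub>Val M x\<^esub>}"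
    "\<forall>x\<in>P. S n x = fibre M x" "\<forall>k<n. minimal_extension M (S k) (S (Suc k))"
    using finite_down_has_series[OF fin M] unfolding has_series_def by auto
  note S = series[rule_format]
  define A where "A k = sub_rep M (S k)" for k
  define a where "a k = id_hom (A k)" for k
  have A: "is_rep (A k)" "fg (A k)" "a k \<in> homs (A k) M" for k
    using sub_rep[OF M(1) S(1)] sub_rep_fin_gen[OF nobad M(1) _ S(1)] M(2)
    by (auto simp: A_def a_def fg_def fin_gen_sub_rep)
  have mono: "is_mono (RC fg) (A k) M (a k)" for k
    using A M by (intro monoI) (auto simp: a_def A_def intro: inj_onI)
  have zero: "zero_object (RC fg) (A 0)"
    using A(1,2) by (intro zero_objectI) (simp_all add: A_def S(2))
  have iso: "is_iso (RC fg) (A n) M (a n)"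
  proof -
    have "bij_betw (a n x) (fibre (A n) x) (fibre M x)" if x: "x \<in> P" for x
      using sub_rep_inj[OF x, of M "S n"] sub_rep_range[OF x, of M "S n"] S(3)[OF x]
      by (simp add: bij_betw_def a_def A_def)
    then show ?thesis using A M by (intro isoI)
  qed
  have step: "\<exists>u\<in>Hom (RC fg) (A k) (A (Suc k)).
      Comp (RC fg) (A k) (A (Suc k)) M (a (Suc k)) u = a k \<and>
      (\<exists>Q c. is_cokernel (RC fg) (A k) (A (Suc k)) u Q c \<and> simple_object (RC fg) Q)" if k: "k < n" for k
  proof -
    obtain u Q c where "u \<in> homs (sub_rep M (S k)) (sub_rep M (S (Suc k)))"
      "comp_hom (sub_rep M (S k)) (id_hom (sub_rep M (S (Suc k)))) u = id_hom (sub_rep M (S k))"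
      "is_cokernel (RC fg) (sub_rep M (S k)) (sub_rep M (S (Suc k))) u Q c" "simple_object (RC fg) Q"
      by (rule minimal_extension_quotient[OF nobad M S(1) S(1) S(4)[OF k]])
    then show ?thesis
      unfolding RC_simps A_def a_def by (intro bexI[of _ u] conjI exI[of _ Q] exI[of _ c])
  qed
  show ?thesis
    unfolding finite_length_object_def
    by (intro conjI exI[of _ n] exI[of _ A] exI[of _ a] allI impI)
      (use M in simp, (rule mono zero iso step; assumption?)+)
qed

end

section \<open>The two characterisations\<close>

theorem corollary18:
  fixes P :: "'p set" and r :: "'p rel" and F :: "'f ring"
    and C :: "('p, 'f, 'v) rep_category"
  assumes "partial_order_on P r"
    and "field F"
    \<comment> \<open>The universe \<open>'v\<close> in which vector spaces live is large enough to contain \<open>F\<^sup>n\<close> for all \<open>n\<close>.\<close>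
    and "\<exists>\<iota> :: 'f list \<Rightarrow> 'v. inj_on \<iota> (lists (carrier F))"
    and "C = rep P r F"
  shows "(abelian_category C \<and> (\<forall>X\<in>Obj C. finite_length_object C X) \<longleftrightarrow>
            (\<forall>x\<in>P. finite (down P r x)))
       \<and> (abelian_category C \<and> (\<forall>X\<in>Obj C. noetherian_object C X) \<longleftrightarrow>
            (\<forall>x\<in>P. ascending_chains_of_ideals_stabilise (down P r x) r))"
proof -
  obtain \<iota> :: "'f list \<Rightarrow> 'v" where \<iota>: "inj_on \<iota> (lists (carrier F))" using assms(3) by blast
  interpret poset_universe P r F \<iota>
    by (intro poset_universe.intro poset_over_field.intro poset_over_field_axioms.intro
        poset_universe_axioms.intro assms(1,2) \<iota>)
  have C: "C = RC (finitely_presented P r F)" unfolding assms(4) by (rule rep_as_RC)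
  have hrep: "hrep x \<in> Obj C" if "x \<in> P" for x
    unfolding C using hrep_rep[OF that] fp_hrep[OF that] by simp
  have C_fg: "C = RC fg" if no_bad_sequences
    unfolding assms(4) by (rule rep_as_RC_fg[OF that])
  show ?thesis
  proof (intro conjI iffI ballI)
    fix x assume *: "abelian_category C \<and> (\<forall>X\<in>Obj C. finite_length_object C X)" and x: "x \<in> P"
    have "finite (support (hrep x))"
      by (rule finite_length_imp_finite_support[folded C]) (use * hrep[OF x] in auto)
    with down_subset_support_hrep[OF x] show "finite (down P r x)" by (rule finite_subset)
  next
    assume fin: "\<forall>x\<in>P. finite (down P r x)"
    then have nobad: no_bad_sequences
      using finite_down_no_bad_sequence by (simp add: no_bad_sequences_def)
    show "abelian_category C" unfolding C_fg[OF nobad] by (rule fg_abelian[OF nobad])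
    show "finite_length_object C X" if "X \<in> Obj C" for X
      using that fin unfolding C_fg[OF nobad] by (intro finite_down_finite_length) auto
  next
    fix x assume *: "abelian_category C \<and> (\<forall>X\<in>Obj C. noetherian_object C X)" and x: "x \<in> P"
    have "\<not> bad_sequence x z" for z
      by (rule noetherian_imp_no_bad_sequence[folded C]) (use * hrep[OF x] x in auto)
    then show "ascending_chains_of_ideals_stabilise (down P r x) r"
      using ideal_chains_iff_no_bad_sequence[OF x] by blast
  next
    assume acc: "\<forall>x\<in>P. ascending_chains_of_ideals_stabilise (down P r x) r"
    then have nobad: no_bad_sequences
      using ideal_chains_iff_no_bad_sequence by (simp add: no_bad_sequences_def)
    show "abelian_category C" unfolding C_fg[OF nobad] by (rule fg_abelian[OF nobad])
    show "noetherian_object C X" if "X \<in> Obj C" for X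
      using that unfolding C_fg[OF nobad] by (intro fg_noetherian[OF nobad]) auto
  qed
qed

end
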